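(* Let $\mathbb{Z}_2=\langle\gamma\rangle$ and let $(G,p,\ell)$ be a $\mathbb{Z}_2$-regular point-line framework in $\mathbb{R}^2$ with respect to $\theta:\mathbb{Z}_2\to\mathrm{Aut}_{PH}(G)$ and $\tau:\mathbb{Z}_2\to\mathcal{C}_s$, where $G=(V_P\cup V_H,E)$, $|V_H|=2$ and $\theta$ acts freely on $V=V_P\cup V_H$. Let $(G_0,\psi)$ be the quotient $\mathbb{Z}_2$-gain graph of $G$. Then $(G,p,\ell)$ is infinitesimally rigid if and only if $(G_0,\psi)$ contains a spanning $(2,3,i)$-gain-tight subgraph $(H_i,\psi_i)$ for each $i=1,2$; and $(G,p,\ell)$ is forced $\mathbb{Z}_2$-symmetric infinitesimally rigid if and only if $(G_0,\psi)$ contains a spanning $(2,3,1)$-gain-tight subgraph $(H_1,\psi_1)$.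
   Context: $\mathcal{C}_s\subset O(\mathbb{R}^2)$ is generated by a reflection in a line through the origin; $\tau$ is an isomorphism onto it. $\mathrm{Aut}_{PH}(G)$ is the group of automorphisms of $G$ mapping $V_P$ to $V_P$ and $V_H$ to $V_H$. Write $\gamma i=\theta(\gamma)(i)$. Point-line framework $(G,p,\ell)$: $p:V_P\to\mathbb{R}^2$, $\ell=(a,r):V_H\to\mathbb{S}^1\times\mathbb{R}$ (vertex $j$ is the line $\{x:\langle a_j,x\rangle+r_j=0\}$), affinely spanning $\mathbb{R}^2$. Infinitesimal motions $(\dot p,\dot a,\dot r)$: $\langle p_i-p_j,\dot p_i-\dot p_j\rangle=0$ (point-point edges), $\langle p_i,\dot a_j\rangle+\langle\dot p_i,a_j\rangle+\dot r_j=0$ (edges with $i\in V_P,j\in V_H$), $\langle a_i,\dot a_j\rangle+\langle\dot a_i,a_j\rangle=0$ (line-line edges), $\langle a_i,\dot a_i\rangle=0$ ($i\in V_H$). Infinitesimally rigid: the motion space has dimension 3 (all motions trivial, induced by isometries). $\mathbb{Z}_2$-symmetric: $\tau(\delta)p(i)=p(\delta i)$, $\tau(\delta)a(j)=\pm a(\delta j)$, $r(j)=r(\delta j)$ for all $\delta\in\mathbb{Z}_2$; symmetric motions satisfy the same relations for velocities; forced $\mathbb{Z}_2$-symmetric infinitesimally rigid: every symmetric motion is trivial. $\mathbb{Z}_2$-regular: the coefficient matrix of the motion system has maximum rank among all $\mathbb{Z}_2$-symmetric point-line realisations of $G$ w.r.t. $\theta,\tau$ with the same partition. Quotient gain graph: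 $G_0$ has vertex set the vertex orbits and edge set the edge orbits (a loop is possible); each edge orbit between orbits $\Gamma i$ and $\Gamma j$ can be written uniquely as $\{\{\delta i,\delta\alpha j\}:\delta\in\mathbb{Z}_2\}$ for some $\alpha\in\mathbb{Z}_2$ (for fixed representatives $i,j$); orient it from $\Gamma i$ to $\Gamma j$ and set $\psi=\alpha$. A closed walk is balanced if the product of the gains (inverted on edges traversed against their orientation) is the identity; an edge set is balanced if all closed walks in it are balanced. $(G_0,\psi)$, or a subgraph with edge set $F_0$, is $(k,l,m)$-gain-sparse if $|F|\le k|V(F)|-l$ for all nonempty balanced $F\subseteq F_0$ and $|F|\le k|V(F)|-m$ for all $F\subseteq F_0$ (where $V(F)$ is the set of vertices incident to $F$); it is $(k,l,m)$-gain-tight if moreover it has exactly $k|V|-m$ edges, $|V|$ its number of vertices. A spanning subgraph has all vertices of $G_0$.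
   Formalization: The sign ± in τ(δ)a(j)=±a(δj) is also applied to r(j)=±r(δj), and likewise for velocities (with r(j)=r(δj) and sign −, the forced-symmetric claim fails); the second sparsity count ranges over nonempty F only, as F=∅ would violate it. *)

theory Defs
  imports "HOL-Analysis.Analysis" "HOL-Library.Z2"
begin

section \<open>Point-line frameworks in the plane\<close>

definition point_line_graph :: "'v::finite set \<Rightarrow> 'v set \<Rightarrow> 'v set set \<Rightarrow> bool" where
  "point_line_graph VP VH E \<longleftrightarrow>
     VP \<union> VH = UNIV \<and> VP \<inter> VH = {} \<and> (\<forall>e\<in>E. card e = 2)"

definition line_of :: "real^2 \<Rightarrow> real \<Rightarrow> (real^2) set" where
  "line_of n c = {x. n \<bullet> x + c = 0}"

text \<open>
  The values of \<open>p\<close> outside \<open>VP\<close> and of \<open>a\<close>, \<open>r\<close> outside \<open>VH\<close> are irrelevant.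
\<close>

definition point_line_framework ::
  "'v set \<Rightarrow> 'v set \<Rightarrow> ('v \<Rightarrow> real^2) \<Rightarrow> ('v \<Rightarrow> real^2) \<Rightarrow> ('v \<Rightarrow> real) \<Rightarrow> bool" where
  "point_line_framework VP VH p a r \<longleftrightarrow>
     (\<forall>j\<in>VH. norm (a j) = 1) \<and>
     affine hull (p ` VP \<union> (\<Union>j\<in>VH. line_of (a j) (r j))) = UNIV"

section \<open>Infinitesimal motions\<close>

text \<open>
  A velocity is a triple \<open>(p', a', r')\<close> indexed by all vertices; the coordinates that do not
  belong to \<open>V\<^sub>P\<close> (for \<open>p'\<close>) or to \<open>V\<^sub>H\<close> (for \<open>a'\<close> and \<open>r'\<close>) are required to vanish, so that
  the motion space has the dimension of the solution space of the motion system.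
\<close>

type_synonym 'v velocity = "((real^2)^'v) \<times> ((real^2)^'v) \<times> (real^'v)"

definition inf_motions ::
  "'v::finite set \<Rightarrow> 'v set \<Rightarrow> 'v set set \<Rightarrow> ('v \<Rightarrow> real^2) \<Rightarrow> ('v \<Rightarrow> real^2) \<Rightarrow> 'v velocity set" where
  "inf_motions VP VH E p a = {(p', a', r').
     (\<forall>i. i \<notin> VP \<longrightarrow> p' $ i = 0) \<and>
     (\<forall>j. j \<notin> VH \<longrightarrow> a' $ j = 0 \<and> r' $ j = 0) \<and>
     (\<forall>i\<in>VP. \<forall>j\<in>VP. {i, j} \<in> E \<longrightarrow> (p i - p j) \<bullet> (p' $ i - p' $ j) = 0) \<and>
     (\<forall>i\<in>VP. \<forall>j\<in>VH. {i, j} \<in> E \<longrightarrow> p i \<bullet> a' $ j + p' $ i \<bullet> a j + r' $ j = 0) \<and>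
     (\<forall>i\<in>VH. \<forall>j\<in>VH. {i, j} \<in> E \<longrightarrow> a i \<bullet> a' $ j + a' $ i \<bullet> a j = 0) \<and>
     (\<forall>i\<in>VH. a i \<bullet> a' $ i = 0)}"

definition infinitesimally_rigid ::
  "'v::finite set \<Rightarrow> 'v set \<Rightarrow> 'v set set \<Rightarrow> ('v \<Rightarrow> real^2) \<Rightarrow> ('v \<Rightarrow> real^2) \<Rightarrow> bool" where
  "infinitesimally_rigid VP VH E p a \<longleftrightarrow> dim (inf_motions VP VH E p a) = 3"

text \<open>
  Velocities induced by an infinitesimal isometry \<open>x \<mapsto> S x + t\<close> with \<open>S\<close> skew-symmetric.
  Moving the line \<open>{x. \<langle>a, x\<rangle> + r = 0}\<close> by \<open>x \<mapsto> R x + s\<close> gives the line with normal \<open>R a\<close> and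
  offset \<open>r - \<langle>R a, s\<rangle>\<close>, whose derivative at the identity is \<open>(S a, - \<langle>a, t\<rangle>)\<close>.
\<close>

definition trivial_velocity ::
  "'v::finite set \<Rightarrow> 'v set \<Rightarrow> ('v \<Rightarrow> real^2) \<Rightarrow> ('v \<Rightarrow> real^2) \<Rightarrow> 'v velocity \<Rightarrow> bool" where
  "trivial_velocity VP VH p a = (\<lambda>(p', a', r').
     \<exists>(S::real^2^2) t. transpose S = - S \<and>
       (\<forall>i\<in>VP. p' $ i = S *v p i + t) \<and>
       (\<forall>j\<in>VH. a' $ j = S *v a j \<and> r' $ j = - (a j \<bullet> t)))"

text \<open>
  The rows of the coefficient matrix of the motion system, as vectors of the space of
  velocities; the columns of coordinates required to vanish are zero.  As for \<open>rank\<close> in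
  HOL-Analysis, the rank is the dimension of the span of the rows.
\<close>

definition rigidity_rows ::
  "'v::finite set \<Rightarrow> 'v set \<Rightarrow> 'v set set \<Rightarrow> ('v \<Rightarrow> real^2) \<Rightarrow> ('v \<Rightarrow> real^2) \<Rightarrow> 'v velocity set" where
  "rigidity_rows VP VH E p a =
     {(axis i (p i - p j) + axis j (p j - p i), 0, 0) | i j. i \<in> VP \<and> j \<in> VP \<and> {i, j} \<in> E} \<union>
     {(axis i (a j), axis j (p i), axis j 1) | i j. i \<in> VP \<and> j \<in> VH \<and> {i, j} \<in> E} \<union>
     {(0, axis i (a j) + axis j (a i), 0) | i j. i \<in> VH \<and> j \<in> VH \<and> {i, j} \<in> E} \<union>
     {(0, axis i (a i), 0) | i. i \<in> VH}"

definition rigidity_rank ::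
  "'v::finite set \<Rightarrow> 'v set \<Rightarrow> 'v set set \<Rightarrow> ('v \<Rightarrow> real^2) \<Rightarrow> ('v \<Rightarrow> real^2) \<Rightarrow> nat" where
  "rigidity_rank VP VH E p a = dim (rigidity_rows VP VH E p a)"

lemma inner_axis_left: "axis i x \<bullet> (y :: 'b::real_inner^'v::finite) = x \<bullet> y $ i"
  by (metis inner_axis inner_commute)

lemma inf_motions_eq_orthogonal_rows:
  "inf_motions VP VH E p a = {(p', a', r').
     (\<forall>i. i \<notin> VP \<longrightarrow> p' $ i = 0) \<and> (\<forall>j. j \<notin> VH \<longrightarrow> a' $ j = 0 \<and> r' $ j = 0) \<and>
     (\<forall>\<rho>\<in>rigidity_rows VP VH E p a. \<rho> \<bullet> (p', a', r') = 0)}"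
proof -
  have 1: "(p i - p j) \<bullet> (p' $ i - p' $ j) =
      (axis i (p i - p j) + axis j (p j - p i), 0, 0) \<bullet> (p', a', r')"
    for i j and p' a' :: "(real^2)^'a" and r' :: "real^'a"
    by (simp add: inner_add_left inner_axis_left inner_diff_left inner_diff_right)
  have 2: "p i \<bullet> a' $ j + p' $ i \<bullet> a j + r' $ j =
      (axis i (a j), axis j (p i), axis j 1) \<bullet> (p', a', r')"
    for i j and p' a' :: "(real^2)^'a" and r' :: "real^'a"
    by (simp add: inner_axis_left inner_commute[of "p' $ i" "a j"])
  have 3: "a i \<bullet> a' $ j + a' $ i \<bullet> a j =
      (0, axis i (a j) + axis j (a i), 0) \<bullet> (p', a', r')"
    for i j and p' a' :: "(real^2)^'a" and r' :: "real^'a"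
    by (simp add: inner_add_left inner_axis_left inner_commute[of "a' $ i" "a j"])
  have 4: "a i \<bullet> a' $ i = (0, axis i (a i), 0) \<bullet> (p', a', r')"
    for i and p' a' :: "(real^2)^'a" and r' :: "real^'a"
    by (simp add: inner_axis_left)
  have "(x \<in> inf_motions VP VH E p a) = (case x of (p', a', r') \<Rightarrow>
     (\<forall>i. i \<notin> VP \<longrightarrow> p' $ i = 0) \<and> (\<forall>j. j \<notin> VH \<longrightarrow> a' $ j = 0 \<and> r' $ j = 0) \<and>
     (\<forall>\<rho>\<in>rigidity_rows VP VH E p a. \<rho> \<bullet> (p', a', r') = 0))" for x
  proof (cases x)
    case (fields p' a' r')
    show ?thesis
      unfolding fields inf_motions_def rigidity_rows_def mem_Collect_eq prod.case
        1[of _ _ p' a' r'] 2[of _ a' _ p' r'] 3[of _ a' _ p' r'] 4[of _ a' p' r']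
      by blast
  qed
  then show ?thesis by (intro set_eqI) (simp only: mem_Collect_eq)
qed

section \<open>Reflection symmetry\<close>

text \<open>
  The type \<open>bit\<close> is the integers modulo 2; the group \<open>\<int>\<^sub>2 = \<langle>\<gamma>\<rangle>\<close> is its additive group,
  with identity \<open>0\<close> and \<open>\<gamma> = 1\<close>.
\<close>

definition Aut_PH :: "'v set \<Rightarrow> 'v set \<Rightarrow> 'v set set \<Rightarrow> ('v \<Rightarrow> 'v) set" where
  "Aut_PH VP VH E = {f. bij f \<and> (\<forall>i j. {f i, f j} \<in> E \<longleftrightarrow> {i, j} \<in> E) \<and>
     f ` VP = VP \<and> f ` VH = VH}"

definition Aut_PH_action ::
  "'v set \<Rightarrow> 'v set \<Rightarrow> 'v set set \<Rightarrow> (bit \<Rightarrow> 'v \<Rightarrow> 'v) \<Rightarrow> bool" where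
  "Aut_PH_action VP VH E \<theta> \<longleftrightarrow>
     (\<forall>\<delta>. \<theta> \<delta> \<in> Aut_PH VP VH E) \<and> (\<forall>\<delta> \<epsilon>. \<theta> (\<delta> + \<epsilon>) = \<theta> \<delta> \<circ> \<theta> \<epsilon>)"

definition free_action :: "(bit \<Rightarrow> 'v \<Rightarrow> 'v) \<Rightarrow> bool" where
  "free_action \<theta> \<longleftrightarrow> (\<forall>\<delta> i. \<theta> \<delta> i = i \<longrightarrow> \<delta> = 0)"

text \<open>Reflection in the line through the origin with unit normal \<open>n\<close>.\<close>

definition reflection :: "real^2 \<Rightarrow> real^2 \<Rightarrow> real^2" where
  "reflection n x = x - (2 * (n \<bullet> x)) *\<^sub>R n"

definition iso_onto_Cs :: "(bit \<Rightarrow> real^2 \<Rightarrow> real^2) \<Rightarrow> bool" where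
  "iso_onto_Cs \<tau> \<longleftrightarrow> (\<exists>n. norm n = 1 \<and> bij_betw \<tau> UNIV {id, reflection n}) \<and>
     (\<forall>\<delta> \<epsilon>. \<tau> (\<delta> + \<epsilon>) = \<tau> \<delta> \<circ> \<tau> \<epsilon>)"

text \<open>
  Since \<open>(a, r)\<close> and \<open>(-a, -r)\<close> describe the same line, the sign \<open>\<sigma>\<close> relating the normals
  also relates the offsets: \<open>\<tau> \<delta>\<close> maps the line \<open>j\<close> to the line \<open>\<delta> j\<close>.
\<close>

definition symmetric_framework ::
  "'v set \<Rightarrow> 'v set \<Rightarrow> (bit \<Rightarrow> 'v \<Rightarrow> 'v) \<Rightarrow> (bit \<Rightarrow> real^2 \<Rightarrow> real^2) \<Rightarrow>
   ('v \<Rightarrow> real^2) \<Rightarrow> ('v \<Rightarrow> real^2) \<Rightarrow> ('v \<Rightarrow> real) \<Rightarrow> bool" where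
  "symmetric_framework VP VH \<theta> \<tau> p a r \<longleftrightarrow>
     point_line_framework VP VH p a r \<and>
     (\<forall>\<delta>. \<forall>i\<in>VP. \<tau> \<delta> (p i) = p (\<theta> \<delta> i)) \<and>
     (\<forall>\<delta>. \<forall>j\<in>VH. \<exists>\<sigma>\<in>{1, -1}. \<tau> \<delta> (a j) = \<sigma> *\<^sub>R a (\<theta> \<delta> j) \<and> r j = \<sigma> * r (\<theta> \<delta> j))"

text \<open>The sign for the velocities of a line is the one occurring for its position.\<close>

definition symmetric_velocity ::
  "'v::finite set \<Rightarrow> 'v set \<Rightarrow> (bit \<Rightarrow> 'v \<Rightarrow> 'v) \<Rightarrow> (bit \<Rightarrow> real^2 \<Rightarrow> real^2) \<Rightarrow>
   ('v \<Rightarrow> real^2) \<Rightarrow> 'v velocity \<Rightarrow> bool" where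
  "symmetric_velocity VP VH \<theta> \<tau> a = (\<lambda>(p', a', r').
     (\<forall>\<delta>. \<forall>i\<in>VP. \<tau> \<delta> (p' $ i) = p' $ (\<theta> \<delta> i)) \<and>
     (\<forall>\<delta>. \<forall>j\<in>VH. \<exists>\<sigma>\<in>{1, -1}. \<tau> \<delta> (a j) = \<sigma> *\<^sub>R a (\<theta> \<delta> j) \<and>
        \<tau> \<delta> (a' $ j) = \<sigma> *\<^sub>R a' $ (\<theta> \<delta> j) \<and> r' $ j = \<sigma> * r' $ (\<theta> \<delta> j)))"

definition forced_symmetric_rigid ::
  "'v::finite set \<Rightarrow> 'v set \<Rightarrow> 'v set set \<Rightarrow> (bit \<Rightarrow> 'v \<Rightarrow> 'v) \<Rightarrow> (bit \<Rightarrow> real^2 \<Rightarrow> real^2) \<Rightarrow>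
   ('v \<Rightarrow> real^2) \<Rightarrow> ('v \<Rightarrow> real^2) \<Rightarrow> bool" where
  "forced_symmetric_rigid VP VH E \<theta> \<tau> p a \<longleftrightarrow>
     (\<forall>m \<in> inf_motions VP VH E p a.
        symmetric_velocity VP VH \<theta> \<tau> a m \<longrightarrow> trivial_velocity VP VH p a m)"

definition regular_framework ::
  "'v::finite set \<Rightarrow> 'v set \<Rightarrow> 'v set set \<Rightarrow> (bit \<Rightarrow> 'v \<Rightarrow> 'v) \<Rightarrow> (bit \<Rightarrow> real^2 \<Rightarrow> real^2) \<Rightarrow>
   ('v \<Rightarrow> real^2) \<Rightarrow> ('v \<Rightarrow> real^2) \<Rightarrow> ('v \<Rightarrow> real) \<Rightarrow> bool" where
  "regular_framework VP VH E \<theta> \<tau> p a r \<longleftrightarrow>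
     symmetric_framework VP VH \<theta> \<tau> p a r \<and>
     (\<forall>q b s. symmetric_framework VP VH \<theta> \<tau> q b s \<longrightarrow>
        rigidity_rank VP VH E q b \<le> rigidity_rank VP VH E p a)"

section \<open>Gain graphs\<close>

text \<open>Multigraphs with loops; the gain group is written additively.\<close>

record ('a, 'b, 'g) gain_graph =
  gverts :: "'a set"
  gedges :: "'b set"
  gtail :: "'b \<Rightarrow> 'a"
  ghead :: "'b \<Rightarrow> 'a"
  ggain :: "'b \<Rightarrow> 'g"

text \<open>A step \<open>(e, True)\<close> of a walk follows the orientation of \<open>e\<close>, a step \<open>(e, False)\<close> reverses it.\<close>

fun step_from :: "('a, 'b, 'g) gain_graph \<Rightarrow> 'b \<times> bool \<Rightarrow> 'a" where
  "step_from G (e, d) = (if d then gtail G e else ghead G e)"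

fun step_to :: "('a, 'b, 'g) gain_graph \<Rightarrow> 'b \<times> bool \<Rightarrow> 'a" where
  "step_to G (e, d) = (if d then ghead G e else gtail G e)"

fun step_gain :: "('a, 'b, 'g::group_add) gain_graph \<Rightarrow> 'b \<times> bool \<Rightarrow> 'g" where
  "step_gain G (e, d) = (if d then ggain G e else - ggain G e)"

fun gwalk :: "('a, 'b, 'g) gain_graph \<Rightarrow> 'b set \<Rightarrow> 'a \<Rightarrow> ('b \<times> bool) list \<Rightarrow> 'a \<Rightarrow> bool" where
  "gwalk G F u [] v \<longleftrightarrow> u = v"
| "gwalk G F u (s # w) v \<longleftrightarrow> fst s \<in> F \<and> step_from G s = u \<and> gwalk G F (step_to G s) w v"

definition balanced :: "('a, 'b, 'g::group_add) gain_graph \<Rightarrow> 'b set \<Rightarrow> bool" where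
  "balanced G F \<longleftrightarrow> (\<forall>u w. gwalk G F u w u \<longrightarrow> sum_list (map (step_gain G) w) = 0)"

definition incident_verts :: "('a, 'b, 'g) gain_graph \<Rightarrow> 'b set \<Rightarrow> 'a set" where
  "incident_verts G F = gtail G ` F \<union> ghead G ` F"

text \<open>
  For \<open>m > 0\<close> the empty edge set violates the second inequality, so both conditions range over
  nonempty \<open>F\<close>.
\<close>

definition gain_sparse :: "int \<Rightarrow> int \<Rightarrow> int \<Rightarrow> ('a, 'b, 'g::group_add) gain_graph \<Rightarrow> bool" where
  "gain_sparse k l m G \<longleftrightarrow> (\<forall>F \<subseteq> gedges G. F \<noteq> {} \<longrightarrow>
     (balanced G F \<longrightarrow> int (card F) \<le> k * int (card (incident_verts G F)) - l) \<and>
     int (card F) \<le> k * int (card (incident_verts G F)) - m)"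

definition gain_tight :: "int \<Rightarrow> int \<Rightarrow> int \<Rightarrow> ('a, 'b, 'g::group_add) gain_graph \<Rightarrow> bool" where
  "gain_tight k l m G \<longleftrightarrow> gain_sparse k l m G \<and>
     int (card (gedges G)) = k * int (card (gverts G)) - m"

definition spanning_gain_subgraph ::
  "('a, 'b, 'g) gain_graph \<Rightarrow> ('a, 'b, 'g) gain_graph \<Rightarrow> bool" where
  "spanning_gain_subgraph H G \<longleftrightarrow> gverts H = gverts G \<and> gedges H \<subseteq> gedges G \<and>
     (\<forall>e \<in> gedges H. gtail H e = gtail G e \<and> ghead H e = ghead G e \<and> ggain H e = ggain G e)"

definition vertex_orbit :: "(bit \<Rightarrow> 'v \<Rightarrow> 'v) \<Rightarrow> 'v \<Rightarrow> 'v set" where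
  "vertex_orbit \<theta> i = {\<theta> \<delta> i | \<delta>. True}"

definition edge_orbit :: "(bit \<Rightarrow> 'v \<Rightarrow> 'v) \<Rightarrow> 'v set \<Rightarrow> 'v set set" where
  "edge_orbit \<theta> e = {\<theta> \<delta> ` e | \<delta>. True}"

text \<open>
  The quotient gain graph depends on the choice of orbit representatives \<open>rep\<close> and of
  the orientations; the predicate holds for the gain graphs arising from all such choices.
\<close>

definition quotient_gain_graph ::
  "'v set set \<Rightarrow> (bit \<Rightarrow> 'v \<Rightarrow> 'v) \<Rightarrow> ('v set, 'v set set, bit) gain_graph \<Rightarrow> bool" where
  "quotient_gain_graph E \<theta> G0 \<longleftrightarrow>
     gverts G0 = range (vertex_orbit \<theta>) \<and>
     gedges G0 = edge_orbit \<theta> ` E \<and>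
     (\<exists>rep. (\<forall>X \<in> gverts G0. rep X \<in> X) \<and>
       (\<forall>e \<in> gedges G0. gtail G0 e \<in> gverts G0 \<and> ghead G0 e \<in> gverts G0 \<and>
          e = {{\<theta> \<delta> (rep (gtail G0 e)), \<theta> (\<delta> + ggain G0 e) (rep (ghead G0 e))} | \<delta>. True}))"

end

theory Submission
  imports Defs
begin

text \<open>
  In homogeneous coordinates a point \<open>p\<close> becomes \<open>(p, 1)\<close> and a line with normal \<open>a\<close> becomes
  \<open>(a, 0)\<close>; the bar between \<open>x\<close> and \<open>y\<close> then contributes \<open>x \<times> y\<close> to the rigidity matrix.  This
  treats points and lines alike, and the independence of rows is invariant under linear maps
  commuting with the reflection and under rescaling of vertices.  Since one such map moves any pair
  of mirror images to infinity, two lines exchanged by the reflection impose no restriction on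
  generic placements in \<open>\<real>\<^sup>3\<close>.  The motion space splits into a symmetric and an antisymmetric block,
  indexed by the quotient gain graph.  Trivial motions show that independent rows of the
  symmetric (antisymmetric) block are (2,3,1)-sparse ((2,3,2)-sparse).  Conversely, a sparse graph
  has a vertex of degree at most 3, and deleting it, with the addition of an edge between two of its
  neighbours if the degree is 3, leaves a sparse graph; the inverse operations preserve
  independence for a suitable position of the new vertex.  As independence is an open algebraic
  condition, both blocks attain their maximal rank simultaneously, which is
  what regularity means.
\<close>

section \<open>Generic properties and independence\<close>

text \<open>The constants 1 and 2 count trivial motions: translation along the mirror is symmetric,
  while rotation and translation across the mirror are antisymmetric. With \<open>U\<close> a set of
  orbit representatives, each block has 2 coordinates per element of \<open>U\<close>, so the two
  ranks are at most 2|U| - 1 and 2|U| - 2, and rigidity is equality in both. The constant 3 arises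
  because the ends of a balanced edge set lift consistently to the covering graph, where all three
  trivial motions survive in either block. Regularity maximises only the sum of the two ranks. Hence
  a single placement has to serve both blocks, and the maximum of one rank is read off by keeping an
  optimal edge set of the other fixed. The combinatorial obstacle is a vertex of degree 3 all of
  whose candidate edges are blocked by tight sets, that is, sets for which a sparsity inequality is
  an equality. Such sets are merged by inclusion-exclusion; for two balanced ones the outcome
  depends on whether their potentials agree on all common vertices.\<close>

definition generically :: "('a::real_normed_vector \<Rightarrow> bool) \<Rightarrow> bool" where
  "generically P \<longleftrightarrow>
     (\<exists>f. real_polynomial_function f \<and> (\<exists>x. f x \<noteq> 0) \<and> (\<forall>x. f x \<noteq> 0 \<longrightarrow> P x))"

lemma generically_ex: "generically P \<Longrightarrow> \<exists>x. P x"
  by (auto simp: generically_def)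

lemma generically_mono: "generically P \<Longrightarrow> (\<And>x. P x \<Longrightarrow> Q x) \<Longrightarrow> generically Q"
  by (auto simp: generically_def)

lemma generically_True: "generically (\<lambda>x. True)"
  unfolding generically_def by (intro exI[of _ "\<lambda>x. 1"]) auto

lemma real_polynomial_function_finite_zeros:
  fixes f :: "real \<Rightarrow> real"
  assumes "real_polynomial_function f" "f a \<noteq> 0"
  shows "finite {t. f t = 0}"
proof -
  obtain c n where f: "f = (\<lambda>x. \<Sum>i\<le>n. c i * x ^ i)"
    using assms(1) real_polynomial_function_iff_sum by blast
  with assms(2) have "\<exists>i\<le>n. c i \<noteq> 0"
    by (metis (mono_tags, lifting) atMost_iff mult_zero_left sum.neutral)
  then show ?thesis
    unfolding f using polyfun_finite_roots by (metis (no_types))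
qed

text \<open>On the line joining a point where \<open>f\<close> is nonzero to one where
  \<open>g\<close> is nonzero, both restrict to nonzero polynomials in one variable. Each has
  finitely many zeros there, so some point of the line avoids both, and the product
  \<open>f x * g x\<close> is a witness.\<close>

lemma generically_conj:
  assumes "generically P" "generically Q"
  shows "generically (\<lambda>x. P x \<and> Q x)"
proof -
  obtain f a where f: "real_polynomial_function f" "f a \<noteq> 0" "\<And>x. f x \<noteq> 0 \<Longrightarrow> P x"
    using assms(1) by (auto simp: generically_def)
  obtain g b where g: "real_polynomial_function g" "g b \<noteq> 0" "\<And>x. g x \<noteq> 0 \<Longrightarrow> Q x"
    using assms(2) by (auto simp: generically_def)
  define h where "h t = a + t *\<^sub>R (b - a)" for t :: real
  have "polynomial_function h"
    unfolding h_def
    by (intro polynomial_function_add polynomial_function_mult polynomial_function_const)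
       (auto simp: real_polynomial_function_eq)
  then have fh: "real_polynomial_function (f \<circ> h)" and gh: "real_polynomial_function (g \<circ> h)"
    using f(1) g(1) by auto
  have "finite {t. (f \<circ> h) t = 0}"
    by (rule real_polynomial_function_finite_zeros[OF fh, of 0]) (simp add: h_def f(2))
  moreover have "finite {t. (g \<circ> h) t = 0}"
    by (rule real_polynomial_function_finite_zeros[OF gh, of 1]) (simp add: h_def g(2))
  ultimately have "finite ({t. (f \<circ> h) t = 0} \<union> {t. (g \<circ> h) t = 0})"
    by (rule finite_UnI)
  then obtain t where "t \<notin> {t. (f \<circ> h) t = 0} \<union> {t. (g \<circ> h) t = 0}"
    using ex_new_if_finite infinite_UNIV_char_0 by blast
  then have "f (h t) * g (h t) \<noteq> 0" by simp
  then show ?thesis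
    unfolding generically_def
    by (intro exI[of _ "\<lambda>x. f x * g x"]) (use f g in auto)
qed

lemma generically_ball:
  assumes "finite A" "\<And>i. i \<in> A \<Longrightarrow> generically (P i)"
  shows "generically (\<lambda>x. \<forall>i\<in>A. P i x)"
  using assms
proof (induction A rule: finite_induct)
  case empty
  then show ?case by (simp add: generically_True)
next
  case (insert i A)
  then have "generically (\<lambda>x. P i x \<and> (\<forall>i\<in>A. P i x))"
    by (intro generically_conj) auto
  then show ?case by (rule generically_mono) auto
qed

lemma polynomial_function_bilinear:
  fixes h :: "'b::euclidean_space \<Rightarrow> 'c::euclidean_space \<Rightarrow> 'd::real_normed_vector"
  assumes h: "bilinear h" and f: "polynomial_function f" and g: "polynomial_function g"
  shows "polynomial_function (\<lambda>x. h (f x) (g x))"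
proof -
  have *: "h (f x) (g x) = (\<Sum>i\<in>Basis. \<Sum>j\<in>Basis. ((f x \<bullet> i) * (g x \<bullet> j)) *\<^sub>R h i j)" for x
  proof -
    have "h (f x) (g x) = h (\<Sum>i\<in>Basis. (f x \<bullet> i) *\<^sub>R i) (\<Sum>j\<in>Basis. (g x \<bullet> j) *\<^sub>R j)"
      by (simp add: euclidean_representation)
    also have "\<dots> = (\<Sum>(i, j)\<in>Basis \<times> Basis. h ((f x \<bullet> i) *\<^sub>R i) ((g x \<bullet> j) *\<^sub>R j))"
      by (rule bilinear_sum[OF h])
    also have "\<dots> = (\<Sum>(i, j)\<in>Basis \<times> Basis. ((f x \<bullet> i) * (g x \<bullet> j)) *\<^sub>R h i j)"
      by (simp add: bilinear_lmul[OF h] bilinear_rmul[OF h] mult.commute)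
    finally show ?thesis by (simp add: sum.cartesian_product)
  qed
  have "real_polynomial_function (\<lambda>x. f x \<bullet> i)" "real_polynomial_function (\<lambda>x. g x \<bullet> j)" for i j
    using f[unfolded polynomial_function_def, rule_format, OF bounded_linear_inner_left]
      g[unfolded polynomial_function_def, rule_format, OF bounded_linear_inner_left]
    by (simp_all add: o_def)
  then have "polynomial_function (\<lambda>x. (f x \<bullet> i) * (g x \<bullet> j))" for i j
    unfolding real_polynomial_function_eq[symmetric] by (intro real_polynomial_function.intros(4))
  then show ?thesis
    unfolding *
    by (intro polynomial_function_sum finite_Basis polynomial_function_mult
          polynomial_function_const)
qed

text \<open>Indexed by edges, so that two edges with the same row count as dependent; independence
  of the set of rows would merge them.\<close>

definition indep_family :: "'e set \<Rightarrow> ('e \<Rightarrow> 'a::real_vector) \<Rightarrow> bool" where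
  "indep_family F r \<longleftrightarrow> (\<forall>c. (\<Sum>e\<in>F. c e *\<^sub>R r e) = 0 \<longrightarrow> (\<forall>e\<in>F. c e = 0))"

lemma indep_familyD:
  "indep_family F r \<Longrightarrow> (\<Sum>e\<in>F. c e *\<^sub>R r e) = 0 \<Longrightarrow> e \<in> F \<Longrightarrow> c e = 0"
  unfolding indep_family_def by blast

lemma indep_family_subset:
  assumes "indep_family F r" "T \<subseteq> F" "finite F"
  shows "indep_family T r"
  unfolding indep_family_def
proof (intro allI impI)
  fix c assume "(\<Sum>e\<in>T. c e *\<^sub>R r e) = 0"
  moreover have "(\<Sum>e\<in>F. (if e \<in> T then c e else 0) *\<^sub>R r e) = (\<Sum>e\<in>T. c e *\<^sub>R r e)"
    using assms(2,3) by (intro sum.mono_neutral_cong_right) auto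
  ultimately have "\<forall>e\<in>F. (if e \<in> T then c e else 0) = 0"
    using indep_familyD[OF assms(1), of "\<lambda>e. if e \<in> T then c e else 0"] by simp
  then show "\<forall>e\<in>T. c e = 0" using assms(2) by (metis subsetD)
qed

lemma indep_family_iff_independent:
  fixes r :: "'e \<Rightarrow> 'a::euclidean_space"
  assumes "finite F"
  shows "indep_family F r \<longleftrightarrow> inj_on r F \<and> independent (r ` F)"
proof
  assume L: "indep_family F r"
  have inj: "inj_on r F"
  proof (rule inj_onI, rule ccontr)
    fix x y assume xy: "x \<in> F" "y \<in> F" "r x = r y" "x \<noteq> y"
    have "(\<Sum>e\<in>F. ((if e = x then 1 else 0) - (if e = y then 1 else 0)) *\<^sub>R r e) = r x - r y"
      using assms xy by (simp add: scaleR_diff_left sum_subtractf if_distrib[of "\<lambda>c. c *\<^sub>R _"] sum.delta cong: if_cong)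
    then have "((if x = x then 1 else 0) - (if x = y then 1 else 0)) = (0::real)"
      using indep_familyD[OF L, of "\<lambda>e. (if e = x then 1 else 0) - (if e = y then 1 else 0)" x] xy by simp
    then show False using xy by simp
  qed
  have "u (r x) = 0" if "(\<Sum>v\<in>r ` F. u v *\<^sub>R v) = 0" "x \<in> F" for u x
    using that indep_familyD[OF L, of "u \<circ> r"] by (simp add: sum.reindex[OF inj])
  then show "inj_on r F \<and> independent (r ` F)"
    using inj assms by (auto simp: independent_explicit)
next
  assume R: "inj_on r F \<and> independent (r ` F)"
  show "indep_family F r"
    unfolding indep_family_def
  proof (intro allI impI)
    fix c assume "(\<Sum>e\<in>F. c e *\<^sub>R r e) = 0"
    then have "(\<Sum>v\<in>r ` F. c (inv_into F r v) *\<^sub>R v) = 0"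
      using R by (simp add: sum.reindex)
    then show "\<forall>e\<in>F. c e = 0"
      using R unfolding independent_explicit by (auto simp: inv_into_f_f)
  qed
qed

text \<open>This turns independence into the nonvanishing of one polynomial in the rows. The Gram
  matrix of \<open>F\<close> is padded by an identity block, so that its index type does not depend
  on \<open>F\<close>. A kernel vector gives a combination of the rows that is orthogonal to each of
  them, hence to itself.\<close>

lemma indep_family_iff_gram:
  fixes r :: "'e::finite \<Rightarrow> 'a::real_inner"
  shows "indep_family F r \<longleftrightarrow>
    det (\<chi> e f. if e \<in> F \<and> f \<in> F then r e \<bullet> r f else if e = f then 1 else 0 :: real^'e^'e) \<noteq> 0"
    (is "_ \<longleftrightarrow> det ?A \<noteq> 0")
proof -
  have Ax: "(?A *v x) $ e = (if e \<in> F then r e \<bullet> (\<Sum>f\<in>F. x $ f *\<^sub>R r f) else x $ e)" for x e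
  proof (cases "e \<in> F")
    case True
    then have "(?A *v x) $ e = (\<Sum>f\<in>UNIV. if f \<in> F then r e \<bullet> r f * x $ f else 0)"
      by (auto simp: matrix_vector_mult_def intro!: sum.cong)
    also have "\<dots> = (\<Sum>f\<in>F. r e \<bullet> r f * x $ f)"
      by (subst sum.inter_restrict[symmetric]) auto
    finally show ?thesis using True by (simp add: inner_sum_right mult.commute)
  next
    case False
    then show ?thesis
      by (simp add: matrix_vector_mult_def if_distrib[of "\<lambda>c. c * _"] sum.delta cong: if_cong)
  qed
  have "indep_family F r \<longleftrightarrow> (\<forall>x. ?A *v x = 0 \<longrightarrow> x = 0)"
  proof (intro iffI allI impI)
    fix x assume L: "indep_family F r" and 0: "?A *v x = 0"
    let ?s = "\<Sum>f\<in>F. x $ f *\<^sub>R r f"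
    have "\<And>e. e \<in> F \<Longrightarrow> r e \<bullet> ?s = 0" using Ax[of x] unfolding 0 zero_index by presburger
    then have "?s \<bullet> ?s = 0" by (subst inner_sum_left) simp
    then have "\<And>e. e \<in> F \<Longrightarrow> x $ e = 0" using indep_familyD[OF L, of "\<lambda>e. x $ e"] by simp
    moreover have "\<And>e. e \<notin> F \<Longrightarrow> x $ e = 0" using Ax[of x] unfolding 0 zero_index by presburger
    ultimately show "x = 0" by (metis vec_eq_iff zero_index)
  next
    assume R: "\<forall>x. ?A *v x = 0 \<longrightarrow> x = 0"
    show "indep_family F r"
      unfolding indep_family_def
    proof (intro allI impI ballI)
      fix c e assume c: "(\<Sum>e\<in>F. c e *\<^sub>R r e) = 0" and e: "e \<in> F"
      let ?x = "\<chi> e. if e \<in> F then c e else 0"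
      have "(\<Sum>f\<in>F. ?x $ f *\<^sub>R r f) = 0" using c by simp
      then have "?A *v ?x = 0" unfolding vec_eq_iff Ax by simp
      then have "?x = 0" using R by blast
      then have "?x $ e = 0" by (simp only: zero_index)
      then show "c e = 0" using e by simp
    qed
  qed
  then show ?thesis
    unfolding invertible_det_nz[symmetric] invertible_left_inverse matrix_left_invertible_ker .
qed

lemma generically_indep_family:
  fixes r :: "'a::real_normed_vector \<Rightarrow> 'e::finite \<Rightarrow> 'b::euclidean_space"
  assumes r: "\<And>e. polynomial_function (\<lambda>Y. r Y e)" and 0: "indep_family F (r Y0)"
  shows "generically (\<lambda>Y. indep_family F (r Y))"
proof -
  have *: "real_polynomial_function (\<lambda>Y. r Y e \<bullet> r Y f)" for e f
    using polynomial_function_bilinear[OF _ r r, of inner]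
    by (simp add: real_polynomial_function_eq bilinear_def linear_iff inner_add_left inner_add_right)
  have "real_polynomial_function (\<lambda>Y. if e \<in> F \<and> f \<in> F then r Y e \<bullet> r Y f
      else if e = f then 1 else 0)" for e f
  proof (cases "e \<in> F \<and> f \<in> F")
    case True
    then show ?thesis by (simp add: *)
  next
    case False
    show ?thesis unfolding if_not_P[OF False] by (rule real_polynomial_function.intros(2))
  qed
  then have "real_polynomial_function (\<lambda>Y. det (\<chi> e f. if e \<in> F \<and> f \<in> F then r Y e \<bullet> r Y f
      else if e = f then 1 else 0 :: real^'e^'e))"
    unfolding det_def vec_lambda_beta
    by (intro real_polynomial_function_sum real_polynomial_function.intros(2,4)
          real_polynomial_function_prod) auto
  then show ?thesis
    unfolding generically_def indep_family_iff_gram using 0[unfolded indep_family_iff_gram]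
    by blast
qed

lemma generically_nonzero:
  "real_polynomial_function f \<Longrightarrow> f x \<noteq> 0 \<Longrightarrow> generically (\<lambda>x. f x \<noteq> 0)"
  unfolding generically_def by blast

section \<open>Sparsity of signed graphs\<close>

declare add_bit_eq_xor [simp del] mult_bit_eq_and [simp del]

instance bit :: finite
proof
  have U: "(UNIV :: bit set) = {0, 1}" by (auto intro: bit.exhaust)
  show "finite (UNIV :: bit set)" unfolding U by simp
qed

lemma bit_add_self [simp]: "a + a = 0" for a :: bit
  by (cases a) auto

text \<open>
  A triple \<open>(u, w, \<alpha>)\<close> of vertex representatives and a gain stands for the edge orbit
  \<open>{{\<delta> u, \<delta> \<alpha> w} | \<delta>}\<close>.  An edge set is balanced iff it has a potential.
\<close>

type_synonym 'v sedge = "'v \<times> 'v \<times> bit"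

definition sverts :: "'v sedge set \<Rightarrow> 'v set" where
  "sverts F = fst ` F \<union> (fst \<circ> snd) ` F"

definition potential :: "('v \<Rightarrow> bit) \<Rightarrow> 'v sedge set \<Rightarrow> bool" where
  "potential \<phi> F \<longleftrightarrow> (\<forall>u w \<alpha>. (u, w, \<alpha>) \<in> F \<longrightarrow> \<phi> u + \<phi> w = \<alpha>)"

definition signed_sparse :: "nat \<Rightarrow> 'v sedge set \<Rightarrow> bool" where
  "signed_sparse m F \<longleftrightarrow> (\<forall>T\<subseteq>F. T \<noteq> {} \<longrightarrow>
     ((\<exists>\<phi>. potential \<phi> T) \<longrightarrow> card T + 3 \<le> 2 * card (sverts T)) \<and>
     card T + m \<le> 2 * card (sverts T))"

text \<open>Sparsity bounds this number from below, by \<open>m\<close> for nonempty sets and by 3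
  for balanced ones; integers avoid truncated subtraction in the estimates for unions.\<close>

definition dof :: "'v sedge set \<Rightarrow> int" where
  "dof T = 2 * int (card (sverts T)) - int (card T)"

lemma sverts_Un: "sverts (A \<union> B) = sverts A \<union> sverts B"
  by (auto simp: sverts_def)

lemma sverts_insert: "sverts (insert (u, w, \<alpha>) A) = insert u (insert w (sverts A))"
  by (auto simp: sverts_def)

lemma sverts_empty [simp]: "sverts {} = {}"
  by (simp add: sverts_def)

lemma sverts_mono: "A \<subseteq> B \<Longrightarrow> sverts A \<subseteq> sverts B"
  by (auto simp: sverts_def)

lemma in_sverts: "(u, w, \<alpha>) \<in> A \<Longrightarrow> u \<in> sverts A" "(u, w, \<alpha>) \<in> A \<Longrightarrow> w \<in> sverts A"
  by (force simp: sverts_def)+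

lemma potential_subset: "potential \<phi> F \<Longrightarrow> T \<subseteq> F \<Longrightarrow> potential \<phi> T"
  by (auto simp: potential_def)

lemma signed_sparse_subset: "signed_sparse m F \<Longrightarrow> T \<subseteq> F \<Longrightarrow> signed_sparse m T"
  unfolding signed_sparse_def by (meson order_trans)

lemma signed_sparse_dof:
  assumes "signed_sparse m F" "T \<subseteq> F" "T \<noteq> {}"
  shows "int m \<le> dof T" and "potential \<phi> T \<Longrightarrow> 3 \<le> dof T"
proof -
  have "card T + m \<le> 2 * card (sverts T)" "potential \<phi> T \<Longrightarrow> card T + 3 \<le> 2 * card (sverts T)"
    using assms unfolding signed_sparse_def by blast+
  then show "int m \<le> dof T" and "potential \<phi> T \<Longrightarrow> 3 \<le> dof T"
    unfolding dof_def by linarith+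
qed

section \<open>Unions of tight sets\<close>

lemma dof_Un:
  fixes A B :: "'v::finite sedge set"
  shows "dof (A \<union> B) = dof A + dof B - 2 * int (card (sverts A \<inter> sverts B)) + int (card (A \<inter> B))"
  using card_Un_Int[OF finite finite, of A B] card_Un_Int[OF finite finite, of "sverts A" "sverts B"]
  unfolding dof_def sverts_Un by linarith

text \<open>The maximum with 0 accounts for empty \<open>T\<close>, to which the sparsity
  inequalities do not apply. In use, \<open>T\<close> is the intersection of two tight sets and
  \<open>K\<close> their set of common vertices.\<close>

lemma card_le_sparse:
  fixes T :: "'v::finite sedge set"
  assumes "signed_sparse m F" "T \<subseteq> F" "sverts T \<subseteq> K"
  shows "int (card T) \<le> max 0 (2 * int (card K) - int m)"
    and "potential \<phi> T \<Longrightarrow> int (card T) \<le> max 0 (2 * int (card K) - 3)"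
proof -
  have K: "card (sverts T) \<le> card K" using assms(3) by (simp add: card_mono)
  show "int (card T) \<le> max 0 (2 * int (card K) - int m)"
  proof (cases "T = {}")
    case False
    show ?thesis using signed_sparse_dof(1)[OF assms(1,2) False] K unfolding dof_def by linarith
  qed simp
  show "int (card T) \<le> max 0 (2 * int (card K) - 3)" if \<phi>: "potential \<phi> T"
  proof (cases "T = {}")
    case False
    show ?thesis using signed_sparse_dof(2)[OF assms(1,2) False \<phi>] K unfolding dof_def by linarith
  qed simp
qed

text \<open>With k common vertices the union has at most max (2m - 2k) m degrees of freedom; k is at
  least 1 and m at most 2.\<close>

lemma dof_Un_tight:
  fixes A B :: "'v::finite sedge set"
  assumes F: "signed_sparse m F" "A \<subseteq> F" "B \<subseteq> F" and m: "m \<le> 2"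
    and A: "dof A \<le> int m" and B: "dof B \<le> int m" and w: "w \<in> sverts A" "w \<in> sverts B"
  shows "dof (A \<union> B) \<le> int m"
proof -
  let ?K = "sverts A \<inter> sverts B"
  have "card ?K \<noteq> 0" using w by auto
  moreover have "int (card (A \<inter> B)) \<le> max 0 (2 * int (card ?K) - int m)"
    using F(2) sverts_mono[of "A \<inter> B" A] sverts_mono[of "A \<inter> B" B]
    by (intro card_le_sparse(1)[OF F(1)]) auto
  ultimately show ?thesis unfolding dof_Un using A B m by linarith
qed

text \<open>The intersection inherits the potential of \<open>B\<close>, so k common vertices carry
  at most max 0 (2k - 3) common edges. The union then has at most max (m + 3 - 2k) m degrees of
  freedom, which exceeds m only for k = 1.\<close>

lemma dof_Un_tight_balanced:
  fixes A B :: "'v::finite sedge set"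
  assumes F: "signed_sparse m F" "A \<subseteq> F" "B \<subseteq> F"
    and A: "dof A \<le> int m" and B: "dof B \<le> 3" "potential \<phi> B"
    and w: "w \<in> sverts A" "w \<in> sverts B" and big: "dof (A \<union> B) > int m"
  shows "sverts A \<inter> sverts B = {w}" and "A \<inter> B = {}"
proof -
  let ?K = "sverts A \<inter> sverts B"
  have K: "card ?K \<noteq> 0" using w by auto
  have AB: "int (card (A \<inter> B)) \<le> max 0 (2 * int (card ?K) - 3)"
    using F(2) sverts_mono[of "A \<inter> B" A] sverts_mono[of "A \<inter> B" B]
    by (intro card_le_sparse(2)[OF F(1) _ _ potential_subset[OF B(2)]]) auto
  have 1: "card ?K = 1" using big K AB A B(1) unfolding dof_Un by linarith
  with w show "sverts A \<inter> sverts B = {w}" by (metis IntI card_1_singletonE singletonD)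
  show "A \<inter> B = {}" using AB 1 by simp
qed

text \<open>For k common vertices the same count gives at most max (6 - 2k) 3 for the union, so a
  value above 3 forces k = 1 and leaves no room for a common edge.\<close>

lemma dof_Un_agree:
  fixes A B :: "'v::finite sedge set"
  assumes F: "signed_sparse m F" "A \<subseteq> F" "B \<subseteq> F"
    and A: "dof A \<le> 3" "potential \<phi> A" and B: "dof B \<le> 3" "potential \<psi> B"
    and w: "w \<in> sverts A" "w \<in> sverts B"
  shows "dof (A \<union> B) \<le> 4" and "dof (A \<union> B) > 3 \<Longrightarrow> sverts A \<inter> sverts B = {w}"
    and "dof (A \<union> B) > 3 \<Longrightarrow> A \<inter> B = {}"
proof -
  let ?K = "sverts A \<inter> sverts B"
  have K: "card ?K \<noteq> 0" using w by auto
  have AB: "int (card (A \<inter> B)) \<le> max 0 (2 * int (card ?K) - 3)"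
    using F(2) sverts_mono[of "A \<inter> B" A] sverts_mono[of "A \<inter> B" B]
    by (intro card_le_sparse(2)[OF F(1) _ _ potential_subset[OF B(2)]]) auto
  then show "dof (A \<union> B) \<le> 4" using K A(1) B(1) unfolding dof_Un by linarith
  have 1: "card ?K = 1" if "dof (A \<union> B) > 3"
    using that K AB A(1) B(1) unfolding dof_Un by linarith
  with w show "dof (A \<union> B) > 3 \<Longrightarrow> sverts A \<inter> sverts B = {w}"
    by (metis IntI card_1_singletonE singletonD)
  show "dof (A \<union> B) > 3 \<Longrightarrow> A \<inter> B = {}" using AB 1 by simp
qed

text \<open>A common edge has the same gain for both potentials, so they agree at both of its ends
  or at neither. The intersection therefore splits into two balanced parts on the disjoint vertex
  sets \<open>?P\<close> and \<open>?Q\<close>, both nonempty. Each part lowers the sum 3 + 3 by at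
  least 2, and by at least 3 if it contains an edge.\<close>

lemma dof_Un_disagree:
  fixes A B :: "'v::finite sedge set"
  assumes F: "signed_sparse m F" "A \<subseteq> F" "B \<subseteq> F"
    and A: "dof A \<le> 3" "potential \<phi> A" and B: "dof B \<le> 3" "potential \<psi> B"
    and w: "w \<in> sverts A" "w \<in> sverts B" "\<phi> w = \<psi> w"
    and z: "z \<in> sverts A" "z \<in> sverts B" "\<phi> z \<noteq> \<psi> z"
  shows "dof (A \<union> B) \<le> 2" and "dof (A \<union> B) > 1 \<Longrightarrow> A \<inter> B = {}"
proof -
  let ?K = "sverts A \<inter> sverts B"
  let ?P = "?K \<inter> {x. \<phi> x = \<psi> x}" and ?Q = "?K \<inter> {x. \<phi> x \<noteq> \<psi> x}"
  let ?S = "{e \<in> A \<inter> B. \<phi> (fst e) = \<psi> (fst e)}" and ?R = "{e \<in> A \<inter> B. \<phi> (fst e) \<noteq> \<psi> (fst e)}"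
  have K: "card ?K = card ?P + card ?Q"
    by (subst card_Un_disjoint[symmetric]) (auto intro: arg_cong[where f=card])
  have AB: "card (A \<inter> B) = card ?S + card ?R"
    by (subst card_Un_disjoint[symmetric]) (auto intro: arg_cong[where f=card])
  have P: "card ?P \<noteq> 0" using w by auto
  have Q: "card ?Q \<noteq> 0" using z by auto
  have end2: "\<phi> u = \<psi> u \<longleftrightarrow> \<phi> v = \<psi> v" if "(u, v, \<beta>) \<in> A \<inter> B" for u v \<beta>
    using that A(2) B(2) unfolding potential_def
    by (cases "\<phi> u"; cases "\<psi> u"; cases "\<phi> v"; cases "\<psi> v") force+
  have "sverts ?S \<subseteq> ?P"
  proof
    fix x assume "x \<in> sverts ?S"
    then obtain u v \<beta> where "(u, v, \<beta>) \<in> ?S" "x = u \<or> x = v" by (force simp: sverts_def)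
    then show "x \<in> ?P"
      using end2[of u v \<beta>] in_sverts[of u v \<beta> A] in_sverts[of u v \<beta> B] by auto
  qed
  then have S: "int (card ?S) \<le> max 0 (2 * int (card ?P) - 3)"
    using F(2) by (intro card_le_sparse(2)[OF F(1) _ _ potential_subset[OF A(2)]]) auto
  have "sverts ?R \<subseteq> ?Q"
  proof
    fix x assume "x \<in> sverts ?R"
    then obtain u v \<beta> where "(u, v, \<beta>) \<in> ?R" "x = u \<or> x = v" by (force simp: sverts_def)
    then show "x \<in> ?Q"
      using end2[of u v \<beta>] in_sverts[of u v \<beta> A] in_sverts[of u v \<beta> B] by auto
  qed
  then have R: "int (card ?R) \<le> max 0 (2 * int (card ?Q) - 3)"
    using F(2) by (intro card_le_sparse(2)[OF F(1) _ _ potential_subset[OF A(2)]]) auto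
  have S': "int (card ?S) \<le> 2 * int (card ?P) - 2" "card ?S \<noteq> 0 \<Longrightarrow> int (card ?S) \<le> 2 * int (card ?P) - 3"
    using S P by linarith+
  have R': "int (card ?R) \<le> 2 * int (card ?Q) - 2" "card ?R \<noteq> 0 \<Longrightarrow> int (card ?R) \<le> 2 * int (card ?Q) - 3"
    using R Q by linarith+
  have D: "dof (A \<union> B) \<le> 6 - 2 * int (card ?P) - 2 * int (card ?Q) + int (card ?S) + int (card ?R)"
    unfolding dof_Un K AB using A(1) B(1) by simp
  then show "dof (A \<union> B) \<le> 2" using S'(1) R'(1) by linarith
  show "A \<inter> B = {}" if "dof (A \<union> B) > 1"
  proof -
    have "card (A \<inter> B) = 0" unfolding AB using that D S' R' by linarith
    then show ?thesis by (simp only: card_eq_0_iff) simp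
  qed
qed

lemma potential_glue:
  assumes "potential \<phi> A" "potential \<psi> B" "\<And>z. z \<in> sverts A \<Longrightarrow> z \<in> sverts B \<Longrightarrow> \<phi> z = \<psi> z"
  shows "potential (\<lambda>z. if z \<in> sverts A then \<phi> z else \<psi> z) (A \<union> B)"
  unfolding potential_def
proof (intro allI impI)
  fix u w \<alpha> assume e: "(u, w, \<alpha>) \<in> A \<union> B"
  show "(if u \<in> sverts A then \<phi> u else \<psi> u) + (if w \<in> sverts A then \<phi> w else \<psi> w) = \<alpha>"
  proof (cases "(u, w, \<alpha>) \<in> A")
    case True
    then show ?thesis using assms(1) in_sverts[OF True] by (auto simp: potential_def)
  next
    case False
    then have B: "(u, w, \<alpha>) \<in> B" using e by simp
    then show ?thesis using assms(2,3) in_sverts[OF B] by (auto simp: potential_def)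
  qed
qed

section \<open>Tight sets blocking the insertion of an edge\<close>

definition tight_unbal :: "nat \<Rightarrow> 'v sedge set \<Rightarrow> 'v \<times> bit \<Rightarrow> 'v \<times> bit \<Rightarrow> 'v sedge set \<Rightarrow> bool" where
  "tight_unbal m F c d T \<longleftrightarrow> T \<subseteq> F \<and> T \<noteq> {} \<and> dof T \<le> int m \<and> fst c \<in> sverts T \<and> fst d \<in> sverts T"

text \<open>A new edge respects a potential exactly if, after adding a constant, the potential takes
  the prescribed bits at the two ends. Fixing the constant this way makes potentials of different
  blocking sets comparable at shared ends.\<close>

definition tight_bal :: "'v sedge set \<Rightarrow> 'v \<times> bit \<Rightarrow> 'v \<times> bit \<Rightarrow> 'v sedge set \<Rightarrow> bool" where
  "tight_bal F c d T \<longleftrightarrow> T \<subseteq> F \<and> T \<noteq> {} \<and> dof T \<le> 3 \<and> fst c \<in> sverts T \<and> fst d \<in> sverts T \<and>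
     (\<exists>\<phi>. potential \<phi> T \<and> \<phi> (fst c) = snd c \<and> \<phi> (fst d) = snd d)"

text \<open>A pair \<open>(x, a)\<close> is a vertex of the covering graph. The edge joining
  \<open>(x, a)\<close> to \<open>(y, b)\<close> lies in an orbit of gain \<open>a + b\<close>, as
  every element of the group is its own negative.\<close>

definition addable :: "nat \<Rightarrow> 'v sedge set \<Rightarrow> 'v \<times> bit \<Rightarrow> 'v \<times> bit \<Rightarrow> bool" where
  "addable m F c d \<longleftrightarrow> (fst c, fst d, snd c + snd d) \<notin> F \<and>
     signed_sparse m (insert (fst c, fst d, snd c + snd d) F)"

lemma tight_bal_commute: "tight_bal F c d T \<longleftrightarrow> tight_bal F d c T"
  by (auto simp: tight_bal_def)

lemma tight_unbal_commute: "tight_unbal m F c d T \<longleftrightarrow> tight_unbal m F d c T"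
  by (auto simp: tight_unbal_def)

text \<open>An edge already present is itself tight. Otherwise a violating set contains the new
  edge, and what remains after removing it is tight and meets both ends. If nothing remains, the
  violating set is a single unbalanced loop, which is forbidden only for \<open>m = 2\<close>; this
  is the last alternative.\<close>

lemma not_addable:
  fixes F :: "'v::finite sedge set"
  assumes F: "signed_sparse m F" and m: "m = 1 \<or> m = 2" and cd: "c \<noteq> d" and no: "\<not> addable m F c d"
  shows "(\<exists>T. tight_bal F c d T) \<or> (\<exists>T. tight_unbal m F c d T) \<or> (fst c = fst d \<and> m = 2)"
proof -
  obtain x a y b where c: "c = (x, a)" and d: "d = (y, b)" by (cases c, cases d)
  let ?f = "(x, y, a + b)"
  show ?thesis
  proof (cases "?f \<in> F")
    case True
    show ?thesis
    proof (cases "x = y")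
      case True
      have "int m \<le> dof {?f}" using \<open>?f \<in> F\<close> by (intro signed_sparse_dof(1)[OF F]) auto
      then have "tight_unbal m F c d {?f}"
        using \<open>?f \<in> F\<close> True m by (auto simp: tight_unbal_def c d dof_def sverts_insert)
      then show ?thesis by blast
    next
      case False
      have "potential (\<lambda>z. if z = x then a else b) {?f}" using False by (auto simp: potential_def)
      then have "tight_bal F c d {?f}"
        using \<open>?f \<in> F\<close> False
        by (auto simp: tight_bal_def c d dof_def sverts_insert intro!: exI[of _ "\<lambda>z. if z = x then a else b"])
      then show ?thesis by blast
    qed
  next
    case False
    then have "\<not> signed_sparse m (insert ?f F)" using no by (simp add: addable_def c d)
    then obtain T' where T': "T' \<subseteq> insert ?f F" "T' \<noteq> {}"
      and viol: "(\<exists>\<phi>. potential \<phi> T') \<and> card T' + 3 > 2 * card (sverts T') \<or> card T' + m > 2 * card (sverts T')"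
      unfolding signed_sparse_def by (meson not_le)
    define T where "T = T' - {?f}"
    have "?f \<in> T'" using T' viol F unfolding signed_sparse_def by (metis not_le subset_insert)
    then have T'T: "T' = insert ?f T" "?f \<notin> T" and TF: "T \<subseteq> F" using T' by (auto simp: T_def)
    have cT: "card T' = card T + 1" using T'T by simp
    have vT: "sverts T' = insert x (insert y (sverts T))" by (simp add: T'T sverts_insert)
    show ?thesis
    proof (cases "T = {}")
      case True
      have cT1: "card T' = 1" using cT True by simp
      have "x = y"
      proof (rule ccontr)
        assume "x \<noteq> y"
        then have "card (sverts T') = 2" using vT True by simp
        then show False using viol cT1 m by auto
      qed
      moreover have "m = 2"
      proof (rule ccontr)
        assume "m \<noteq> 2"
        have "\<not> potential \<phi> T'" for \<phi>
          using cd \<open>x = y\<close> unfolding T'T True potential_def c d by (cases a; cases b) auto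
        moreover have "card (sverts T') = 1" using vT True \<open>x = y\<close> by simp
        ultimately show False using viol cT1 m \<open>m \<noteq> 2\<close> by auto
      qed
      ultimately show ?thesis by (simp add: c d)
    next
      case ne: False
      have le: "card (sverts T) \<le> card (sverts T')" unfolding vT by (intro card_mono) auto
      have eq: "x \<in> sverts T \<and> y \<in> sverts T" if "card (sverts T') \<le> card (sverts T)"
      proof -
        have "sverts T = sverts T'" by (rule card_seteq) (use vT that in auto)
        then show ?thesis using vT by auto
      qed
      show ?thesis
      proof (cases "\<exists>\<phi>. potential \<phi> T' \<and> card T' + 3 > 2 * card (sverts T')")
        case True
        then obtain \<phi> where \<phi>: "potential \<phi> T'" "card T' + 3 > 2 * card (sverts T')" by blast
        have "potential \<phi> T" using \<phi>(1) T'T by (auto intro: potential_subset)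
        then have "3 \<le> dof T" using signed_sparse_dof(2)[OF F TF ne] by blast
        then have s: "card (sverts T') \<le> card (sverts T)" using \<phi>(2) cT unfolding dof_def by linarith
        \<comment> \<open>Adding a constant preserves a potential; this constant makes the value at
          \<open>x\<close> equal to \<open>a\<close>.\<close>
        define \<psi> where "\<psi> z = \<phi> z + (\<phi> x + a)" for z
        have "potential \<psi> T"
          using \<open>potential \<phi> T\<close> unfolding potential_def \<psi>_def by (metis add.assoc add.commute bit_add_self add_0)
        moreover have "\<psi> x = a" unfolding \<psi>_def by (cases "\<phi> x"; cases a) auto
        moreover have "\<psi> y = b"
          using \<phi>(1) unfolding T'T potential_def \<psi>_def
          by (cases "\<phi> x"; cases "\<phi> y"; cases a; cases b) force+
        moreover have "dof T \<le> 3" using \<phi>(2) cT le unfolding dof_def by linarith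
        ultimately have "tight_bal F c d T"
          using eq[OF s] TF ne by (auto simp: tight_bal_def c d)
        then show ?thesis by blast
      next
        case False
        then have v: "card T' + m > 2 * card (sverts T')" using viol by blast
        have "int m \<le> dof T" using signed_sparse_dof(1)[OF F TF ne] by blast
        then have s: "card (sverts T') \<le> card (sverts T)" using v cT unfolding dof_def by linarith
        have "dof T \<le> int m" using v cT le unfolding dof_def by linarith
        then have "tight_unbal m F c d T" using eq[OF s] TF ne by (auto simp: tight_unbal_def c d)
        then show ?thesis by blast
      qed
    qed
  qed
qed

text \<open>
  \<open>C\<close> consists of the ends, in the covering graph, of the edges at a deleted vertex of degree 3.
\<close>

locale cubic_vertex =
  fixes m :: nat and F :: "'v::finite sedge set" and C :: "('v \<times> bit) set"
  assumes F: "signed_sparse m F" and m: "m = 1 \<or> m = 2"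
    and dof_cover: "\<And>T. T \<subseteq> F \<Longrightarrow> fst ` C \<subseteq> sverts T \<Longrightarrow> dof T > int m"
    and dof_cover_bal: "\<And>T \<phi>. T \<subseteq> F \<Longrightarrow> fst ` C \<subseteq> sverts T \<Longrightarrow> potential \<phi> T \<Longrightarrow>
      (\<forall>c\<in>C. \<phi> (fst c) = snd c) \<Longrightarrow> dof T > 3"
begin

text \<open>The two sets share an end, so their union is tight again, yet it contains all three
  ends.\<close>

lemma tight_unbal_pair:
  assumes C: "C = {c, d, e}" and cd: "tight_unbal m F c d T" and de: "tight_unbal m F d e S"
  shows False
proof -
  have "dof (T \<union> S) \<le> int m"
    using cd de m by (intro dof_Un_tight[OF F, of T S "fst d"]) (auto simp: tight_unbal_def)
  moreover have "dof (T \<union> S) > int m"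
    using cd de by (intro dof_cover) (auto simp: C tight_unbal_def sverts_Un)
  ultimately show False by simp
qed

text \<open>\<open>T\<close> shares no edge with \<open>A\<close> or \<open>B\<close>, as their
  unions with \<open>T\<close> contain all three ends. Moreover \<open>A \<union> B\<close> has at
  most 4 degrees of freedom, and at most 2 if \<open>c\<close> and \<open>d\<close> lie over one
  vertex, because the potentials then agree at \<open>e\<close> and differ there. In both cases the
  vertices of \<open>c\<close> and \<open>d\<close>, shared with \<open>T\<close>, absorb these, so
  that the union of all three is tight.\<close>

lemma tight_unbal_bal:
  assumes C: "C = {c, d, e}" "c \<noteq> d" and T: "tight_unbal m F c d T"
    and A: "tight_bal F c e A" and B: "tight_bal F d e B"
  shows False
proof -
  obtain \<phi> where \<phi>: "potential \<phi> A" "\<phi> (fst c) = snd c" "\<phi> (fst e) = snd e"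
    using A by (auto simp: tight_bal_def)
  obtain \<psi> where \<psi>: "potential \<psi> B" "\<psi> (fst d) = snd d" "\<psi> (fst e) = snd e"
    using B by (auto simp: tight_bal_def)
  have TA: "dof (T \<union> A) > int m" and TB: "dof (T \<union> B) > int m" and TAB: "dof (T \<union> (A \<union> B)) > int m"
    using T A B by (auto intro!: dof_cover simp: C tight_unbal_def tight_bal_def sverts_Un)
  have "T \<inter> A = {}"
    by (rule dof_Un_tight_balanced(2)[OF F _ _ _ _ \<phi>(1) _ _ TA, of "fst c"])
       (use T A in \<open>auto simp: tight_unbal_def tight_bal_def\<close>)
  moreover have "T \<inter> B = {}"
    by (rule dof_Un_tight_balanced(2)[OF F _ _ _ _ \<psi>(1) _ _ TB, of "fst d"])
       (use T B in \<open>auto simp: tight_unbal_def tight_bal_def\<close>)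
  ultimately have 0: "T \<inter> (A \<union> B) = {}" by blast
  have "card {fst c, fst d} \<le> card (sverts T \<inter> sverts (A \<union> B))"
    using T A B by (intro card_mono) (auto simp: tight_unbal_def tight_bal_def sverts_Un)
  moreover have "dof (A \<union> B) \<le> 2 * int (card {fst c, fst d})"
  proof (cases "fst c = fst d")
    case True
    then have "snd c \<noteq> snd d" using C(2) by (metis prod_eqI)
    then have "dof (A \<union> B) \<le> 2"
      using A B \<phi> \<psi> True
      by (intro dof_Un_disagree(1)[OF F _ _ _ \<phi>(1) _ \<psi>(1), of "fst e" "fst c"])
         (auto simp: tight_bal_def)
    then show ?thesis using True by simp
  next
    case False
    have "dof (A \<union> B) \<le> 4"
      using A B by (intro dof_Un_agree(1)[OF F _ _ _ \<phi>(1) _ \<psi>(1), of "fst e"]) (auto simp: tight_bal_def)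
    then show ?thesis using False by simp
  qed
  moreover have "dof T \<le> int m" using T by (simp add: tight_unbal_def)
  ultimately have "dof (T \<union> (A \<union> B)) \<le> int m"
    using 0 unfolding dof_Un[of T "A \<union> B"] by simp
  then show False using TAB by simp
qed

text \<open>If the potentials agree on all common vertices, the union is balanced and contains all
  ends, so it has more than 3 degrees of freedom and the sets meet in one vertex. If they disagree
  somewhere, at most 2 remain, which is compatible with \<open>dof_cover\<close> only for
  \<open>m = 1\<close>.\<close>

lemma tight_bal_pair:
  assumes C: "C = {c, d, e}" and A: "tight_bal F c d A" and B: "tight_bal F d e B"
    and \<phi>: "potential \<phi> A" "\<phi> (fst c) = snd c" "\<phi> (fst d) = snd d"
    and \<psi>: "potential \<psi> B" "\<psi> (fst d) = snd d" "\<psi> (fst e) = snd e"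
  shows "A \<inter> B = {}"
    and "m = 1 \<and> dof (A \<union> B) \<le> 2 \<or>
         sverts A \<inter> sverts B = {fst d} \<and> dof (A \<union> B) \<le> 4"
proof -
  have AB: "dof (A \<union> B) > int m"
    using A B by (auto intro!: dof_cover simp: C tight_bal_def sverts_Un)
  have "A \<inter> B = {} \<and> (m = 1 \<and> dof (A \<union> B) \<le> 2 \<or> sverts A \<inter> sverts B = {fst d} \<and> dof (A \<union> B) \<le> 4)"
  proof (cases "\<forall>z. z \<in> sverts A \<longrightarrow> z \<in> sverts B \<longrightarrow> \<phi> z = \<psi> z")
    case True
    let ?\<xi> = "\<lambda>z. if z \<in> sverts A then \<phi> z else \<psi> z"
    have "potential ?\<xi> (A \<union> B)" using potential_glue[OF \<phi>(1) \<psi>(1)] True by blast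
    moreover have "\<forall>c\<in>C. ?\<xi> (fst c) = snd c"
      using A B \<phi> \<psi> True by (auto simp: C tight_bal_def)
    ultimately have "dof (A \<union> B) > 3"
      using A B by (intro dof_cover_bal) (auto simp: C tight_bal_def sverts_Un)
    then show ?thesis
      using A B dof_Un_agree[OF F _ _ _ \<phi>(1) _ \<psi>(1), of "fst d"] by (auto simp: tight_bal_def)
  next
    case False
    then obtain z where "z \<in> sverts A" "z \<in> sverts B" "\<phi> z \<noteq> \<psi> z" by blast
    then have "dof (A \<union> B) \<le> 2" "dof (A \<union> B) > 1 \<Longrightarrow> A \<inter> B = {}"
      using A B \<phi> \<psi> dof_Un_disagree[OF F _ _ _ \<phi>(1) _ \<psi>(1), of "fst d" z] by (auto simp: tight_bal_def)
    then show ?thesis using AB m by auto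
  qed
  then show "A \<inter> B = {}"
    and "m = 1 \<and> dof (A \<union> B) \<le> 2 \<or>
         sverts A \<inter> sverts B = {fst d} \<and> dof (A \<union> B) \<le> 4" by auto
qed

text \<open>If two of the sets have a union of at most 2 degrees of freedom, the third meets it in
  two ends and the total drops to 2 + 3 - 4 = 1, too few. Otherwise the sets meet pairwise in
  exactly one end each; then the potentials glue to one on the whole union, which has at most 4 + 3
  - 4 = 3 degrees of freedom.\<close>

lemma tight_bal_triangle:
  assumes C: "C = {c, d, e}" and dist: "fst c \<noteq> fst d" "fst d \<noteq> fst e" "fst c \<noteq> fst e"
    and A: "tight_bal F c d A" and B: "tight_bal F d e B" and D: "tight_bal F e c D"
  shows False
proof -
  obtain \<phi> where \<phi>: "potential \<phi> A" "\<phi> (fst c) = snd c" "\<phi> (fst d) = snd d"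
    using A by (auto simp: tight_bal_def)
  obtain \<psi> where \<psi>: "potential \<psi> B" "\<psi> (fst d) = snd d" "\<psi> (fst e) = snd e"
    using B by (auto simp: tight_bal_def)
  obtain \<xi> where \<xi>: "potential \<xi> D" "\<xi> (fst e) = snd e" "\<xi> (fst c) = snd c"
    using D by (auto simp: tight_bal_def)
  note AB = tight_bal_pair[OF C A B \<phi> \<psi>]
  have "C = {d, e, c}" "C = {e, c, d}" using C by auto
  note BD = tight_bal_pair[OF \<open>C = {d, e, c}\<close> B D \<psi> \<xi>]
  note DA = tight_bal_pair[OF \<open>C = {e, c, d}\<close> D A \<xi> \<phi>]
  have ends: "fst c \<in> sverts A" "fst d \<in> sverts A" "fst d \<in> sverts B" "fst e \<in> sverts B"
      "fst e \<in> sverts D" "fst c \<in> sverts D" "dof A \<le> 3" "dof B \<le> 3" "dof D \<le> 3"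
      "A \<subseteq> F" "B \<subseteq> F" "D \<subseteq> F"
    using A B D by (auto simp: tight_bal_def)
  have third: False if m1: "m = 1" and PQ: "dof (P \<union> Q) \<le> 2" "(P \<union> Q) \<inter> R = {}" "dof R \<le> 3"
      "P \<subseteq> F" "Q \<subseteq> F" "R \<subseteq> F" "x \<noteq> y" "{x, y} \<subseteq> sverts (P \<union> Q) \<inter> sverts R"
      "fst ` C \<subseteq> sverts (P \<union> Q)" for P Q R x y
  proof -
    have "dof (P \<union> Q \<union> R) > int m" using PQ by (intro dof_cover) (auto simp: sverts_Un)
    moreover have "card {x, y} \<le> card (sverts (P \<union> Q) \<inter> sverts R)"
      using PQ by (intro card_mono) auto
    ultimately show False using PQ(1,2,3) \<open>x \<noteq> y\<close> m1 unfolding dof_Un[of "P \<union> Q" R] by simp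
  qed
  have sAB: "sverts A \<inter> sverts B = {fst d}" and dAB: "dof (A \<union> B) \<le> 4"
    using third[of A B D "fst e" "fst c"] AB(2) BD(1) DA(1) ends dist
    by (auto simp: sverts_Un C)
  have sBD: "sverts B \<inter> sverts D = {fst e}"
    using third[of B D A "fst c" "fst d"] BD(2) AB(1) DA(1) ends dist by (auto simp: sverts_Un C)
  have sDA: "sverts D \<inter> sverts A = {fst c}"
    using third[of D A B "fst d" "fst e"] DA(2) AB(1) BD(1) ends dist by (auto simp: sverts_Un C)
  have sABD: "sverts (A \<union> B) \<inter> sverts D = {fst c, fst e}"
    using sBD sDA by (auto simp: sverts_Un)
  have "(A \<union> B) \<inter> D = {}" using BD(1) DA(1) by blast
  then have "dof (A \<union> B \<union> D) \<le> 3"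
    unfolding dof_Un[of "A \<union> B" D] sABD using dAB ends dist by simp
  moreover have "dof (A \<union> B \<union> D) > 3"
  proof -
    define \<mu> where "\<mu> z = (if z \<in> sverts A then \<phi> z else \<psi> z)" for z
    have \<mu>: "potential \<mu> (A \<union> B)"
      unfolding \<mu>_def by (rule potential_glue[OF \<phi>(1) \<psi>(1)]) (use sAB \<phi> \<psi> in force)
    have "fst e \<notin> sverts A" using sDA ends dist by (metis IntI singletonD)
    then have \<mu>C: "\<mu> (fst c) = snd c" "\<mu> (fst d) = snd d" "\<mu> (fst e) = snd e"
      using ends \<phi> \<psi> by (auto simp: \<mu>_def)
    have "potential (\<lambda>z. if z \<in> sverts (A \<union> B) then \<mu> z else \<xi> z) (A \<union> B \<union> D)"
      by (rule potential_glue[OF \<mu> \<xi>(1)]) (use sABD \<mu>C \<xi> in force)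
    then show ?thesis
      using ends \<mu>C by (rule_tac dof_cover_bal) (auto simp: C sverts_Un)
  qed
  ultimately show False by simp
qed

text \<open>The potentials agree at \<open>e\<close> but differ at the common vertex of
  \<open>c\<close> and \<open>d\<close>, so the union has at most 2 degrees of freedom.\<close>

lemma tight_bal_digon:
  assumes C: "C = {c, d, e}" "c \<noteq> d" "fst c = fst d" and "m = 2"
    and A: "tight_bal F c e A" and B: "tight_bal F d e B"
  shows False
proof -
  obtain \<phi> where \<phi>: "potential \<phi> A" "\<phi> (fst c) = snd c" "\<phi> (fst e) = snd e"
    using A by (auto simp: tight_bal_def)
  obtain \<psi> where \<psi>: "potential \<psi> B" "\<psi> (fst d) = snd d" "\<psi> (fst e) = snd e"
    using B by (auto simp: tight_bal_def)
  have "snd c \<noteq> snd d" using C(2,3) by (metis prod_eqI)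
  then have "dof (A \<union> B) \<le> 2"
    using A B \<phi> \<psi> C(3)
    by (intro dof_Un_disagree(1)[OF F _ _ _ \<phi>(1) _ \<psi>(1), of "fst e" "fst c"])
       (auto simp: tight_bal_def)
  moreover have "dof (A \<union> B) > int m"
    by (rule dof_cover) (use A B C(3) in \<open>auto simp: C(1) tight_bal_def sverts_Un\<close>)
  ultimately show False using \<open>m = 2\<close> by simp
qed

text \<open>The parallel pair, if there is one, is \<open>c\<close>, \<open>d\<close>.\<close>

lemma addable_aux:
  assumes C: "C = {c, d, e}" "c \<noteq> d" "d \<noteq> e" "c \<noteq> e" and e: "fst c \<noteq> fst e" "fst d \<noteq> fst e"
  shows "addable m F c d \<or> addable m F c e \<or> addable m F d e"
proof (rule ccontr)
  assume "\<not> ?thesis"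
  then have cd: "(\<exists>T. tight_bal F c d T) \<or> (\<exists>T. tight_unbal m F c d T) \<or> (fst c = fst d \<and> m = 2)"
    and ce: "(\<exists>T. tight_bal F c e T) \<or> (\<exists>T. tight_unbal m F c e T)"
    and de: "(\<exists>T. tight_bal F d e T) \<or> (\<exists>T. tight_unbal m F d e T)"
    using not_addable[OF F m] C e by blast+
  have perm: "C = {d, c, e}" "C = {c, e, d}" "C = {e, c, d}" "C = {d, e, c}" "C = {e, d, c}" using C by auto
  have two: False if "(tight_unbal m F c d T \<and> tight_unbal m F c e S) \<or> (tight_unbal m F c d T \<and> tight_unbal m F d e S)
      \<or> (tight_unbal m F c e T \<and> tight_unbal m F d e S)" for T S
    using that tight_unbal_pair[OF C(1), of T S] tight_unbal_pair[OF perm(1), of T S]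
      tight_unbal_pair[OF perm(2), of T S] by (auto simp: tight_unbal_commute)
  \<comment> \<open>An unbalanced tight set at \<open>e\<close> leaves only a balanced one for the
    other edge at \<open>e\<close>. Whatever blocks the edge between \<open>c\<close> and
    \<open>d\<close> then gives a contradiction; if these two are parallel, \<open>T\<close> alone
    already contains all ends.\<close>
  have side: False if xy: "x = c \<and> y = d \<or> x = d \<and> y = c" and T: "tight_unbal m F x e T" for x y T
  proof -
    obtain S where S: "tight_bal F y e S" using xy T ce de two by blast
    have C': "C = {x, e, y}" "x \<noteq> e" using xy C by auto
    from cd xy consider D where "tight_bal F x y D" | D where "tight_unbal m F c d D" | "fst c = fst d"
      by (metis tight_bal_commute)
    then show False
    proof cases
      case 1
      then show ?thesis using tight_unbal_bal[OF C' T] S by (metis tight_bal_commute)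
    next
      case 2
      then show ?thesis using xy T two by blast
    next
      case 3
      then have "dof T > int m" using T xy by (intro dof_cover) (auto simp: tight_unbal_def C)
      then show ?thesis using T by (simp add: tight_unbal_def)
    qed
  qed
  then have 4: "\<nexists>T. tight_unbal m F c e T" "\<nexists>T. tight_unbal m F d e T" by blast+
  obtain A B where A: "tight_bal F c e A" and B: "tight_bal F d e B" using 4 ce de by blast
  have 5: "\<nexists>T. tight_unbal m F c d T" using tight_unbal_bal[OF C(1,2) _ A B] by blast
  show False
  proof (cases "fst c = fst d")
    case True
    have "\<nexists>T. tight_bal F c d T" using True C(2) unfolding tight_bal_def by (metis prod_eqI)
    then have "m = 2" using cd 5 by blast
    then show ?thesis using tight_bal_digon[OF C(1,2) True _ A B] by blast
  next
    case False
    then obtain D where "tight_bal F c d D" using cd 5 by blast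
    then show ?thesis
      using tight_bal_triangle[OF C(1) False e(2,1), of D B A] A B by (metis tight_bal_commute)
  qed
qed

end

text \<open>The deletion of a cubic vertex can be compensated by one of the three edges closing a
  triangle with it: otherwise tight sets blocking these edges would add up to a set that
  is too dense together with the vertex.\<close>

lemma one_reduction:
  fixes F :: "'v::finite sedge set"
  assumes H: "signed_sparse m (F \<union> {(v, fst c, snd c), (v, fst d, snd d), (v, fst e, snd e)})"
    and m: "m = 1 \<or> m = 2" and v: "v \<notin> sverts F" "v \<noteq> fst c" "v \<noteq> fst d" "v \<noteq> fst e"
    and dist: "c \<noteq> d" "d \<noteq> e" "c \<noteq> e"
  shows "\<exists>c' d' e'. {c', d', e'} = {c, d, e} \<and> c' \<noteq> d' \<and> d' \<noteq> e' \<and> c' \<noteq> e' \<and> addable m F c' d'"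
proof -
  let ?S = "{(v, fst c, snd c), (v, fst d, snd d), (v, fst e, snd e)}"
  have F: "signed_sparse m F" by (rule signed_sparse_subset[OF H]) auto
  have S3: "card ?S = 3" using dist by (auto simp: prod_eq_iff)
  have "(v, z) \<notin> F" for z using v(1) in_sverts(1)[of v "fst z" "snd z" F] by auto
  then have disj: "T \<inter> ?S = {}" if "T \<subseteq> F" for T using that by blast
  \<comment> \<open>The new vertex contributes 2 and its three edges take away 3; this is why sets
    containing all ends cannot be tight.\<close>
  have dofS: "dof (T \<union> ?S) = dof T - 1" if "T \<subseteq> F" "fst ` {c, d, e} \<subseteq> sverts T" for T
  proof -
    have "sverts (T \<union> ?S) = insert v (sverts T)"
      unfolding sverts_Un sverts_insert using that(2) by auto
    moreover have "v \<notin> sverts T" using v(1) sverts_mono[OF that(1)] by blast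
    moreover have "card (T \<union> ?S) = card T + 3"
      using disj[OF that(1)] S3 by (subst card_Un_disjoint) auto
    ultimately show ?thesis by (simp add: dof_def)
  qed
  interpret cubic_vertex m F "{c, d, e}"
  proof
    show "dof T > int m" if T: "T \<subseteq> F" "fst ` {c, d, e} \<subseteq> sverts T" for T
      using signed_sparse_dof(1)[OF H, of "T \<union> ?S"] dofS[OF T] T(1) by auto
    show "dof T > 3" if T: "T \<subseteq> F" "fst ` {c, d, e} \<subseteq> sverts T" "potential \<phi> T"
      "\<forall>c\<in>{c, d, e}. \<phi> (fst c) = snd c" for T \<phi>
    proof -
      have vT: "v \<notin> sverts T" using v(1) sverts_mono[OF T(1)] by blast
      have "potential (\<phi>(v := 0)) T"
        using T(3) vT unfolding potential_def by (metis fun_upd_apply in_sverts)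
      moreover have "potential (\<phi>(v := 0)) ?S" using T(4) v by (auto simp: potential_def)
      ultimately have "potential (\<phi>(v := 0)) (T \<union> ?S)" unfolding potential_def by blast
      then show ?thesis
        using signed_sparse_dof(2)[OF H, of "T \<union> ?S"] dofS[OF T(1,2)] T(1) by auto
    qed
  qed (use F m in auto)
  have tri: "\<not> (fst c = fst d \<and> fst d = fst e)"
  proof
    assume "fst c = fst d \<and> fst d = fst e"
    then have "snd c \<noteq> snd d" "snd d \<noteq> snd e" "snd c \<noteq> snd e" using dist by (auto simp: prod_eq_iff)
    then show False by (cases "snd c"; cases "snd d"; cases "snd e") auto
  qed
  have fin: ?thesis if "addable m F x y" "{x, y, z} = {c, d, e}" "x \<noteq> y" "y \<noteq> z" "x \<noteq> z" for x y z
    using that by blast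
  have perm: "{c, e, d} = {c, d, e}" "{d, e, c} = {c, d, e}" "{d, c, e} = {c, d, e}"
    "{e, c, d} = {c, d, e}" "{e, d, c} = {c, d, e}" by auto
  note ne = dist dist[symmetric]
  \<comment> \<open>Only two covering vertices lie over each vertex, so one of the three ends is
    parallel to neither of the others; it takes the role of \<open>e\<close> in
    \<open>addable_aux\<close>.\<close>
  consider "fst c \<noteq> fst e" "fst d \<noteq> fst e" | "fst c \<noteq> fst d" "fst e \<noteq> fst d" | "fst d \<noteq> fst c" "fst e \<noteq> fst c"
    using tri by metis
  then show ?thesis
  proof cases
    case 1
    then have "addable m F c d \<or> addable m F c e \<or> addable m F d e"
      using dist by (intro addable_aux) auto
    then show ?thesis using fin[of c d e] fin[of c e d] fin[of d e c] perm ne by blast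
  next
    case 2
    then have "addable m F c e \<or> addable m F c d \<or> addable m F e d"
      using dist by (intro addable_aux) auto
    then show ?thesis using fin[of c e d] fin[of c d e] fin[of e d c] perm ne by blast
  next
    case 3
    then have "addable m F d e \<or> addable m F d c \<or> addable m F e c"
      using dist by (intro addable_aux) auto
    then show ?thesis using fin[of d e c] fin[of d c e] fin[of e c d] perm ne by blast
  qed
qed

text \<open>Degrees, with loops counted twice, add up to 2|F|, which is less than 4 times the number
  of vertices.\<close>

lemma signed_sparse_low_degree:
  fixes F :: "'v::finite sedge set"
  assumes F: "signed_sparse m F" "0 < m" "F \<noteq> {}"
  obtains v where "v \<in> sverts F" "card {e \<in> F. fst e = v} + card {e \<in> F. fst (snd e) = v} \<le> 3"
proof -
  have "\<exists>v\<in>sverts F. card {e \<in> F. fst e = v} + card {e \<in> F. fst (snd e) = v} \<le> 3"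
  proof (rule ccontr)
    assume "\<not> ?thesis"
    then have big: "4 \<le> card {e \<in> F. fst e = v} + card {e \<in> F. fst (snd e) = v}" if "v \<in> sverts F" for v
      using that by (force simp: not_le)
    have count: "card F = (\<Sum>v\<in>sverts F. card {e \<in> F. g e = v})" if "g ` F \<subseteq> sverts F" for g :: "'v sedge \<Rightarrow> 'v"
      using sum.group[of F "sverts F" g "\<lambda>_. 1::nat"] that by simp
    have "4 * card (sverts F) = (\<Sum>v\<in>sverts F. 4)" by simp
    also have "\<dots> \<le> (\<Sum>v\<in>sverts F. card {e \<in> F. fst e = v} + card {e \<in> F. fst (snd e) = v})"
      by (intro sum_mono big)
    also have "\<dots> = 2 * card F"
      using count[of fst] count[of "fst \<circ> snd"] by (simp add: sum.distrib sverts_def)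
    finally have "4 * card (sverts F) \<le> 2 * card F" .
    moreover have "card F + m \<le> 2 * card (sverts F)" using F unfolding signed_sparse_def by blast
    ultimately show False using F(2) by linarith
  qed
  then show thesis using that by blast
qed

text \<open>Reversing an edge negates its gain, which has no effect in this group; hence all edges
  at \<open>v\<close> can be made to start there.\<close>

definition orient_from :: "'v \<Rightarrow> 'v sedge \<Rightarrow> 'v sedge" where
  "orient_from v e = (if fst (snd e) = v then (v, fst e, snd (snd e)) else e)"

lemma sverts_orient_from [simp]:
  fixes v :: 'v
  shows "sverts (orient_from v ` T) = sverts T"
proof -
  have "sverts F = (\<Union>e\<in>F. {fst e, fst (snd e)})" for F :: "'v sedge set"
    by (auto simp: sverts_def)
  moreover have "{fst (orient_from v e), fst (snd (orient_from v e))} = {fst e, fst (snd e)}" for e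
    by (auto simp: orient_from_def)
  ultimately show ?thesis by simp
qed

lemma potential_orient_from [simp]: "potential \<phi> (orient_from v ` T) \<longleftrightarrow> potential \<phi> T"
proof -
  have "potential \<phi> F \<longleftrightarrow> (\<forall>e\<in>F. \<phi> (fst e) + \<phi> (fst (snd e)) = snd (snd e))" for F
    by (auto simp: potential_def)
  moreover have "\<phi> (fst (orient_from v e)) + \<phi> (fst (snd (orient_from v e))) = \<phi> (fst e) + \<phi> (fst (snd e))"
    "snd (snd (orient_from v e)) = snd (snd e)" for e
    by (auto simp: orient_from_def add.commute)
  ultimately show ?thesis by simp
qed

text \<open>Two edges that become equal would be parallel with the same gain: a balanced set with 2
  edges on 2 vertices, which has only 2 degrees of freedom.\<close>

lemma inj_on_orient_from:
  fixes F :: "'v::finite sedge set"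
  assumes "signed_sparse m F"
  shows "inj_on (orient_from v) F"
proof (rule inj_onI, rule ccontr)
  fix e e' assume e: "e \<in> F" "e' \<in> F" "orient_from v e = orient_from v e'" "e \<noteq> e'"
  obtain u w \<alpha> u' w' \<alpha>' where ee: "e = (u, w, \<alpha>)" "e' = (u', w', \<alpha>')" by (cases e, cases e')
  have *: "\<alpha>' = \<alpha>" "u' = w" "w' = u" "u \<noteq> w" using e(3,4) unfolding ee by (auto simp: orient_from_def split: if_splits)
  have "potential (\<lambda>z. if z = u then \<alpha> else 0) {e, e'}" using * by (auto simp: potential_def ee)
  then have "3 \<le> dof {e, e'}" using e by (intro signed_sparse_dof(2)[OF assms]) auto
  moreover have "sverts {e, e'} = {u, w}" using * by (auto simp: ee sverts_insert)
  ultimately show False using * e(4) by (simp add: dof_def)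
qed

lemma signed_sparse_orient_from:
  fixes F :: "'v::finite sedge set"
  assumes "signed_sparse m F"
  shows "signed_sparse m (orient_from v ` F)"
  unfolding signed_sparse_def
proof (intro allI impI)
  fix T' assume "T' \<subseteq> orient_from v ` F" "T' \<noteq> {}"
  then obtain T where T: "T \<subseteq> F" "T' = orient_from v ` T" "T \<noteq> {}" by (auto simp: subset_image_iff)
  have "card T' = card T"
    unfolding T(2) by (rule card_image) (rule inj_on_subset[OF inj_on_orient_from[OF assms] T(1)])
  then show "((\<exists>\<phi>. potential \<phi> T') \<longrightarrow> card T' + 3 \<le> 2 * card (sverts T')) \<and> card T' + m \<le> 2 * card (sverts T')"
    using assms T unfolding signed_sparse_def by simp
qed

section \<open>Orbit rigidity matrices\<close>

text \<open>The action of the group on homogeneous coordinates in which the first entry is the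
  component along the normal of the mirror.\<close>

definition flip :: "bit \<Rightarrow> real^3 \<Rightarrow> real^3" where
  "flip \<alpha> x = (if \<alpha> = 0 then x else vector [- x $ 1, x $ 2, x $ 3])"

definition gain_sign :: "real \<Rightarrow> bit \<Rightarrow> real" where
  "gain_sign eps \<alpha> = (if \<alpha> = 0 then 1 else eps)"

lemma flip_nth [simp]:
  "flip \<alpha> x $ 1 = (if \<alpha> = 0 then x $ 1 else - x $ 1)" "flip \<alpha> x $ 2 = x $ 2" "flip \<alpha> x $ 3 = x $ 3"
  by (simp_all add: flip_def)

lemma flip_0 [simp]: "flip 0 x = x"
  by (simp add: flip_def)

lemma flip_flip [simp]: "flip \<alpha> (flip \<beta> x) = flip (\<alpha> + \<beta>) x"
  by (cases \<alpha>; cases \<beta>) (auto simp: vec_eq_iff forall_3)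

lemma flip_add: "flip \<alpha> (x + y) = flip \<alpha> x + flip \<alpha> y"
  by (auto simp: vec_eq_iff forall_3)

lemma flip_scaleR: "flip \<alpha> (c *\<^sub>R x) = c *\<^sub>R flip \<alpha> x"
  by (auto simp: vec_eq_iff forall_3)

lemma flip_minus: "flip \<alpha> (- x) = - flip \<alpha> x"
  by (auto simp: vec_eq_iff forall_3)

lemma linear_flip: "linear (flip \<alpha>)"
  by (auto intro!: linearI simp: flip_add flip_scaleR)

lemma flip_eq_0_iff [simp]: "flip \<alpha> x = 0 \<longleftrightarrow> x = 0"
  by (auto simp: vec_eq_iff forall_3)

lemma inner_flip: "flip \<alpha> x \<bullet> y = x \<bullet> flip \<alpha> y"
  by (auto simp: inner_vec_def sum_3)

text \<open>A reflection has determinant -1, so it commutes with the cross product only up to sign;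
  for gain 1 this sign cancels the one from exchanging the factors.\<close>

lemma cross3_flip_swap:
  "cross3 y (flip \<alpha> x) = (if \<alpha> = 0 then - cross3 x y else flip 1 (cross3 x (flip \<alpha> y)))"
  by (auto simp: vec_eq_iff forall_3 cross_components)

lemma gain_sign_0 [simp]: "gain_sign eps 0 = 1"
  by (simp add: gain_sign_def)

lemma gain_sign_add: "eps * eps = 1 \<Longrightarrow> gain_sign eps (\<alpha> + \<beta>) = gain_sign eps \<alpha> * gain_sign eps \<beta>"
  by (cases \<alpha>; cases \<beta>) (auto simp: gain_sign_def)

lemma gain_sign_mult_self [simp]: "eps * eps = 1 \<Longrightarrow> gain_sign eps \<alpha> * gain_sign eps \<alpha> = 1"
  by (auto simp: gain_sign_def)

text \<open>
  The row of an edge orbit in the block of velocities that are multiplied by \<open>eps\<close> under the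
  symmetry: \<open>eps = 1\<close> is the symmetric block, \<open>eps = -1\<close> the antisymmetric one.  The second end of
  \<open>(u, w, \<alpha>)\<close> is the mirror image of \<open>w\<close> if \<open>\<alpha> = 1\<close>, and its contribution is pulled back to \<open>w\<close>.
\<close>

definition orbit_row :: "real \<Rightarrow> (real^3)^'v::finite \<Rightarrow> 'v sedge \<Rightarrow> (real^3)^'v" where
  "orbit_row eps Y = (\<lambda>(u, w, \<alpha>). axis u (cross3 (Y $ u) (flip \<alpha> (Y $ w))) +
     axis w (gain_sign eps \<alpha> *\<^sub>R cross3 (Y $ w) (flip \<alpha> (Y $ u))))"

lemma orbit_row_nth:
  "orbit_row eps Y (u, w, \<alpha>) $ z =
     (if z = u then cross3 (Y $ u) (flip \<alpha> (Y $ w)) else 0) +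
     (if z = w then gain_sign eps \<alpha> *\<^sub>R cross3 (Y $ w) (flip \<alpha> (Y $ u)) else 0)"
  by (auto simp: orbit_row_def axis_def)

lemma orbit_row_swap:
  fixes Y :: "(real^3)^'v::finite"
  assumes "eps * eps = 1"
  shows "orbit_row eps Y (w, u, \<alpha>) = gain_sign eps \<alpha> *\<^sub>R orbit_row eps Y (u, w, \<alpha>)"
proof (rule vec_eq_iff[THEN iffD2], rule allI)
  fix z
  show "orbit_row eps Y (w, u, \<alpha>) $ z = (gain_sign eps \<alpha> *\<^sub>R orbit_row eps Y (u, w, \<alpha>)) $ z"
    using assms by (auto simp: orbit_row_nth scaleR_add_right)
qed

lemma polynomial_function_orbit_row:
  fixes e :: "'v::finite sedge"
  shows "polynomial_function (\<lambda>Y. orbit_row eps Y e)"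
proof -
  obtain u w \<alpha> where e: "e = (u, w, \<alpha>)" by (cases e)
  have c: "polynomial_function (\<lambda>Y :: (real^3)^'v. cross3 (Y $ u) (flip \<alpha> (Y $ w)))" for u w :: 'v
  proof (rule polynomial_function_bilinear[OF bilinear_cross])
    show "polynomial_function (\<lambda>Y :: (real^3)^'v. Y $ u)"
      by (intro polynomial_function_bounded_linear bounded_linear_vec_nth)
    have "bounded_linear (\<lambda>Y :: (real^3)^'v. flip \<alpha> (Y $ w))"
      using linear_compose[OF bounded_linear.linear[OF bounded_linear_vec_nth[of w]] linear_flip[of \<alpha>]]
      by (simp add: o_def linear_conv_bounded_linear)
    then show "polynomial_function (\<lambda>Y :: (real^3)^'v. flip \<alpha> (Y $ w))"
      by (rule polynomial_function_bounded_linear)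
  qed
  have a: "polynomial_function (\<lambda>Y. axis u (f Y) :: (real^3)^'v)" if "polynomial_function f"
    for f :: "(real^3)^'v \<Rightarrow> real^3" and u :: 'v
  proof -
    have "linear (axis u :: real^3 \<Rightarrow> (real^3)^'v)"
      by (auto intro!: linearI simp: vec_eq_iff[where 'b='v] axis_def)
    then have "polynomial_function (axis u :: real^3 \<Rightarrow> (real^3)^'v)"
      by (intro polynomial_function_bounded_linear) (simp add: linear_conv_bounded_linear)
    from polynomial_function_compose[OF that this] show ?thesis by (simp add: o_def)
  qed
  show ?thesis
    unfolding orbit_row_def e prod.case
    by (intro polynomial_function_add a c polynomial_function_cmul)
qed

section \<open>Covering vertices in general position\<close>

definition place :: "(real^3)^'v \<Rightarrow> 'v \<times> bit \<Rightarrow> real^3" where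
  "place Y c = flip (snd c) (Y $ fst c)"

definition general_position :: "(real^3)^'v::finite \<Rightarrow> bool" where
  "general_position Y \<longleftrightarrow>
     (\<forall>c d. c \<noteq> d \<longrightarrow> cross3 (place Y c) (place Y d) \<noteq> 0) \<and>
     (\<forall>c d e. c \<noteq> d \<longrightarrow> d \<noteq> e \<longrightarrow> c \<noteq> e \<longrightarrow> place Y c \<bullet> cross3 (place Y d) (place Y e) \<noteq> 0)"

text \<open>A witness is a symmetric set of points on a parabola.\<close>

lemma generically_general_position: "generically (general_position :: (real^3)^'v::finite \<Rightarrow> bool)"
proof -
  obtain f :: "'v \<Rightarrow> nat" where f: "inj f"
    using finite_imp_inj_to_nat_seg[OF finite[of "UNIV :: 'v set"]] by auto
  \<comment> \<open>Mirror images have opposite parameters; adding 1 keeps the parameters away from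
    0, so that all covering vertices get distinct ones.\<close>
  define t where "t c = (if snd c = 0 then 1 + real (f (fst c)) else - 1 - real (f (fst c)))" for c :: "'v \<times> bit"
  define Y where "Y = (\<chi> u. (vector [t (u, 0), t (u, 0) ^ 2, 1] :: real^3))"
  have t: "t c \<noteq> 0" for c by (auto simp: t_def)
  have inj: "t c = t d \<Longrightarrow> c = d" for c d
    using f by (cases "snd c"; cases "snd d") (auto simp: t_def prod_eq_iff inj_def)
  have pl: "place Y c = vector [t c, t c ^ 2, 1]" for c
    by (cases "snd c") (auto simp: place_def Y_def t_def vec_eq_iff forall_3 power2_eq_square algebra_simps)
  have lin: "polynomial_function (\<lambda>Y :: (real^3)^'v. place Y c)" for c
  proof -
    have "bounded_linear (\<lambda>Y :: (real^3)^'v. place Y c)"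
      using linear_compose[OF bounded_linear.linear[OF bounded_linear_vec_nth[of "fst c"]] linear_flip[of "snd c"]]
      by (simp add: o_def linear_conv_bounded_linear place_def)
    then show ?thesis by (rule polynomial_function_bounded_linear)
  qed
  have cr: "polynomial_function (\<lambda>Y :: (real^3)^'v. cross3 (place Y c) (place Y d))" for c d
    by (rule polynomial_function_bilinear[OF bilinear_cross lin lin])
  have bi: "bilinear (inner :: real^3 \<Rightarrow> real^3 \<Rightarrow> real)"
    by (simp add: bilinear_def linear_iff inner_add_left inner_add_right)
  have 2: "generically (\<lambda>Y :: (real^3)^'v. cross3 (place Y c) (place Y d) \<noteq> 0)" if "c \<noteq> d" for c d
  proof -
    have "real_polynomial_function (\<lambda>Y :: (real^3)^'v. cross3 (place Y c) (place Y d) \<bullet> cross3 (place Y c) (place Y d))"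
      unfolding real_polynomial_function_eq by (rule polynomial_function_bilinear[OF bi cr cr])
    moreover have "cross3 (place Y c) (place Y d) $ 3 = t c * t d * (t d - t c)"
      unfolding pl cross_components by (simp add: power2_eq_square algebra_simps)
    then have "cross3 (place Y c) (place Y d) \<noteq> 0" using t inj that by (metis eq_iff_diff_eq_0 mult_eq_0_iff zero_index)
    ultimately show ?thesis
      using generically_nonzero[of "\<lambda>Y :: (real^3)^'v. cross3 (place Y c) (place Y d) \<bullet> cross3 (place Y c) (place Y d)" Y]
      by simp
  qed
  have 3: "generically (\<lambda>Y :: (real^3)^'v. place Y c \<bullet> cross3 (place Y d) (place Y e) \<noteq> 0)"
    if "c \<noteq> d" "d \<noteq> e" "c \<noteq> e" for c d e
  proof (rule generically_nonzero)
    show "real_polynomial_function (\<lambda>Y :: (real^3)^'v. place Y c \<bullet> cross3 (place Y d) (place Y e))"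
      unfolding real_polynomial_function_eq by (rule polynomial_function_bilinear[OF bi lin cr])
    \<comment> \<open>A Vandermonde determinant.\<close>
    have "place Y c \<bullet> cross3 (place Y d) (place Y e) = (t c - t d) * (t d - t e) * (t e - t c)"
      unfolding pl inner_vec_def sum_3 cross_components by (simp add: power2_eq_square algebra_simps)
    then show "place Y c \<bullet> cross3 (place Y d) (place Y e) \<noteq> 0"
      using inj that by (metis eq_iff_diff_eq_0 mult_eq_0_iff)
  qed
  have g2: "generically (\<lambda>Y :: (real^3)^'v. \<forall>p\<in>{p. fst p \<noteq> snd p}.
      cross3 (place Y (fst p)) (place Y (snd p)) \<noteq> 0)"
    by (rule generically_ball[OF finite], drule CollectD, erule 2)
  have g3: "generically (\<lambda>Y :: (real^3)^'v.
      \<forall>p\<in>{p. fst p \<noteq> fst (snd p) \<and> fst (snd p) \<noteq> snd (snd p) \<and> fst p \<noteq> snd (snd p)}.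
        place Y (fst p) \<bullet> cross3 (place Y (fst (snd p))) (place Y (snd (snd p))) \<noteq> 0)"
    by (rule generically_ball[OF finite], drule CollectD, elim conjE, rule 3)
  show ?thesis
  proof (rule generically_mono[OF generically_conj[OF g2 g3]], unfold general_position_def,
      intro conjI allI impI)
    fix Y c d
    assume "(\<forall>p\<in>{p. fst p \<noteq> snd p}. cross3 (place Y (fst p)) (place Y (snd p)) \<noteq> 0) \<and>
      (\<forall>p\<in>{p. fst p \<noteq> fst (snd p) \<and> fst (snd p) \<noteq> snd (snd p) \<and> fst p \<noteq> snd (snd p)}.
        place Y (fst p) \<bullet> cross3 (place Y (fst (snd p))) (place Y (snd (snd p))) \<noteq> 0)"
    note * = this[THEN conjunct1, rule_format, of "(c, d)"]
      this[THEN conjunct2, rule_format, of "(c, d, e)" for e]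
    show "c \<noteq> d \<Longrightarrow> cross3 (place Y c) (place Y d) \<noteq> 0" using *(1) by simp
    show "c \<noteq> d \<Longrightarrow> d \<noteq> e \<Longrightarrow> c \<noteq> e \<Longrightarrow> place Y c \<bullet> cross3 (place Y d) (place Y e) \<noteq> 0" for e
      using *(2)[of e] by simp
  qed
qed

lemma generic_placement:
  fixes F :: "'v::finite sedge set"
  assumes "indep_family F (orbit_row eps Y0)"
  obtains Y where "indep_family F (orbit_row eps Y)" "general_position Y"
  using generically_ex[OF generically_conj[OF
      generically_indep_family[where r="orbit_row eps", OF polynomial_function_orbit_row assms]
      generically_general_position]] that by blast

lemma indep_family_cong:
  "(\<And>e. e \<in> F \<Longrightarrow> r e = s e) \<Longrightarrow> indep_family F r \<longleftrightarrow> indep_family F s"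
  unfolding indep_family_def by (simp cong: sum.cong)

lemma indep_family_scale:
  assumes "indep_family F r" "\<And>e. e \<in> F \<Longrightarrow> k e \<noteq> 0"
  shows "indep_family F (\<lambda>e. k e *\<^sub>R r e)"
  unfolding indep_family_def
proof (intro allI impI ballI)
  fix c e assume "(\<Sum>e\<in>F. c e *\<^sub>R k e *\<^sub>R r e) = 0" "e \<in> F"
  then have "c e * k e = 0" using indep_familyD[OF assms(1), of "\<lambda>e. c e * k e"] by simp
  then show "c e = 0" using assms(2) \<open>e \<in> F\<close> by simp
qed

lemma indep_family_image:
  assumes "inj_on g F" "indep_family (g ` F) r"
  shows "indep_family F (r \<circ> g)"
  unfolding indep_family_def
proof (intro allI impI ballI)
  fix c e assume "(\<Sum>e\<in>F. c e *\<^sub>R (r \<circ> g) e) = 0" "e \<in> F"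
  then have "(\<Sum>x\<in>g ` F. c (inv_into F g x) *\<^sub>R r x) = 0"
    by (simp add: sum.reindex[OF assms(1)] inv_into_f_f[OF assms(1)])
  from indep_familyD[OF assms(2) this, of "g e"] show "c e = 0"
    using \<open>e \<in> F\<close> by (simp add: inv_into_f_f[OF assms(1)])
qed

lemma indep_family_orient_from:
  fixes F :: "'v::finite sedge set"
  assumes "eps * eps = 1" "inj_on (orient_from v) F" "indep_family (orient_from v ` F) (orbit_row eps Y)"
  shows "indep_family F (orbit_row eps Y)"
proof -
  define k where "k e = (if fst (snd e) = v then gain_sign eps (snd (snd e)) else 1)" for e :: "'v sedge"
  have k: "k e * k e = 1" for e using assms(1) by (simp add: k_def)
  have "orbit_row eps Y (orient_from v e) = k e *\<^sub>R orbit_row eps Y e" for e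
    using orbit_row_swap[OF assms(1), of Y v "fst e" "snd (snd e)"]
    by (cases e) (auto simp: orient_from_def k_def)
  then have "k e *\<^sub>R (orbit_row eps Y \<circ> orient_from v) e = orbit_row eps Y e" for e
    using k by simp
  then show ?thesis
    using indep_family_scale[OF indep_family_image[OF assms(2,3)], of k] k by (metis (no_types, lifting) ext mult_zero_left zero_neq_one)
qed

section \<open>Extension by one vertex\<close>

definition replace :: "(real^3)^'v \<Rightarrow> 'v \<Rightarrow> real^3 \<Rightarrow> (real^3)^'v::finite" where
  "replace Y v X = (\<chi> u. if u = v then X else Y $ u)"

lemma replace_nth [simp]: "replace Y v X $ u = (if u = v then X else Y $ u)"
  by (simp add: replace_def)

lemma orbit_row_replace:
  assumes "v \<notin> sverts F" "e \<in> F"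
  shows "orbit_row eps (replace Y v X) e = orbit_row eps Y e" "orbit_row eps Y e $ v = 0"
proof -
  obtain u w \<alpha> where e: "e = (u, w, \<alpha>)" by (cases e)
  then have "u \<noteq> v" "w \<noteq> v" using assms in_sverts[of u w \<alpha> F] by auto
  then show "orbit_row eps (replace Y v X) e = orbit_row eps Y e" "orbit_row eps Y e $ v = 0"
    by (auto simp: e orbit_row_def axis_def)
qed

text \<open>The matrix is block triangular: rows of \<open>F\<close> vanish at \<open>v\<close>, so
  the component at \<open>v\<close> of a dependence involves \<open>S\<close> alone and kills its
  coefficients first.\<close>

lemma zero_extension:
  fixes F :: "'v::finite sedge set"
  assumes F: "indep_family F (orbit_row eps Y)" and v: "v \<notin> sverts F"
    and S: "indep_family S (\<lambda>e. orbit_row eps (replace Y v X) e $ v)" and disj: "F \<inter> S = {}"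
  shows "indep_family (F \<union> S) (orbit_row eps (replace Y v X))"
  unfolding indep_family_def
proof (intro allI impI)
  let ?r = "orbit_row eps (replace Y v X)"
  fix c assume 0: "(\<Sum>e\<in>F \<union> S. c e *\<^sub>R ?r e) = 0"
  have split: "(\<Sum>e\<in>F. c e *\<^sub>R ?r e) + (\<Sum>e\<in>S. c e *\<^sub>R ?r e) = 0"
    using 0 disj by (subst (asm) sum.union_disjoint) auto
  have "(\<Sum>e\<in>F. c e *\<^sub>R ?r e) $ v = 0"
    using orbit_row_replace[OF v] by (simp add: sum_component)
  then have "(\<Sum>e\<in>S. c e *\<^sub>R ?r e $ v) = 0"
    using arg_cong[OF split, of "\<lambda>x. x $ v"] by (simp add: sum_component)
  then have S0: "c e = 0" if "e \<in> S" for e using indep_familyD[OF S] that by blast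
  then have "(\<Sum>e\<in>F. c e *\<^sub>R orbit_row eps Y e) = 0"
    using split orbit_row_replace[OF v] by (simp cong: sum.cong)
  then have "c e = 0" if "e \<in> F" for e using indep_familyD[OF F] that by blast
  with S0 show "\<forall>e\<in>F \<union> S. c e = 0" by blast
qed

text \<open>The new vertex is placed on the line through the ends of the removed edge.\<close>

lemma one_extension:
  fixes F :: "'v::finite sedge set"
  assumes eps: "eps * eps = 1" and v: "v \<notin> sverts F" "v \<noteq> fst c" "v \<noteq> fst d" "v \<noteq> fst e"
    and dist: "c \<noteq> d" "d \<noteq> e" "c \<noteq> e"
    and f: "(fst c, fst d, snd c + snd d) \<notin> F"
    and F: "indep_family (insert (fst c, fst d, snd c + snd d) F) (orbit_row eps Y)"
    and gen: "place Y c \<bullet> cross3 (place Y d) (place Y e) \<noteq> 0"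
  shows "indep_family (F \<union> {(v, c), (v, d), (v, e)})
           (orbit_row eps (replace Y v (place Y c + place Y d)))"
  unfolding indep_family_def
proof (intro allI impI)
  define X where "X = place Y c + place Y d"
  let ?f = "(fst c, fst d, snd c + snd d)"
  let ?r = "orbit_row eps (replace Y v X)" and ?S = "{(v, c), (v, d), (v, e)}"
  fix k assume 0: "(\<Sum>x\<in>F \<union> ?S. k x *\<^sub>R orbit_row eps (replace Y v (place Y c + place Y d)) x) = 0"
  have "(v, z) \<notin> F" for z using v(1) in_sverts(1)[of v "fst z" "snd z" F] by auto
  then have "F \<inter> ?S = {}" by blast
  then have split: "(\<Sum>x\<in>F. k x *\<^sub>R ?r x) + (\<Sum>x\<in>?S. k x *\<^sub>R ?r x) = 0"
    using 0 unfolding X_def by (subst (asm) sum.union_disjoint) auto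
  have S: "(\<Sum>x\<in>?S. k x *\<^sub>R ?r x) = k (v, c) *\<^sub>R ?r (v, c) + k (v, d) *\<^sub>R ?r (v, d) + k (v, e) *\<^sub>R ?r (v, e)"
    using dist by (simp add: add.assoc)
  have rv: "?r (v, b) $ v = cross3 X (place Y b)" if "fst b \<noteq> v" for b
    using that by (cases b) (simp add: orbit_row_nth place_def)
  have Fv: "(\<Sum>x\<in>F. k x *\<^sub>R ?r x) $ v = 0"
    using orbit_row_replace[OF v(1)] by (simp add: sum_component)
  let ?c = "place Y c" and ?d = "place Y d" and ?e = "place Y e"
  have eq: "k (v, c) *\<^sub>R cross3 X ?c + k (v, d) *\<^sub>R cross3 X ?d + k (v, e) *\<^sub>R cross3 X ?e = 0"
    using arg_cong[OF split, of "\<lambda>x. x $ v"] Fv v unfolding S by (simp add: rv)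
  have Xc: "cross3 X ?c = - cross3 ?c ?d" and Xd: "cross3 X ?d = cross3 ?c ?d"
    unfolding X_def cross_add_left using cross_skew[of ?d ?c] by simp_all
  \<comment> \<open>As \<open>X\<close> lies on the line through \<open>?c\<close> and
    \<open>?d\<close>, the first two products in \<open>eq\<close> are multiples of
    \<open>cross3 ?c ?d\<close> and hence orthogonal to \<open>?c\<close>; pairing with
    \<open>?c\<close> isolates the third edge.\<close>
  have "k (v, e) * (?c \<bullet> cross3 ?d ?e) = 0"
    using arg_cong[OF eq, of "\<lambda>x. x \<bullet> ?c"] unfolding Xc Xd X_def cross_add_left
    by (simp add: inner_add_left inner_add_right dot_cross_self inner_commute)
  then have ke: "k (v, e) = 0" using gen by simp
  have "(k (v, d) - k (v, c)) *\<^sub>R cross3 ?c ?d = 0"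
    using eq unfolding ke Xc Xd by (simp add: scaleR_diff_left)
  moreover have "cross3 ?c ?d \<noteq> 0"
  proof
    assume "cross3 ?c ?d = 0"
    moreover have "?c \<bullet> cross3 ?d ?e = cross3 ?c ?d \<bullet> ?e" by (simp add: cross3_simps)
    ultimately show False using gen by simp
  qed
  ultimately have kd: "k (v, d) = k (v, c)" by simp
  \<comment> \<open>Seen from either end, \<open>X\<close> differs from the other end by a multiple
    of that end itself, which the cross product ignores. So two edges at \<open>v\<close> with equal
    coefficients act away from \<open>v\<close> like the removed edge; the sign comes from pulling
    the end \<open>c\<close> back to its representative.\<close>
  have key: "?r (v, c) $ z + ?r (v, d) $ z = gain_sign eps (snd c) *\<^sub>R orbit_row eps Y ?f $ z" if "z \<noteq> v" for z
  proof -
    obtain x a y b where cd: "c = (x, a)" "d = (y, b)" by (cases c, cases d)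
    have "flip a X = Y $ x + flip (a + b) (Y $ y)" "flip b X = Y $ y + flip (a + b) (Y $ x)"
      unfolding X_def place_def cd by (simp_all add: flip_add add.commute)
    then have "cross3 (Y $ x) (flip a X) = cross3 (Y $ x) (flip (a + b) (Y $ y))"
      "cross3 (Y $ y) (flip b X) = cross3 (Y $ y) (flip (a + b) (Y $ x))"
      by (simp_all add: cross_add_right)
    moreover have "gain_sign eps a * gain_sign eps (a + b) = gain_sign eps b"
      using eps by (simp add: gain_sign_add mult.assoc[symmetric])
    ultimately show ?thesis
      using that v unfolding cd by (auto simp: orbit_row_nth scaleR_add_right)
  qed
  let ?k = "\<lambda>x. if x = ?f then k (v, c) * gain_sign eps (snd c) else k x"
  have "(\<Sum>x\<in>insert ?f F. ?k x *\<^sub>R orbit_row eps Y x) =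
      (k (v, c) * gain_sign eps (snd c)) *\<^sub>R orbit_row eps Y ?f + (\<Sum>x\<in>F. k x *\<^sub>R ?r x)"
    using f orbit_row_replace(1)[OF v(1)] by (subst sum.insert) (auto intro!: sum.cong)
  also have "\<dots> = 0"
  proof (rule vec_eq_iff[THEN iffD2], rule allI)
    fix z
    show "((k (v, c) * gain_sign eps (snd c)) *\<^sub>R orbit_row eps Y ?f + (\<Sum>x\<in>F. k x *\<^sub>R ?r x)) $ z = 0 $ z"
    proof (cases "z = v")
      case True
      have "orbit_row eps Y ?f $ v = 0" using v by (simp add: orbit_row_nth)
      then show ?thesis using Fv True by simp
    next
      case False
      have "(\<Sum>x\<in>F. k x *\<^sub>R ?r x) $ z + k (v, c) *\<^sub>R (?r (v, c) $ z + ?r (v, d) $ z) = 0"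
        using arg_cong[OF split, of "\<lambda>x. x $ z"] unfolding S ke kd by (simp add: scaleR_add_right)
      then show ?thesis unfolding key[OF False] by (simp add: add.commute)
    qed
  qed
  finally have k0: "?k x = 0" if "x \<in> insert ?f F" for x using indep_familyD[OF F, of ?k] that by blast
  have "k (v, c) * gain_sign eps (snd c) = 0" using k0[of ?f] by simp
  moreover have "gain_sign eps (snd c) \<noteq> 0" using gain_sign_mult_self[OF eps, of "snd c"] by auto
  ultimately have "k (v, c) = 0" by simp
  then have "\<forall>x\<in>?S. k x = 0" using ke kd by simp
  moreover have "\<forall>x\<in>F. k x = 0" using k0 f by (metis insertCI)
  ultimately show "\<forall>x\<in>F \<union> ?S. k x = 0" by blast
qed


lemma general_position_pair:
  assumes "general_position Y"
  shows "c \<noteq> d \<Longrightarrow> cross3 (place Y c) (place Y d) \<noteq> 0"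
    and "c \<noteq> d \<Longrightarrow> d \<noteq> e \<Longrightarrow> c \<noteq> e \<Longrightarrow> place Y c \<bullet> cross3 (place Y d) (place Y e) \<noteq> 0"
  using assms unfolding general_position_def by blast+

text \<open>A vector (x, y, z) and its mirror image have the cross product (0, -2xz, 2xy).\<close>

lemma general_position_nth:
  assumes "general_position Y"
  shows "Y $ u $ 1 \<noteq> 0" "Y $ u $ 2 \<noteq> 0 \<or> Y $ u $ 3 \<noteq> 0"
  using general_position_pair(1)[OF assms, of "(u, 0)" "(u, 1)"]
  by (auto simp: place_def cross_components vec_eq_iff forall_3)

text \<open>Cross products with \<open>P\<close> and \<open>Q\<close> are independent for every
  vector outside the plane of \<open>P\<close> and \<open>Q\<close>; the normal of this plane is
  such a vector.\<close>

lemma two_edges_free: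
  assumes "cross3 P Q \<noteq> 0" "a *\<^sub>R cross3 (cross3 P Q) P + b *\<^sub>R cross3 (cross3 P Q) Q = 0"
  shows "a = 0" "b = 0"
proof -
  have P: "cross3 (cross3 P Q) P \<bullet> Q = cross3 P Q \<bullet> cross3 P Q"
    and Q: "cross3 (cross3 P Q) Q \<bullet> P = - (cross3 P Q \<bullet> cross3 P Q)"
    by (simp_all add: cross3_simps)
  show "a = 0"
    using arg_cong[OF assms(2), of "\<lambda>x. x \<bullet> Q"] assms(1) by (simp add: inner_add_left P dot_cross_self)
  show "b = 0"
    using arg_cong[OF assms(2), of "\<lambda>x. x \<bullet> P"] assms(1) by (simp add: inner_add_left Q dot_cross_self)
qed

text \<open>The row of the loop is orthogonal to the first axis, and \<open>X\<close> is chosen so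
  that its other two entries are proportional to those of \<open>P\<close>. Pairing with
  \<open>P\<close> thus detects the loop, while the other edge is orthogonal to
  \<open>P\<close>.\<close>

lemma loop_edge_free:
  fixes P :: "real^3"
  defines "X \<equiv> vector [1, - P $ 3, P $ 2]"
  assumes P: "P $ 2 \<noteq> 0 \<or> P $ 3 \<noteq> 0" and 0: "a *\<^sub>R cross3 X (flip 1 X) + b *\<^sub>R cross3 X P = 0"
  shows "a = 0" "b = 0"
proof -
  have sq: "P $ 2 * P $ 2 + P $ 3 * P $ 3 \<noteq> 0" using P by (metis sum_squares_eq_zero_iff)
  have "cross3 X (flip 1 X) \<bullet> P = - 2 * (P $ 2 * P $ 2 + P $ 3 * P $ 3)"
    by (simp add: X_def inner_vec_def sum_3 cross_components algebra_simps)
  then show a: "a = 0"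
    using arg_cong[OF 0, of "\<lambda>x. x \<bullet> P"] sq by (simp add: inner_add_left dot_cross_self)
  have "cross3 X P $ 1 = - (P $ 2 * P $ 2 + P $ 3 * P $ 3)"
    by (simp add: X_def cross_components algebra_simps)
  then show "b = 0" using arg_cong[OF 0, of "\<lambda>x. x $ 1"] sq a by simp
qed

lemma indep_family_two:
  assumes "\<And>s t. s *\<^sub>R r x + t *\<^sub>R r y = 0 \<Longrightarrow> s = 0 \<and> t = 0" "x \<noteq> y"
  shows "indep_family {x, y} r"
  unfolding indep_family_def using assms by auto

text \<open>Induction on the number of spanned vertices. The placement from the induction hypothesis
  is moved into general position, without losing independence, before \<open>v\<close> is placed,
  since the choice of its position needs neighbours that are not special.\<close>

theorem sparse_imp_indep:
  fixes F :: "'v::finite sedge set"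
  assumes m: "m = 1 \<and> eps = 1 \<or> m = 2 \<and> eps = -1" and "signed_sparse m F"
  shows "\<exists>Y. indep_family F (orbit_row eps Y)"
  using assms(2)
proof (induction "card (sverts F)" arbitrary: F rule: less_induct)
  case less
  have eps: "eps * eps = 1" and m12: "m = 1 \<or> m = 2" and m0: "0 < m" using m by auto
  show ?case
  proof (cases "F = {}")
    case True
    then show ?thesis by (simp add: indep_family_def)
  next
    case False
    obtain v where v: "v \<in> sverts F"
      and deg: "card {e \<in> F. fst e = v} + card {e \<in> F. fst (snd e) = v} \<le> 3"
      using signed_sparse_low_degree[OF less.prems m0 False] by blast
    define H where "H = orient_from v ` F"
    have inj: "inj_on (orient_from v) F" by (rule inj_on_orient_from[OF less.prems])
    have H: "signed_sparse m H" unfolding H_def by (rule signed_sparse_orient_from[OF less.prems])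
    have vH: "sverts H = sverts F" by (simp add: H_def)
    define H0 where "H0 = {e \<in> H. fst e \<noteq> v}"
    define K where "K = {c. (v, c) \<in> H}"
    have HK: "H = H0 \<union> Pair v ` K" by (auto simp: H0_def K_def image_iff)
    have snd_H: "w = v \<Longrightarrow> u = v" if "(u, w, \<alpha>) \<in> H" for u w \<alpha>
      using that by (auto simp: H_def orient_from_def split: if_splits)
    have vH0: "v \<notin> sverts H0" using snd_H by (fastforce simp: sverts_def H0_def)
    have H0: "signed_sparse m H0" by (rule signed_sparse_subset[OF H]) (auto simp: H0_def)
    have disj: "H0 \<inter> Pair v ` K = {}" by (auto simp: H0_def)
    have small: "\<exists>Y. indep_family F' (orbit_row eps Y)"
      if "signed_sparse m F'" "sverts F' \<subseteq> sverts F - {v}" for F'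
    proof (rule less.hyps[OF _ that(1)])
      show "card (sverts F') < card (sverts F)"
        using that(2) v by (intro psubset_card_mono) auto
    qed
    have sub0: "sverts H0 \<subseteq> sverts F - {v}"
      using vH0 sverts_mono[of H0 H] vH by (auto simp: H0_def)
    define I where "I = {e \<in> F. fst e = v \<or> fst (snd e) = v}"
    have cardK: "card K = card I"
    proof -
      have "Pair v ` K = orient_from v ` I"
        by (force simp: K_def H_def I_def orient_from_def image_iff split: if_splits)
      then have "card (Pair v ` K) = card I"
        using card_image[OF inj_on_subset[OF inj, of I]] by (simp add: I_def)
      then show ?thesis by (simp add: card_image inj_on_def)
    qed
    \<comment> \<open>A loop counts twice in the degree, so beside it there is room for at most one
      more edge at \<open>v\<close>.\<close>
    have degI: "card I + card {e \<in> F. fst e = v \<and> fst (snd e) = v} \<le> 3"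
    proof -
      have "card {e \<in> F. fst e = v} + card {e \<in> F. fst (snd e) = v} =
          card ({e \<in> F. fst e = v} \<union> {e \<in> F. fst (snd e) = v}) +
          card ({e \<in> F. fst e = v} \<inter> {e \<in> F. fst (snd e) = v})"
        by (rule card_Un_Int) auto
      moreover have "{e \<in> F. fst e = v} \<union> {e \<in> F. fst (snd e) = v} = I"
        "{e \<in> F. fst e = v} \<inter> {e \<in> F. fst (snd e) = v} = {e \<in> F. fst e = v \<and> fst (snd e) = v}"
        by (auto simp: I_def)
      ultimately show ?thesis using deg by simp
    qed
    have "\<exists>Y. indep_family H (orbit_row eps Y)"
    proof (cases "\<exists>\<alpha>. (v, \<alpha>) \<in> K")
      case True
      \<comment> \<open>A loop has 1 degree of freedom: too few for \<open>m = 2\<close>, and too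
        few for a balanced set, which a loop of gain 0 is.\<close>
      have loop: "\<alpha> = 1 \<and> m = 1" if "(v, \<alpha>) \<in> K" for \<alpha>
      proof -
        have in_H: "{(v, v, \<alpha>)} \<subseteq> H" using that by (simp add: K_def)
        have "dof {(v, v, \<alpha>)} = 1" by (simp add: dof_def sverts_insert)
        moreover have "potential (\<lambda>_. 0) {(v, v, 0)}" by (simp add: potential_def)
        ultimately show ?thesis
          using signed_sparse_dof[OF H in_H] m12 by (cases \<alpha>) force+
      qed
      then have v1: "(v, 1) \<in> K" and m1: "m = 1" "eps = 1" using True m by auto
      have "{e \<in> F. fst e = v \<and> fst (snd e) = v} \<noteq> {}"
        using v1 by (force simp: K_def H_def orient_from_def split: if_splits)
      then have "card {e \<in> F. fst e = v \<and> fst (snd e) = v} > 0" by (simp add: card_gt_0_iff)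
      then have "card K \<le> 2" using cardK degI by linarith
      then have "card (K - {(v, 1)}) \<le> 1" using v1 by simp
      then obtain c0 where c0: "K - {(v, 1)} \<subseteq> {c0}"
        by (metis card_le_Suc0_iff_eq finite One_nat_def empty_subsetI insertCI subsetI ex_in_conv)
      obtain Y0 where "indep_family H0 (orbit_row eps Y0)" using small[OF H0 sub0] by blast
      then obtain Y where Y: "indep_family H0 (orbit_row eps Y)" "general_position Y"
        by (rule generic_placement)
      \<comment> \<open>If the loop is the only edge at \<open>v\<close>, any vector off the first
        axis serves.\<close>
      define P where "P = (if K = {(v, 1)} then axis 2 1 else place Y c0)"
      have P: "P $ 2 \<noteq> 0 \<or> P $ 3 \<noteq> 0"
        using general_position_nth(2)[OF Y(2), of "fst c0"] by (auto simp: P_def place_def axis_def)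
      define X where "X = (vector [1, - P $ 3, P $ 2] :: real^3)"
      have rl: "orbit_row eps (replace Y v X) (v, v, 1) $ v = 2 *\<^sub>R cross3 X (flip 1 X)"
        by (simp add: orbit_row_nth m1 gain_sign_def scaleR_2)
      have "indep_family (Pair v ` K) (\<lambda>e. orbit_row eps (replace Y v X) e $ v)"
      proof (cases "K = {(v, 1)}")
        case True
        have "cross3 X (flip 1 X) \<noteq> 0"
          using loop_edge_free(1)[OF P, of 1 0] by (auto simp: X_def)
        then show ?thesis unfolding True by (simp add: indep_family_def rl)
      next
        case False
        then have Kc: "K = {(v, 1), c0}" and c0v: "c0 \<noteq> (v, 1)" using c0 v1 by auto
        have "fst c0 \<noteq> v"
          using loop[of "snd c0"] Kc c0v by (metis insertCI prod.collapse)
        then have "orbit_row eps (replace Y v X) (v, c0) $ v = cross3 X P"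
          using False by (cases c0) (simp add: orbit_row_nth place_def P_def)
        then have "indep_family {(v, v, 1), (v, c0)} (\<lambda>e. orbit_row eps (replace Y v X) e $ v)"
          using loop_edge_free[OF P] c0v
          by (intro indep_family_two) (force simp: rl X_def[symmetric])+
        then show ?thesis by (simp add: Kc)
      qed
      from zero_extension[OF Y(1) vH0 this disj] show ?thesis unfolding HK by blast
    next
      case False
      then have nl: "fst c \<noteq> v" if "c \<in> K" for c using that by (metis prod.collapse)
      have "card K \<le> 3" using cardK degI by linarith
      show ?thesis
      proof (cases "card K = 3")
        case True
        then obtain c d e where K: "K = {c, d, e}" and dist: "c \<noteq> d" "d \<noteq> e" "c \<noteq> e"
          by (auto simp: card_3_iff)
        have "signed_sparse m (H0 \<union> {(v, fst c, snd c), (v, fst d, snd d), (v, fst e, snd e)})"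
          using H unfolding HK K by simp
        from one_reduction[OF this m12 vH0 _ _ _ dist] nl
        obtain c' d' e' where cde: "{c', d', e'} = {c, d, e}" "c' \<noteq> d'" "d' \<noteq> e'" "c' \<noteq> e'"
          and add: "addable m H0 c' d'" unfolding K by (metis insertCI)
        have K': "K = {c', d', e'}" using K cde(1) by simp
        let ?f = "(fst c', fst d', snd c' + snd d')"
        have "sverts (insert ?f H0) \<subseteq> sverts F - {v}"
        proof -
          have "fst x \<in> sverts F - {v}" if "x \<in> K" for x
            using that nl[OF that] in_sverts(2)[of v "fst x" "snd x" H] vH by (simp add: K_def)
          then show ?thesis using sub0 K' by (auto simp: sverts_insert)
        qed
        with add small obtain Y0 where "indep_family (insert ?f H0) (orbit_row eps Y0)"
          unfolding addable_def by blast
        then obtain Y where Y: "indep_family (insert ?f H0) (orbit_row eps Y)" "general_position Y"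
          by (rule generic_placement)
        have "indep_family (H0 \<union> {(v, c'), (v, d'), (v, e')})
           (orbit_row eps (replace Y v (place Y c' + place Y d')))"
          using add nl[of c'] nl[of d'] nl[of e'] K' unfolding addable_def
          by (intro one_extension[OF eps vH0 _ _ _ cde(2-4) _ Y(1)] general_position_pair(2)[OF Y(2)] cde) simp_all
        then show ?thesis unfolding HK K' by auto
      next
        case False
        then have le2: "card K \<le> 2" using \<open>card K \<le> 3\<close> by simp
        obtain Y0 where "indep_family H0 (orbit_row eps Y0)" using small[OF H0 sub0] by blast
        then obtain Y where Y: "indep_family H0 (orbit_row eps Y)" "general_position Y"
          by (rule generic_placement)
        show ?thesis
        proof (cases "K = {}")
          case True
          then show ?thesis using Y(1) by (auto simp: HK)
        next
          case False
          then obtain c where c: "c \<in> K" by blast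
          obtain d where d: "K \<subseteq> {c, d}" "c \<noteq> d" "fst d \<noteq> v"
          proof (cases "K = {c}")
            case True
            \<comment> \<open>With a single edge at \<open>v\<close>, the mirror image of its end
              stands in for the missing second end; it only serves to define
              \<open>X\<close>.\<close>
            then show thesis using that[of "(fst c, snd c + 1)"] nl[OF c] by (cases c) auto
          next
            case False
            then obtain d where d: "d \<in> K" "d \<noteq> c" using c by auto
            have "K = {c, d}"
              using card_seteq[of K "{c, d}"] c d le2 by auto
            then show thesis using that[of d] d nl by auto
          qed
          define X where "X = cross3 (place Y c) (place Y d)"
          have r: "orbit_row eps (replace Y v X) (v, b) $ v = cross3 X (place Y b)" if "fst b \<noteq> v" for b
            using that by (cases b) (simp add: orbit_row_nth place_def)
          have "indep_family {(v, c), (v, d)} (\<lambda>e. orbit_row eps (replace Y v X) e $ v)"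
            using two_edges_free[OF general_position_pair(1)[OF Y(2) d(2)]] d nl[OF c]
            by (intro indep_family_two) (force simp: r X_def[symmetric])+
          then have "indep_family (Pair v ` K) (\<lambda>e. orbit_row eps (replace Y v X) e $ v)"
            by (rule indep_family_subset) (use d(1) in auto)
          from zero_extension[OF Y(1) vH0 this disj] show ?thesis unfolding HK by blast
        qed
      qed
    qed
    then show ?thesis
      using indep_family_orient_from[OF eps inj] unfolding H_def by blast
  qed
qed


section \<open>Necessity of the counts: trivial motions\<close>

lemma dim_vec_supported:
  "dim {x :: 'a::euclidean_space^'v::finite. \<forall>u. u \<notin> K \<longrightarrow> x $ u = 0} = card K * DIM('a)"
proof -
  define d where "d = (\<lambda>(u, b). axis u b :: 'a^'v) ` (K \<times> Basis)"
  have inj: "inj_on (\<lambda>(u, b). axis u b :: 'a^'v) (K \<times> Basis)"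
    by (auto simp: inj_on_def axis_eq_axis)
  have mem: "axis u b \<in> d \<longleftrightarrow> u \<in> K" if "b \<in> Basis" for u b
    using that by (auto simp: d_def image_iff axis_eq_axis)
  have "{x :: 'a^'v. \<forall>u. u \<notin> K \<longrightarrow> x $ u = 0} = {x. \<forall>i\<in>Basis. i \<notin> d \<longrightarrow> x \<bullet> i = 0}"
  proof (intro Collect_cong iffI allI impI ballI)
    fix x :: "'a^'v" and i assume x: "\<forall>u. u \<notin> K \<longrightarrow> x $ u = 0" and i: "i \<in> Basis" "i \<notin> d"
    from i(1) obtain u b where "i = axis u b" "b \<in> Basis" by (auto simp: Basis_vec_def)
    with x i(2) mem show "x \<bullet> i = 0" by (simp add: inner_axis)
  next
    fix x :: "'a^'v" and u assume x: "\<forall>i\<in>Basis. i \<notin> d \<longrightarrow> x \<bullet> i = 0" and u: "u \<notin> K"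
    show "x $ u = 0"
    proof (rule euclidean_eqI)
      fix b :: 'a assume b: "b \<in> Basis"
      then have "x \<bullet> axis u b = 0" using x mem u by (auto simp: Basis_vec_def)
      then show "x $ u \<bullet> b = 0 \<bullet> b" by (simp add: inner_axis)
    qed
  qed
  also have "dim \<dots> = card d" by (rule dim_substandard) (auto simp: d_def Basis_vec_def)
  also have "\<dots> = card K * DIM('a)" unfolding d_def by (subst card_image[OF inj]) (simp add: card_cartesian_product)
  finally show ?thesis .
qed

text \<open>How an infinitesimal isometry of the sphere, encoded by a constant vector, acts
  on the other half of the orbit.\<close>

definition twist :: "real \<Rightarrow> bit \<Rightarrow> real^3 \<Rightarrow> real^3" where
  "twist eps \<alpha> z = (if \<alpha> = 0 then z else - eps *\<^sub>R flip 1 z)"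

lemma twist_0 [simp]: "twist eps 0 z = z"
  by (simp add: twist_def)

lemma twist_twist: "eps * eps = 1 \<Longrightarrow> twist eps \<alpha> (twist eps \<beta> z) = twist eps (\<alpha> + \<beta>) z"
  by (cases \<alpha>; cases \<beta>) (auto simp: twist_def flip_scaleR flip_minus)

lemma linear_twist: "linear (twist eps \<alpha>)"
  by (auto intro!: linearI simp: twist_def flip_add flip_scaleR algebra_simps)

lemmas twist_linear = linear_add[OF linear_twist] linear_cmul[OF linear_twist]

text \<open>The equation of a single bar between \<open>u\<close> and the covering vertex over
  \<open>w\<close>: \<open>twist\<close> transports the velocity of \<open>w\<close> there, and its
  sign compensates for the reflection reversing cross products.\<close>

lemma orbit_row_inner:
  "orbit_row eps Y (u, w, \<alpha>) \<bullet> x = cross3 (Y $ u) (flip \<alpha> (Y $ w)) \<bullet> (x $ u - twist eps \<alpha> (x $ w))"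
proof -
  have "(gain_sign eps \<alpha> *\<^sub>R cross3 (Y $ w) (flip \<alpha> (Y $ u))) \<bullet> x $ w =
      - (cross3 (Y $ u) (flip \<alpha> (Y $ w)) \<bullet> twist eps \<alpha> (x $ w))"
    unfolding cross3_flip_swap[of "Y $ w"]
    by (cases \<alpha>) (auto simp: twist_def gain_sign_def inner_flip)
  then show ?thesis
    by (simp add: orbit_row_def inner_add_left inner_axis_left inner_diff_right)
qed

text \<open>In the space of dimension 3 per vertex, the rows are orthogonal to the multiples of
  \<open>Y $ u\<close> at each vertex and to the trivial motions \<open>z\<close>, read at the
  covering vertex chosen by \<open>\<phi>\<close>. Assumption \<open>triv\<close> says that these
  readings are consistent along every edge, and \<open>inj\<close> that no trivial motion is a
  combination of the multiples.\<close>

lemma orbit_rows_count: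
  fixes T :: "'v::finite sedge set" and Z :: "(real^3) set"
  assumes T: "indep_family T (orbit_row eps Y)" and eps: "eps * eps = 1"
    and Y: "\<And>u. Y $ u \<noteq> 0" and Z: "subspace Z"
    and triv: "\<And>u w \<alpha> z. (u, w, \<alpha>) \<in> T \<Longrightarrow> z \<in> Z \<Longrightarrow> twist eps (\<phi> u) z = twist eps (\<alpha> + \<phi> w) z"
    and inj: "\<And>z c. z \<in> Z \<Longrightarrow> (\<And>u. u \<in> sverts T \<Longrightarrow> c u *\<^sub>R Y $ u + twist eps (\<phi> u) z = 0) \<Longrightarrow> z = 0"
  shows "card T + dim Z \<le> 2 * card (sverts T)"
proof -
  let ?K = "sverts T"
  define L :: "(real^'v) \<times> (real^3) \<Rightarrow> (real^3)^'v" where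
    "L = (\<lambda>(c, z). \<chi> u. if u \<in> ?K then (c $ u) *\<^sub>R Y $ u + twist eps (\<phi> u) z else 0)"
  define A :: "(real^'v) set" where "A = {c. \<forall>u. u \<notin> ?K \<longrightarrow> c $ u = 0}"
  define W :: "((real^3)^'v) set" where "W = {x. \<forall>u. u \<notin> ?K \<longrightarrow> x $ u = 0}"
  have subA: "subspace A" by (auto simp: A_def subspace_def)
  have L_nth: "L (c, z) $ u = (if u \<in> ?K then (c $ u) *\<^sub>R Y $ u + twist eps (\<phi> u) z else 0)" for c z u
    by (simp add: L_def)
  have linL: "linear L"
  proof (rule linearI)
    fix p q :: "(real^'v) \<times> (real^3)" and r :: real
    obtain c z c' z' where pq: "p = (c, z)" "q = (c', z')" by (cases p, cases q)
    show "L (p + q) = L p + L q"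
      by (rule vec_eq_iff[THEN iffD2]) (auto simp: pq L_nth linear_add[OF linear_twist] scaleR_add_left)
    show "L (r *\<^sub>R p) = r *\<^sub>R L p"
      by (rule vec_eq_iff[THEN iffD2]) (auto simp: pq L_nth linear_cmul[OF linear_twist] scaleR_add_right)
  qed
  have subAZ: "subspace (A \<times> Z)" using subA Z by (rule subspace_Times)
  have "inj_on L (A \<times> Z)"
    unfolding linear_inj_on_iff_eq_0[OF linL subAZ]
  proof (intro ballI impI)
    fix p assume p: "p \<in> A \<times> Z" "L p = 0"
    obtain c z where cz: "p = (c, z)" by (cases p)
    have 0: "(c $ u) *\<^sub>R Y $ u + twist eps (\<phi> u) z = 0" if "u \<in> ?K" for u
      using arg_cong[OF p(2), of "\<lambda>x. x $ u"] that by (simp add: cz L_nth)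
    then have z: "z = 0" using inj[of z "\<lambda>u. c $ u"] p(1) cz by auto
    then have "c $ u = 0" for u
      using 0[of u] p(1) Y[of u] by (cases "u \<in> ?K") (auto simp: cz A_def linear_0[OF linear_twist])
    then have "c = 0" by (simp add: vec_eq_iff)
    then show "p = 0" using z by (simp add: cz zero_prod_def)
  qed
  then have "dim (L ` (A \<times> Z)) = dim (A \<times> Z)"
    using linL subAZ by (intro dim_image_eq) (auto simp: span_eq_iff[THEN iffD2])
  also have "\<dots> = card ?K + dim Z"
    using dim_Times[OF subA Z] dim_vec_supported[of ?K, where 'a=real] by (simp add: A_def)
  finally have dL: "dim (L ` (A \<times> Z)) = card ?K + dim Z" .
  have orth: "x \<bullet> y = 0" if x: "x \<in> orbit_row eps Y ` T" and y: "y \<in> L ` (A \<times> Z)" for x y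
  proof -
    obtain u w \<alpha> where e: "(u, w, \<alpha>) \<in> T" "x = orbit_row eps Y (u, w, \<alpha>)" using x by force
    obtain c z where cz: "z \<in> Z" "y = L (c, z)" using y by auto
    have uw: "u \<in> ?K" "w \<in> ?K" using in_sverts[OF e(1)] by auto
    have tw: "twist eps (\<phi> u) z - twist eps \<alpha> (twist eps (\<phi> w) z) = 0"
      using triv[OF e(1) cz(1)] twist_twist[OF eps] by simp
    have flipw: "twist eps \<alpha> (Y $ w) = gain_sign (- eps) \<alpha> *\<^sub>R flip \<alpha> (Y $ w)"
      by (cases \<alpha>) (auto simp: twist_def gain_sign_def)
    have "L (c, z) $ u - twist eps \<alpha> (L (c, z) $ w) =
        (c $ u) *\<^sub>R Y $ u - (c $ w * gain_sign (- eps) \<alpha>) *\<^sub>R flip \<alpha> (Y $ w)"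
      using uw tw by (simp add: L_nth twist_linear flipw algebra_simps)
    then show ?thesis
      unfolding e(2) cz(2) orbit_row_inner by (simp add: inner_diff_right dot_cross_self inner_commute)
  qed
  have "dim (orbit_row eps Y ` T) = card T"
    using T unfolding indep_family_iff_independent[OF finite]
    by (metis card_image dim_eq_card_independent)
  then have "card T + (card ?K + dim Z) = dim (orbit_row eps Y ` T \<union> L ` (A \<times> Z))"
    using dim_orthogonal_sum[OF orth] dL by simp
  also have "\<dots> \<le> dim W"
  proof (rule dim_subset)
    have "orbit_row eps Y e \<in> W" if "e \<in> T" for e
    proof -
      obtain u w \<alpha> where e: "e = (u, w, \<alpha>)" by (cases e)
      then show ?thesis using in_sverts[of u w \<alpha> T] that by (auto simp: W_def e orbit_row_nth)
    qed
    then show "orbit_row eps Y ` T \<union> L ` (A \<times> Z) \<subseteq> W" by (auto simp: W_def L_nth)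
  qed
  also have "dim W = card ?K * 3"
    unfolding W_def using dim_vec_supported[of ?K, where 'a="real^3"] by simp
  finally show ?thesis by simp
qed

theorem indep_imp_sparse:
  fixes F :: "'v::finite sedge set"
  assumes m: "m = 1 \<and> eps = 1 \<or> m = 2 \<and> eps = -1" and "indep_family F (orbit_row eps Y0)"
  shows "signed_sparse m F"
proof -
  obtain Y where Y: "indep_family F (orbit_row eps Y)" "general_position Y"
    using assms(2) by (rule generic_placement)
  have eps: "eps * eps = 1" using m by auto
  have nz: "Y $ u \<noteq> 0" for u using general_position_nth(1)[OF Y(2), of u] by auto
  show ?thesis
    unfolding signed_sparse_def
  proof (intro allI impI conjI)
    fix T assume T: "T \<subseteq> F" "T \<noteq> {}"
    have IT: "indep_family T (orbit_row eps Y)" by (rule indep_family_subset[OF Y(1) T(1)]) simp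
    obtain u0 w0 \<alpha>0 where e0: "(u0, w0, \<alpha>0) \<in> T" using T(2) by auto
    \<comment> \<open>The vectors fixed by \<open>twist eps 1\<close>: the first coordinate is
      translation along the mirror, the other two are translation across it and rotation. They are
      consistent along every edge whatever its gain.\<close>
    define J :: "3 set" where "J = (if m = 1 then {1} else {2, 3})"
    define Z :: "(real^3) set" where "Z = {z. \<forall>i. i \<notin> J \<longrightarrow> z $ i = 0}"
    have tz: "twist eps \<alpha> z = z" if "z \<in> Z" for \<alpha> z
      using that m by (auto simp: Z_def J_def twist_def vec_eq_iff forall_3)
    have "dim Z = card J" unfolding Z_def using dim_vec_supported[of J, where 'a=real] by simp
    also have "\<dots> = m" using m by (auto simp: J_def)
    finally have dZ: "dim Z = m" .
    have "card T + dim Z \<le> 2 * card (sverts T)"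
    proof (rule orbit_rows_count[OF IT eps nz, of Z "\<lambda>_. 0"])
      show "subspace Z" by (auto simp: Z_def subspace_def)
      show "twist eps 0 z = twist eps (\<alpha> + 0) z" if "z \<in> Z" for \<alpha> z using tz[OF that] by simp
      show "z = 0" if z: "z \<in> Z" and 0: "\<And>u. u \<in> sverts T \<Longrightarrow> c u *\<^sub>R Y $ u + twist eps 0 z = 0" for z c
      proof -
        have eq: "c u0 *\<^sub>R Y $ u0 + z = 0" using 0[OF in_sverts(1)[OF e0]] by simp
        have "c u0 = 0"
          using arg_cong[OF eq, of "\<lambda>x. x $ 1"] arg_cong[OF eq, of "\<lambda>x. x $ 2"] arg_cong[OF eq, of "\<lambda>x. x $ 3"]
            general_position_nth[OF Y(2), of u0] z m by (auto simp: Z_def J_def forall_3)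
        then show "z = 0" using eq by simp
      qed
    qed
    then show "card T + m \<le> 2 * card (sverts T)" by (simp add: dZ)
    show "card T + 3 \<le> 2 * card (sverts T)" if bal: "\<exists>\<phi>. potential \<phi> T"
    proof -
      obtain \<phi> where \<phi>: "potential \<phi> T" using bal by blast
      \<comment> \<open>A balanced loop has gain 0 and therefore the row of a vector crossed with
        itself; two distinct vertices are needed for \<open>inj\<close> below.\<close>
      have "u0 \<noteq> w0"
      proof
        assume "u0 = w0"
        then have "\<alpha>0 = 0" using \<phi> e0 unfolding potential_def by (metis bit_add_self)
        then have "orbit_row eps Y (u0, w0, \<alpha>0) = 0"
          using \<open>u0 = w0\<close> by (intro vec_eq_iff[THEN iffD2]) (simp add: orbit_row_nth)
        then have "(\<Sum>e\<in>T. (if e = (u0, w0, \<alpha>0) then 1 else 0) *\<^sub>R orbit_row eps Y e) = 0"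
          by (intro sum.neutral) auto
        then show False using indep_familyD[OF IT _ e0] by fastforce
      qed
      have "card T + dim (UNIV :: (real^3) set) \<le> 2 * card (sverts T)"
      proof (rule orbit_rows_count[OF IT eps nz, of UNIV \<phi>])
        show "twist eps (\<phi> u) z = twist eps (\<alpha> + \<phi> w) z" if "(u, w, \<alpha>) \<in> T" for u w \<alpha> z
        proof -
          have "\<phi> u = \<alpha> + \<phi> w" using \<phi> that unfolding potential_def by (cases "\<phi> u"; cases "\<phi> w") force+
          then show ?thesis by simp
        qed
        show "z = 0" if 0: "\<And>u. u \<in> sverts T \<Longrightarrow> c u *\<^sub>R Y $ u + twist eps (\<phi> u) z = 0" for z c
        proof -
          \<comment> \<open>A trivial motion that is radial at every vertex would be parallel to two
            covering vertices in general position.\<close>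
          have par: "\<exists>a. z = a *\<^sub>R place Y (u, \<phi> u)" if "u \<in> sverts T" for u
          proof -
            have "twist eps (\<phi> u) z = - c u *\<^sub>R Y $ u" using 0[OF that] by (simp add: add_eq_0_iff)
            then have "twist eps (\<phi> u) (twist eps (\<phi> u) z) = - c u *\<^sub>R twist eps (\<phi> u) (Y $ u)"
              by (simp add: linear_neg[OF linear_twist] linear_cmul[OF linear_twist])
            then have "z = - c u *\<^sub>R twist eps (\<phi> u) (Y $ u)" by (simp add: twist_twist[OF eps])
            also have "\<dots> = (- c u * gain_sign (- eps) (\<phi> u)) *\<^sub>R place Y (u, \<phi> u)"
              by (cases "\<phi> u") (auto simp: twist_def gain_sign_def place_def)
            finally show ?thesis by blast
          qed
          obtain a b where ab: "z = a *\<^sub>R place Y (u0, \<phi> u0)" "z = b *\<^sub>R place Y (w0, \<phi> w0)"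
            using par in_sverts[OF e0] by blast
          have "a *\<^sub>R cross3 (place Y (u0, \<phi> u0)) (place Y (w0, \<phi> w0)) =
              cross3 z (place Y (w0, \<phi> w0))" by (simp add: ab(1) cross_mult_left)
          also have "\<dots> = 0" by (simp add: ab(2) cross_mult_left)
          finally have "a = 0" using general_position_pair(1)[OF Y(2)] \<open>u0 \<noteq> w0\<close> by auto
          then show "z = 0" using ab(1) by simp
        qed
      qed auto
      then show ?thesis by (simp add: dim_UNIV)
    qed
  qed
qed

section \<open>Gain graphs and potentials\<close>

lemma gwalk_append:
  "gwalk G F u (s @ t) v \<longleftrightarrow> (\<exists>x. gwalk G F u s x \<and> gwalk G F x t v)"
  by (induction s arbitrary: u) auto

definition rev_walk :: "('b \<times> bool) list \<Rightarrow> ('b \<times> bool) list" where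
  "rev_walk w = rev (map (\<lambda>(e, d). (e, \<not> d)) w)"

lemma gwalk_rev: "gwalk G F u w v \<Longrightarrow> gwalk G F v (rev_walk w) u"
  by (induction w arbitrary: u) (auto simp: rev_walk_def gwalk_append split: if_splits)

lemma bit_minus_eq [simp]: "- a = a" for a :: bit
  by (metis add_eq_0_iff bit_add_self)

lemma rev_walk_gain:
  "sum_list (map (step_gain G) (rev_walk w)) = sum_list (map (step_gain G) w)"
  for G :: "('a, 'b, bit) gain_graph"
  by (induction w) (auto simp: rev_walk_def add.commute)

text \<open>Every component gets a root and every vertex a walk from the root; the gain of that walk
  is the potential. For an edge, the walk to its tail, the edge, and the reversed walk to its head
  form a closed walk. Roots are well defined because connected vertices have equal
  \<open>reach\<close> predicates.\<close>

lemma balanced_iff_potential: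
  fixes G :: "('a, 'b, bit) gain_graph"
  shows "balanced G F \<longleftrightarrow> (\<exists>\<psi>. \<forall>e\<in>F. \<psi> (gtail G e) + \<psi> (ghead G e) = ggain G e)"
proof
  assume bal: "balanced G F"
  let ?g = "\<lambda>w. sum_list (map (step_gain G) w)"
  define reach where "reach u v \<longleftrightarrow> (\<exists>w. gwalk G F u w v)" for u v
  have refl: "reach u u" for u unfolding reach_def by (rule exI[of _ "[]"]) simp
  have sym: "reach u v \<Longrightarrow> reach v u" for u v unfolding reach_def using gwalk_rev by metis
  have trans: "reach u v \<Longrightarrow> reach v x \<Longrightarrow> reach u x" for u v x
    unfolding reach_def using gwalk_append by metis
  define root where "root v = (SOME u. reach v u)" for v
  have root: "reach (root v) v" for v unfolding root_def by (rule sym) (rule someI[of _ v], rule refl)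
  have same: "root u = root v" if "reach u v" for u v
  proof -
    have "reach u = reach v" using that sym trans by (intro ext) blast
    then show ?thesis by (simp add: root_def)
  qed
  define walk where "walk v = (SOME w. gwalk G F (root v) w v)" for v
  have walk: "gwalk G F (root v) (walk v) v" for v
    unfolding walk_def using root[of v] unfolding reach_def by (rule someI_ex)
  show "\<exists>\<psi>. \<forall>e\<in>F. \<psi> (gtail G e) + \<psi> (ghead G e) = ggain G e"
  proof (intro exI ballI)
    fix e assume e: "e \<in> F"
    let ?u = "gtail G e" and ?v = "ghead G e"
    have step: "gwalk G F ?u [(e, True)] ?v" using e by simp
    then have "reach ?u ?v" unfolding reach_def by blast
    then have r: "root ?v = root ?u" using same by metis
    have "gwalk G F (root ?u) (walk ?u @ [(e, True)] @ rev_walk (walk ?v)) (root ?u)"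
      using walk[of ?u] step gwalk_rev[OF walk[of ?v]] unfolding r gwalk_append by blast
    then have "?g (walk ?u @ [(e, True)] @ rev_walk (walk ?v)) = 0"
      using bal unfolding balanced_def by blast
    then have "?g (walk ?u) + (ggain G e + ?g (walk ?v)) = 0" by (simp add: rev_walk_gain)
    then show "?g (walk ?u) + ?g (walk ?v) = ggain G e"
      by (cases "?g (walk ?u)"; cases "?g (walk ?v)"; cases "ggain G e") simp_all
  qed
next
  assume "\<exists>\<psi>. \<forall>e\<in>F. \<psi> (gtail G e) + \<psi> (ghead G e) = ggain G e"
  then obtain \<psi> where \<psi>: "\<And>e. e \<in> F \<Longrightarrow> ggain G e = \<psi> (gtail G e) + \<psi> (ghead G e)" by metis
  have "gwalk G F u w v \<Longrightarrow> sum_list (map (step_gain G) w) = \<psi> u + \<psi> v" for u w v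
  proof (induction w arbitrary: u)
    case (Cons s w)
    obtain e d where s: "s = (e, d)" by (cases s)
    have 1: "sum_list (map (step_gain G) w) = \<psi> (step_to G s) + \<psi> v" and "e \<in> F" and u: "step_from G s = u"
      using Cons s by auto
    have "step_gain G s = \<psi> u + \<psi> (step_to G s)"
      using \<psi>[OF \<open>e \<in> F\<close>] u unfolding s by (cases d) (auto simp: add.commute)
    then show ?case using 1
      by (cases "\<psi> u"; cases "\<psi> v"; cases "\<psi> (step_to G s)") simp_all
  qed simp
  then show "balanced G F" unfolding balanced_def by simp
qed

definition edge_triple :: "('a \<Rightarrow> 'v) \<Rightarrow> ('a, 'b, 'g) gain_graph \<Rightarrow> 'b \<Rightarrow> 'v \<times> 'v \<times> 'g" where
  "edge_triple rep G e = (rep (gtail G e), rep (ghead G e), ggain G e)"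

lemma sverts_edge_triple: "sverts (edge_triple rep G ` T) = rep ` incident_verts G T"
  by (simp add: sverts_def edge_triple_def incident_verts_def image_image image_Un)

lemma potential_edge_triple:
  fixes G :: "('a, 'b, bit) gain_graph"
  assumes "inj_on rep (incident_verts G T)"
  shows "(\<exists>\<phi>. potential \<phi> (edge_triple rep G ` T)) \<longleftrightarrow> balanced G T"
proof -
  have P: "potential \<phi> (edge_triple rep G ` T) \<longleftrightarrow>
      (\<forall>e\<in>T. \<phi> (rep (gtail G e)) + \<phi> (rep (ghead G e)) = ggain G e)" for \<phi>
    by (auto simp: potential_def edge_triple_def image_iff)
  show ?thesis
  proof
    assume "\<exists>\<phi>. potential \<phi> (edge_triple rep G ` T)"
    then obtain \<phi> where "potential \<phi> (edge_triple rep G ` T)" by blast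
    then show "balanced G T" unfolding balanced_iff_potential P by (intro exI[of _ "\<phi> \<circ> rep"]) simp
  next
    assume "balanced G T"
    then obtain \<psi> where \<psi>: "\<forall>e\<in>T. \<psi> (gtail G e) + \<psi> (ghead G e) = ggain G e"
      unfolding balanced_iff_potential by blast
    have "inv_into (incident_verts G T) rep (rep (gtail G e)) = gtail G e"
      "inv_into (incident_verts G T) rep (rep (ghead G e)) = ghead G e" if "e \<in> T" for e
      using that assms by (auto intro!: inv_into_f_f simp: incident_verts_def)
    with \<psi> show "\<exists>\<phi>. potential \<phi> (edge_triple rep G ` T)"
      unfolding P by (intro exI[of _ "\<psi> \<circ> inv_into (incident_verts G T) rep"]) simp
  qed
qed

lemma gain_sparse_iff_signed_sparse:
  fixes G :: "('a, 'b, bit) gain_graph"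
  assumes rep: "inj_on rep (incident_verts G (gedges G))" and tri: "inj_on (edge_triple rep G) (gedges G)"
  shows "gain_sparse 2 3 (int m) G \<longleftrightarrow> signed_sparse m (edge_triple rep G ` gedges G)"
proof -
  have "(balanced G T \<longrightarrow> int (card T) \<le> 2 * int (card (incident_verts G T)) - 3) \<and>
      int (card T) \<le> 2 * int (card (incident_verts G T)) - int m \<longleftrightarrow>
     ((\<exists>\<phi>. potential \<phi> (edge_triple rep G ` T)) \<longrightarrow>
        card (edge_triple rep G ` T) + 3 \<le> 2 * card (sverts (edge_triple rep G ` T))) \<and>
      card (edge_triple rep G ` T) + m \<le> 2 * card (sverts (edge_triple rep G ` T))" if "T \<subseteq> gedges G" for T
  proof -
    have inj: "inj_on rep (incident_verts G T)"
      using that by (intro inj_on_subset[OF rep]) (auto simp: incident_verts_def)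
    have "card (edge_triple rep G ` T) = card T" by (rule card_image[OF inj_on_subset[OF tri that]])
    moreover have "card (sverts (edge_triple rep G ` T)) = card (incident_verts G T)"
      unfolding sverts_edge_triple by (rule card_image[OF inj])
    ultimately show ?thesis unfolding potential_edge_triple[OF inj] by auto
  qed
  then show ?thesis
    unfolding gain_sparse_def signed_sparse_def by (auto simp: all_subset_image)
qed

lemma spanning_tight_iff:
  fixes G :: "('a, 'b, bit) gain_graph"
  assumes rep: "inj_on rep (gverts G)" and tri: "inj_on (edge_triple rep G) (gedges G)"
    and ends: "\<And>e. e \<in> gedges G \<Longrightarrow> gtail G e \<in> gverts G \<and> ghead G e \<in> gverts G"
  shows "(\<exists>H. spanning_gain_subgraph H G \<and> gain_tight 2 3 (int m) H) \<longleftrightarrow>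
    (\<exists>F \<subseteq> edge_triple rep G ` gedges G. signed_sparse m F \<and> card F + m = 2 * card (gverts G))"
proof -
  have H: "gain_tight 2 3 (int m) H \<longleftrightarrow> signed_sparse m (edge_triple rep G ` gedges H) \<and>
      card (edge_triple rep G ` gedges H) + m = 2 * card (gverts G)"
    if "spanning_gain_subgraph H G" for H
  proof -
    have sub: "gedges H \<subseteq> gedges G" and V: "gverts H = gverts G"
      and eq: "\<And>e. e \<in> gedges H \<Longrightarrow> edge_triple rep H e = edge_triple rep G e"
      and ie: "\<And>e. e \<in> gedges H \<Longrightarrow> gtail H e \<in> gverts G \<and> ghead H e \<in> gverts G"
      using that ends by (auto simp: spanning_gain_subgraph_def edge_triple_def)
    have im: "edge_triple rep H ` gedges H = edge_triple rep G ` gedges H" using eq by (rule image_cong[OF refl])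
    have injG: "inj_on (edge_triple rep G) (gedges H)" by (rule inj_on_subset[OF tri sub])
    have injH: "inj_on (edge_triple rep H) (gedges H)"
      using injG eq by (simp add: inj_on_def)
    have "inj_on rep (incident_verts H (gedges H))"
      using ie by (intro inj_on_subset[OF rep]) (auto simp: incident_verts_def)
    from gain_sparse_iff_signed_sparse[OF this injH] show ?thesis
      unfolding gain_tight_def im V card_image[OF injG] by auto
  qed
  show ?thesis
  proof
    assume "\<exists>H. spanning_gain_subgraph H G \<and> gain_tight 2 3 (int m) H"
    then obtain H where 1: "spanning_gain_subgraph H G" "gain_tight 2 3 (int m) H" by blast
    then have "edge_triple rep G ` gedges H \<subseteq> edge_triple rep G ` gedges G"
      by (auto simp: spanning_gain_subgraph_def)
    then show "\<exists>F \<subseteq> edge_triple rep G ` gedges G. signed_sparse m F \<and> card F + m = 2 * card (gverts G)"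
      using H[OF 1(1)] 1(2) by blast
  next
    assume "\<exists>F \<subseteq> edge_triple rep G ` gedges G. signed_sparse m F \<and> card F + m = 2 * card (gverts G)"
    then obtain T where T: "T \<subseteq> gedges G" "signed_sparse m (edge_triple rep G ` T)"
      "card (edge_triple rep G ` T) + m = 2 * card (gverts G)" by (auto simp: subset_image_iff)
    have "spanning_gain_subgraph (G\<lparr>gedges := T\<rparr>) G"
      using T(1) by (simp add: spanning_gain_subgraph_def)
    then show "\<exists>H. spanning_gain_subgraph H G \<and> gain_tight 2 3 (int m) H"
      using H[of "G\<lparr>gedges := T\<rparr>"] T by auto
  qed
qed

section \<open>Point-line frameworks in homogeneous coordinates\<close>

text \<open>\<open>U\<close> is a set of orbit representatives: assumption \<open>g_U\<close> says
  both that it meets every orbit once and that \<open>g\<close> has no fixed point.\<close>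

locale orbit_graph =
  fixes VP VH :: "'v::finite set" and E :: "'v set set" and g :: "'v \<Rightarrow> 'v"
    and U :: "'v set" and E0 :: "'v sedge set" and act :: "bit \<Rightarrow> 'v \<Rightarrow> 'v"
  defines "act \<equiv> \<lambda>\<delta> i. if \<delta> = 0 then i else g i"
  assumes VP_VH: "i \<in> VH \<longleftrightarrow> i \<notin> VP"
    and g_g [simp]: "g (g i) = i" and g_VP [simp]: "g i \<in> VP \<longleftrightarrow> i \<in> VP"
    and g_U [simp]: "g u \<in> U \<longleftrightarrow> u \<notin> U"
    and E0_U: "(u, w, \<alpha>) \<in> E0 \<Longrightarrow> u \<in> U \<and> w \<in> U"
    and E_E0: "{i, j} \<in> E \<longleftrightarrow> (\<exists>u w \<alpha> \<delta>. (u, w, \<alpha>) \<in> E0 \<and> {i, j} = {act \<delta> u, act (\<delta> + \<alpha>) w})"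
begin

lemma all_edges_iff:
  assumes "\<And>i j. Q i j \<longleftrightarrow> Q j i"
  shows "(\<forall>i j. {i, j} \<in> E \<longrightarrow> Q i j) \<longleftrightarrow>
    (\<forall>u w \<alpha>. (u, w, \<alpha>) \<in> E0 \<longrightarrow> Q u (act \<alpha> w) \<and> Q (g u) (act (\<alpha> + 1) w))"
proof (intro iffI allI impI)
  fix u w \<alpha> assume Q: "\<forall>i j. {i, j} \<in> E \<longrightarrow> Q i j" and e: "(u, w, \<alpha>) \<in> E0"
  have "{act \<delta> u, act (\<delta> + \<alpha>) w} \<in> E" for \<delta> using e unfolding E_E0 by blast
  from this[of 0] this[of 1] Q show "Q u (act \<alpha> w) \<and> Q (g u) (act (\<alpha> + 1) w)"
    by (simp add: act_def add.commute)
next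
  fix i j assume R: "\<forall>u w \<alpha>. (u, w, \<alpha>) \<in> E0 \<longrightarrow> Q u (act \<alpha> w) \<and> Q (g u) (act (\<alpha> + 1) w)"
    and "{i, j} \<in> E"
  then obtain u w \<alpha> \<delta> where e: "(u, w, \<alpha>) \<in> E0" and ij: "{i, j} = {act \<delta> u, act (\<delta> + \<alpha>) w}"
    unfolding E_E0 by blast
  have "Q (act \<delta> u) (act (\<delta> + \<alpha>) w)"
  proof -
    have "Q u (act \<alpha> w)" "Q (g u) (act (\<alpha> + 1) w)" using R e by blast+
    then show ?thesis by (cases \<delta>) (simp_all add: act_def add.commute[of 1 \<alpha>])
  qed
  with ij assms show "Q i j" unfolding doubleton_eq_iff by blast
qed

end

section \<open>Coordinates across and along the mirror\<close>

locale mirror =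
  fixes n :: "real^2"
  assumes norm_n: "norm n = 1"
begin

definition axial :: "real^2" where "axial = vector [- n $ 2, n $ 1]"

definition c1 :: "real^2 \<Rightarrow> real" where "c1 x = n \<bullet> x"
definition c2 :: "real^2 \<Rightarrow> real" where "c2 x = axial \<bullet> x"
definition comb :: "real \<Rightarrow> real \<Rightarrow> real^2" where "comb s t = s *\<^sub>R n + t *\<^sub>R axial"

lemma n_sq: "n $ 1 * n $ 1 + n $ 2 * n $ 2 = 1"
  using norm_n by (simp add: norm_eq_1 inner_vec_def sum_2)

lemma inner_c1_c2: "x \<bullet> y = c1 x * c1 y + c2 x * c2 y"
proof -
  have "c1 x * c1 y + c2 x * c2 y = (n $ 1 * n $ 1 + n $ 2 * n $ 2) * (x \<bullet> y)"
    by (simp add: c1_def c2_def axial_def inner_vec_def sum_2 algebra_simps)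
  then show ?thesis by (simp add: n_sq)
qed

lemma c_comb [simp]: "c1 (comb s t) = s" "c2 (comb s t) = t"
proof -
  have 1: "n \<bullet> n = 1" "axial \<bullet> axial = 1" "n \<bullet> axial = 0" "axial \<bullet> n = 0"
    using n_sq by (auto simp: axial_def inner_vec_def sum_2)
  show "c1 (comb s t) = s" "c2 (comb s t) = t"
    by (simp_all add: c1_def c2_def comb_def inner_add_right 1)
qed

lemma c_linear [simp]:
  "c1 (x + y) = c1 x + c1 y" "c2 (x + y) = c2 x + c2 y"
  "c1 (x - y) = c1 x - c1 y" "c2 (x - y) = c2 x - c2 y"
  "c1 (k *\<^sub>R x) = k * c1 x" "c2 (k *\<^sub>R x) = k * c2 x"
  "c1 (- x) = - c1 x" "c2 (- x) = - c2 x" "c1 0 = 0" "c2 0 = 0"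
  by (simp_all add: c1_def c2_def inner_add_right inner_diff_right)

lemma vec2_eq_iff: "x = y \<longleftrightarrow> c1 x = c1 y \<and> c2 x = c2 y"
proof
  assume "c1 x = c1 y \<and> c2 x = c2 y"
  then have "(x - y) \<bullet> (x - y) = 0" unfolding inner_c1_c2 by simp
  then show "x = y" by simp
qed simp

lemma c_n [simp]: "c1 n = 1" "c2 n = 0" "c1 axial = 0" "c2 axial = 1"
  using c_comb[of 1 0] c_comb[of 0 1] by (simp_all add: comb_def)

lemma c_reflection [simp]: "c1 (reflection n x) = - c1 x" "c2 (reflection n x) = c2 x"
  by (simp_all add: reflection_def) (simp add: c1_def)

end

locale reflection_framework = orbit_graph VP VH E g U E0 act + mirror n
  for VP VH :: "'v::finite set" and E g U E0 act n +
  fixes p a :: "'v \<Rightarrow> real^2"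
  assumes p_g: "i \<in> VP \<Longrightarrow> p (g i) = reflection n (p i)"
    and a_g: "j \<in> VH \<Longrightarrow> \<exists>\<sigma>\<in>{1, -1}. reflection n (a j) = \<sigma> *\<^sub>R a (g j)"
    and norm_a: "j \<in> VH \<Longrightarrow> norm (a j) = 1"
begin

definition X :: "'v \<Rightarrow> real^3" where
  "X i = (if i \<in> VP then vector [c1 (p i), c2 (p i), 1] else vector [c1 (a i), c2 (a i), 0])"

lemma X_nth:
  "i \<in> VP \<Longrightarrow> X i $ 1 = c1 (p i)" "i \<in> VP \<Longrightarrow> X i $ 2 = c2 (p i)" "i \<in> VP \<Longrightarrow> X i $ 3 = 1"
  "i \<notin> VP \<Longrightarrow> X i $ 1 = c1 (a i)" "i \<notin> VP \<Longrightarrow> X i $ 2 = c2 (a i)" "i \<notin> VP \<Longrightarrow> X i $ 3 = 0"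
  by (simp_all add: X_def)

lemma a_sq: "j \<notin> VP \<Longrightarrow> c1 (a j) * c1 (a j) + c2 (a j) * c2 (a j) = 1"
  using norm_a[of j] inner_c1_c2[of "a j" "a j"] by (simp add: VP_VH norm_eq_1)

lemma X_g: "\<exists>\<sigma>\<in>{1, -1}. X (g i) = \<sigma> *\<^sub>R flip 1 (X i)"
proof (cases "i \<in> VP")
  case True
  then have "X (g i) = 1 *\<^sub>R flip 1 (X i)"
    by (simp add: vec_eq_iff forall_3 X_nth p_g)
  then show ?thesis by blast
next
  case False
  then obtain \<sigma> where \<sigma>: "\<sigma> \<in> {1, -1}" "reflection n (a i) = \<sigma> *\<^sub>R a (g i)" using a_g VP_VH by blast
  then have "c1 (a (g i)) = - \<sigma> * c1 (a i)" "c2 (a (g i)) = \<sigma> * c2 (a i)"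
    using c_reflection[of "a i"] by auto
  then have "X (g i) = \<sigma> *\<^sub>R flip 1 (X i)"
    using False by (simp add: vec_eq_iff forall_3 X_nth)
  then show ?thesis using \<sigma>(1) by blast
qed

lemma X_act: "\<exists>\<sigma>\<in>{1, -1}. X (act \<alpha> i) = \<sigma> *\<^sub>R flip \<alpha> (X i)"
  using X_g[of i] by (cases \<alpha>) (auto simp: act_def)

definition gauge :: "'v \<Rightarrow> real^3" where
  "gauge i = (if i \<in> VP then axis 3 1 else X i)"

lemma gauge_X: "gauge i \<bullet> X i = 1"
  using a_sq[of i] by (auto simp: gauge_def inner_axis_left X_nth inner_vec_def[of "X i"] sum_3)

text \<open>
  A velocity in the coordinates dual to \<open>X\<close>: for a point it is \<open>p'\<close> turned by a right angle, so that
  pairing with \<open>X i \<times> X j\<close> gives the equation of the edge \<open>{i, j}\<close>.  Multiples of \<open>X i\<close> are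
  invisible to this pairing; the gauge vectors single out one representative.
\<close>

definition hat :: "'v velocity \<Rightarrow> (real^3)^'v" where
  "hat w = (\<chi> i. if i \<in> VP then vector [c2 (fst w $ i), - c1 (fst w $ i), 0]
     else vector [- (snd (snd w) $ i * c2 (a i)), snd (snd w) $ i * c1 (a i),
       c2 (a i) * c1 (fst (snd w) $ i) - c1 (a i) * c2 (fst (snd w) $ i)])"

lemma hat_nth:
  "i \<in> VP \<Longrightarrow> hat (p', a', r') $ i $ 1 = c2 (p' $ i)"
  "i \<in> VP \<Longrightarrow> hat (p', a', r') $ i $ 2 = - c1 (p' $ i)"
  "i \<in> VP \<Longrightarrow> hat (p', a', r') $ i $ 3 = 0"
  "i \<notin> VP \<Longrightarrow> hat (p', a', r') $ i $ 1 = - (r' $ i * c2 (a i))"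
  "i \<notin> VP \<Longrightarrow> hat (p', a', r') $ i $ 2 = r' $ i * c1 (a i)"
  "i \<notin> VP \<Longrightarrow> hat (p', a', r') $ i $ 3 = c2 (a i) * c1 (a' $ i) - c1 (a i) * c2 (a' $ i)"
  by (simp_all add: hat_def)

lemma linear_hat: "linear hat"
proof (rule linearI)
  fix v w :: "'v velocity" and k :: real
  show "hat (v + w) = hat v + hat w"
    by (rule vec_eq_iff[THEN iffD2]) (auto simp: hat_def vec_eq_iff[where 'b=3] forall_3 algebra_simps)
  show "hat (k *\<^sub>R w) = k *\<^sub>R hat w"
    by (rule vec_eq_iff[THEN iffD2]) (auto simp: hat_def vec_eq_iff[where 'b=3] forall_3 algebra_simps)
qed

definition edge_form :: "(real^3)^'v \<Rightarrow> 'v \<Rightarrow> 'v \<Rightarrow> real" where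
  "edge_form x i j = cross3 (X i) (X j) \<bullet> (x $ i - x $ j)"

lemma edge_form_commute: "edge_form x i j = edge_form x j i"
  unfolding edge_form_def by (subst cross_skew) (simp add: inner_diff_right)

lemma edge_form_PP:
  assumes "i \<in> VP" "j \<in> VP"
  shows "edge_form (hat (p', a', r')) i j = (p i - p j) \<bullet> (p' $ i - p' $ j)"
  using assms
  by (simp add: edge_form_def inner_c1_c2 inner_vec_def[of "cross3 _ _"] sum_3 cross_components X_nth hat_nth algebra_simps)

text \<open>A unit normal can only turn, so its velocity is one number, the angular velocity
  \<open>l\<close>, times the normal turned by a right angle.\<close>

lemma normal_velocity:
  assumes "j \<notin> VP" "a j \<bullet> b = 0"
  defines "l \<equiv> c2 (a j) * c1 b - c1 (a j) * c2 b"
  shows "c1 b = l * c2 (a j)" "c2 b = - l * c1 (a j)"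
proof -
  have 0: "c1 (a j) * c1 b + c2 (a j) * c2 b = 0" using assms(2) inner_c1_c2 by simp
  have "c1 b = (c1 (a j) * c1 (a j) + c2 (a j) * c2 (a j)) * c1 b" using a_sq[OF assms(1)] by simp
  also have "\<dots> = c1 (a j) * (c1 (a j) * c1 b + c2 (a j) * c2 b) + l * c2 (a j)"
    unfolding l_def by (simp add: algebra_simps)
  finally show "c1 b = l * c2 (a j)" using 0 by simp
  have "c2 b = (c1 (a j) * c1 (a j) + c2 (a j) * c2 (a j)) * c2 b" using a_sq[OF assms(1)] by simp
  also have "\<dots> = c2 (a j) * (c1 (a j) * c1 b + c2 (a j) * c2 b) - l * c1 (a j)"
    unfolding l_def by (simp add: algebra_simps)
  finally show "c2 b = - l * c1 (a j)" using 0 by simp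
qed

lemma edge_form_PH:
  assumes "i \<in> VP" "j \<notin> VP" "a j \<bullet> a' $ j = 0"
  shows "edge_form (hat (p', a', r')) i j = - (p i \<bullet> a' $ j + p' $ i \<bullet> a j + r' $ j)"
proof -
  let ?l = "c2 (a j) * c1 (a' $ j) - c1 (a j) * c2 (a' $ j)"
  note nv = normal_velocity[OF assms(2,3)]
  have "edge_form (hat (p', a', r')) i j = - (p' $ i \<bullet> a j) - r' $ j * (c1 (a j) * c1 (a j) + c2 (a j) * c2 (a j))
      - (c1 (p i) * (?l * c2 (a j)) + c2 (p i) * (- ?l * c1 (a j)))"
    using assms(1,2)
    by (simp add: edge_form_def inner_c1_c2 inner_vec_def[of "cross3 _ _"] sum_3 cross_components X_nth hat_nth algebra_simps)
  also have "\<dots> = - (p' $ i \<bullet> a j) - r' $ j - (c1 (p i) * c1 (a' $ j) + c2 (p i) * c2 (a' $ j))"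
    using nv a_sq[OF assms(2)] by simp
  finally show ?thesis by (simp add: inner_c1_c2[of "p i"])
qed

lemma edge_form_HH:
  assumes "i \<notin> VP" "j \<notin> VP" "a j \<bullet> a' $ j = 0" "a i \<bullet> a' $ i = 0"
  shows "edge_form (hat (p', a', r')) i j = - (a i \<bullet> a' $ j + a' $ i \<bullet> a j)"
proof -
  define k l where "k = c2 (a i) * c1 (a' $ i) - c1 (a i) * c2 (a' $ i)"
    and "l = c2 (a j) * c1 (a' $ j) - c1 (a j) * c2 (a' $ j)"
  note nj = normal_velocity[OF assms(2,3), folded l_def] and ni = normal_velocity[OF assms(1,4), folded k_def]
  have "edge_form (hat (p', a', r')) i j = (c1 (a i) * c2 (a j) - c2 (a i) * c1 (a j)) * (k - l)"
    using assms(1,2) unfolding k_def l_def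
    by (simp add: edge_form_def inner_vec_def[of "cross3 _ _"] sum_3 cross_components X_nth hat_nth)
  moreover have "a i \<bullet> a' $ j = c1 (a i) * (l * c2 (a j)) + c2 (a i) * (- l * c1 (a j))"
    unfolding inner_c1_c2[of "a i" "a' $ j"] nj ..
  moreover have "a' $ i \<bullet> a j = k * c2 (a i) * c1 (a j) + (- k * c1 (a i)) * c2 (a j)"
    unfolding inner_c1_c2[of "a' $ i" "a j"] ni ..
  ultimately show ?thesis by (simp add: algebra_simps)
qed

text \<open>The edge equations take the uniform form \<open>edge_form\<close> only if velocities of
  normals are perpendicular to the normals, hence the case distinction; without this both sides are
  false.\<close>

lemma inf_motions_iff:
  "(p', a', r') \<in> inf_motions VP VH E p a \<longleftrightarrow>
     (\<forall>i. i \<notin> VP \<longrightarrow> p' $ i = 0) \<and> (\<forall>j. j \<notin> VH \<longrightarrow> a' $ j = 0 \<and> r' $ j = 0) \<and>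
     (\<forall>j\<in>VH. a j \<bullet> a' $ j = 0) \<and> (\<forall>i j. {i, j} \<in> E \<longrightarrow> edge_form (hat (p', a', r')) i j = 0)"
proof (cases "\<forall>j\<in>VH. a j \<bullet> a' $ j = 0")
  case True
  have PH: "edge_form (hat (p', a', r')) i j = - (p i \<bullet> a' $ j + p' $ i \<bullet> a j + r' $ j)"
    if "i \<in> VP" "j \<in> VH" for i j using that True by (intro edge_form_PH) (auto simp: VP_VH)
  have HH: "edge_form (hat (p', a', r')) i j = - (a i \<bullet> a' $ j + a' $ i \<bullet> a j)"
    if "i \<in> VH" "j \<in> VH" for i j using that True by (intro edge_form_HH) (auto simp: VP_VH)
  have *: "(\<forall>i j. {i, j} \<in> E \<longrightarrow> edge_form (hat (p', a', r')) i j = 0) \<longleftrightarrow>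
     (\<forall>i\<in>VP. \<forall>j\<in>VP. {i, j} \<in> E \<longrightarrow> (p i - p j) \<bullet> (p' $ i - p' $ j) = 0) \<and>
     (\<forall>i\<in>VP. \<forall>j\<in>VH. {i, j} \<in> E \<longrightarrow> p i \<bullet> a' $ j + p' $ i \<bullet> a j + r' $ j = 0) \<and>
     (\<forall>i\<in>VH. \<forall>j\<in>VH. {i, j} \<in> E \<longrightarrow> a i \<bullet> a' $ j + a' $ i \<bullet> a j = 0)" (is "?L \<longleftrightarrow> ?R")
  proof
    assume L: ?L
    show ?R
    proof (intro conjI ballI impI)
      fix i j assume "i \<in> VP" "j \<in> VP" "{i, j} \<in> E"
      then show "(p i - p j) \<bullet> (p' $ i - p' $ j) = 0" using L edge_form_PP by metis
    next
      fix i j assume "i \<in> VP" "j \<in> VH" "{i, j} \<in> E"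
      then show "p i \<bullet> a' $ j + p' $ i \<bullet> a j + r' $ j = 0" using L PH by (metis neg_equal_0_iff_equal)
    next
      fix i j assume "i \<in> VH" "j \<in> VH" "{i, j} \<in> E"
      then show "a i \<bullet> a' $ j + a' $ i \<bullet> a j = 0" using L HH by (metis neg_equal_0_iff_equal)
    qed
  next
    assume R: ?R
    show ?L
    proof (intro allI impI)
      fix i j assume e: "{i, j} \<in> E"
      then have e': "{j, i} \<in> E" by (simp add: insert_commute)
      consider "i \<in> VP" "j \<in> VP" | "i \<in> VP" "j \<in> VH" | "i \<in> VH" "j \<in> VP" | "i \<in> VH" "j \<in> VH"
        using VP_VH by blast
      then show "edge_form (hat (p', a', r')) i j = 0"
      proof cases
        case 1
        then show ?thesis using R e edge_form_PP by simp
      next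
        case 2
        then have "p i \<bullet> a' $ j + p' $ i \<bullet> a j + r' $ j = 0" using R e by blast
        then show ?thesis unfolding PH[OF 2] by linarith
      next
        case 3
        then have "p j \<bullet> a' $ i + p' $ j \<bullet> a i + r' $ i = 0" using R e' by blast
        then show ?thesis unfolding edge_form_commute[of _ i j] PH[OF 3(2,1)] by linarith
      next
        case 4
        then have "a i \<bullet> a' $ j + a' $ i \<bullet> a j = 0" using R e by blast
        then show ?thesis unfolding HH[OF 4] by linarith
      qed
    qed
  qed
  show ?thesis unfolding inf_motions_def mem_Collect_eq prod.case * by blast
next
  case False
  then show ?thesis unfolding inf_motions_def mem_Collect_eq prod.case by blast
qed

section \<open>The motion space in dual coordinates\<close>

definition hat_motions :: "((real^3)^'v) set" where
  "hat_motions = {x. (\<forall>i. gauge i \<bullet> x $ i = 0) \<and> (\<forall>i j. {i, j} \<in> E \<longrightarrow> edge_form x i j = 0)}"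

definition unhat :: "(real^3)^'v \<Rightarrow> 'v velocity" where
  "unhat x = ((\<chi> i. if i \<in> VP then comb (- (x $ i $ 2)) (x $ i $ 1) else 0),
     (\<chi> j. if j \<in> VH then (x $ j $ 3) *\<^sub>R comb (c2 (a j)) (- c1 (a j)) else 0),
     (\<chi> j. if j \<in> VH then c1 (a j) * x $ j $ 2 - c2 (a j) * x $ j $ 1 else 0))"

lemma inner_gauge:
  "i \<in> VP \<Longrightarrow> gauge i \<bullet> x = x $ 3"
  "i \<notin> VP \<Longrightarrow> gauge i \<bullet> x = c1 (a i) * x $ 1 + c2 (a i) * x $ 2"
  by (simp_all add: gauge_def inner_axis_left inner_vec_def[of "X i"] sum_3 X_nth)

lemma hat_unhat:
  assumes "\<And>i. gauge i \<bullet> x $ i = 0"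
  shows "hat (unhat x) = x"
proof (rule vec_eq_iff[THEN iffD2], rule allI)
  fix i
  show "hat (unhat x) $ i = x $ i"
  proof (cases "i \<in> VP")
    case True
    then show ?thesis
      using assms[of i] unfolding unhat_def by (simp add: vec_eq_iff forall_3 hat_nth inner_gauge)
  next
    case False
    let ?a = "c1 (a i)" and ?b = "c2 (a i)" and ?x = "x $ i $ 1" and ?y = "x $ i $ 2"
    have 0: "?a * ?x + ?b * ?y = 0" using assms[of i] False by (simp add: inner_gauge)
    have "- ((?a * ?y - ?b * ?x) * ?b) = (?a * ?a + ?b * ?b) * ?x - ?a * (?a * ?x + ?b * ?y)"
      "(?a * ?y - ?b * ?x) * ?a = (?a * ?a + ?b * ?b) * ?y - ?b * (?a * ?x + ?b * ?y)"
      "?b * (x $ i $ 3 * ?b) - ?a * (x $ i $ 3 * - ?a) = (?a * ?a + ?b * ?b) * x $ i $ 3"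
      by (simp_all add: algebra_simps)
    with 0 a_sq[OF False] False show ?thesis
      unfolding unhat_def by (simp add: vec_eq_iff forall_3 hat_nth VP_VH)
  qed
qed

lemma gauge_hat: "gauge i \<bullet> hat w $ i = 0"
  by (cases w; cases "i \<in> VP") (simp_all add: inner_gauge hat_nth)

lemma hat_eq_0:
  assumes w: "w \<in> inf_motions VP VH E p a" and "hat w = 0"
  shows "w = 0"
proof -
  obtain p' a' r' where pa: "w = (p', a', r')" by (cases w)
  have h: "hat (p', a', r') $ i = 0" for i using assms(2) by (simp add: pa)
  have m: "\<And>i. i \<notin> VP \<Longrightarrow> p' $ i = 0" "\<And>j. j \<in> VP \<Longrightarrow> a' $ j = 0" "\<And>j. j \<in> VP \<Longrightarrow> r' $ j = 0"
    "\<And>j. j \<notin> VP \<Longrightarrow> a j \<bullet> a' $ j = 0"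
    using w unfolding pa inf_motions_iff by (auto simp: VP_VH)
  have "p' $ i = 0" for i
    using h[of i] m(1)[of i] hat_nth(1,2)[of i p' a' r'] by (cases "i \<in> VP") (auto simp: vec2_eq_iff)
  moreover have "a' $ i = 0" for i
  proof (cases "i \<in> VP")
    case False
    then have "c2 (a i) * c1 (a' $ i) - c1 (a i) * c2 (a' $ i) = 0"
      using h[of i] hat_nth(6)[OF False, of p' a' r'] by simp
    then have "c1 (a' $ i) = 0" "c2 (a' $ i) = 0"
      using normal_velocity[OF False m(4)[OF False]] by (metis mult_zero_left minus_zero)+
    then show ?thesis by (simp add: vec2_eq_iff)
  qed (simp add: m)
  moreover have "r' $ i = 0" for i
  proof (cases "i \<in> VP")
    case False
    have "r' $ i * c1 (a i) = 0" "r' $ i * c2 (a i) = 0"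
      using h[of i] hat_nth(4,5)[OF False, of p' a' r'] by simp_all
    then show ?thesis using a_sq[OF False] by auto
  qed (simp add: m)
  ultimately show ?thesis unfolding pa by (simp add: vec_eq_iff zero_prod_def)
qed

lemma unhat_motion:
  assumes "x \<in> hat_motions"
  shows "unhat x \<in> inf_motions VP VH E p a" "hat (unhat x) = x"
proof -
  show hx: "hat (unhat x) = x" using assms by (intro hat_unhat) (simp add: hat_motions_def)
  have "\<forall>i j. {i, j} \<in> E \<longrightarrow> edge_form (hat (unhat x)) i j = 0"
    unfolding hx using assms by (simp add: hat_motions_def)
  then show "unhat x \<in> inf_motions VP VH E p a"
    unfolding unhat_def inf_motions_iff
    by (auto simp: VP_VH inner_c1_c2)
qed

lemma hat_motion: "w \<in> inf_motions VP VH E p a \<Longrightarrow> hat w \<in> hat_motions"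
  using gauge_hat by (cases w) (auto simp: inf_motions_iff hat_motions_def)

lemma inf_motions_orthogonal:
  "inf_motions VP VH E p a =
     {w. (\<forall>i. i \<notin> VP \<longrightarrow> fst w $ i = 0) \<and> (\<forall>j. j \<notin> VH \<longrightarrow> fst (snd w) $ j = 0 \<and> snd (snd w) $ j = 0) \<and>
       (\<forall>\<rho>\<in>rigidity_rows VP VH E p a. \<rho> \<bullet> w = 0)}"
  unfolding inf_motions_eq_orthogonal_rows by (rule Collect_cong) (simp add: case_prod_beta)

lemma subspace_inf_motions: "subspace (inf_motions VP VH E p a)"
  unfolding inf_motions_orthogonal by (simp add: subspace_def inner_add_right)

lemma dim_inf_motions: "dim (inf_motions VP VH E p a) = dim hat_motions"
proof -
  have "hat_motions = hat ` inf_motions VP VH E p a"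
    using unhat_motion hat_motion by (force simp: image_iff)
  moreover have "inj_on hat (inf_motions VP VH E p a)"
    unfolding linear_inj_on_iff_eq_0[OF linear_hat subspace_inf_motions] using hat_eq_0 by blast
  ultimately show ?thesis
    using dim_image_eq[OF linear_hat] subspace_inf_motions by (metis span_eq_iff)
qed

end

section \<open>Block decomposition of the motion space\<close>

context reflection_framework
begin

definition Y :: "(real^3)^'v" where "Y = (\<chi> u. X u)"

lemma Y_nth [simp]: "Y $ u = X u" by (simp add: Y_def)

definition block :: "real \<Rightarrow> ((real^3)^'v) set" where
  "block eps = {x. (\<forall>u. u \<notin> U \<longrightarrow> x $ u = 0) \<and> (\<forall>u\<in>U. gauge u \<bullet> x $ u = 0) \<and>
     (\<forall>e\<in>E0. orbit_row eps Y e \<bullet> x = 0)}"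

definition rk :: "real \<Rightarrow> nat" where "rk eps = dim (orbit_row eps Y ` E0)"

lemma subspace_block: "subspace (block eps)"
  unfolding block_def by (simp add: subspace_def inner_add_right)

lemma orbit_row_Y:
  assumes "e \<in> E0"
  shows "u \<notin> U \<Longrightarrow> orbit_row eps Y e $ u = 0" "orbit_row eps Y e $ u \<bullet> X u = 0"
proof -
  obtain v w \<alpha> where e: "e = (v, w, \<alpha>)" by (cases e)
  show "u \<notin> U \<Longrightarrow> orbit_row eps Y e $ u = 0" using E0_U[of v w \<alpha>] assms by (auto simp: e orbit_row_nth)
  show "orbit_row eps Y e $ u \<bullet> X u = 0"
    by (auto simp: e orbit_row_nth inner_add_left inner_add_right dot_cross_self inner_commute)
qed

text \<open>Inside the vectors supported on \<open>U\<close>, of dimension 3|U|, the block is the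
  orthogonal complement of the rows and the gauge vectors. The sum of these is direct, since at each
  \<open>u\<close> the rows pair to 0 with \<open>X u\<close> while \<open>gauge u\<close> pairs to
  1.\<close>

lemma dim_block: "dim (block eps) + rk eps = 2 * card U"
proof -
  define W :: "((real^3)^'v) set" where "W = {x. \<forall>u. u \<notin> U \<longrightarrow> x $ u = 0}"
  define C :: "(real^'v) set" where "C = {c. \<forall>u. u \<notin> U \<longrightarrow> c $ u = 0}"
  define L :: "real^'v \<Rightarrow> (real^3)^'v" where "L c = (\<chi> u. c $ u *\<^sub>R gauge u)" for c
  let ?R = "span (orbit_row eps Y ` E0)"
  have subW: "subspace W" and subC: "subspace C" by (auto simp: W_def C_def subspace_def)
  have linL: "linear L" by (rule linearI) (simp_all add: L_def vec_eq_iff[where 'b='v] scaleR_add_left)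
  have gnz: "gauge u \<noteq> 0" for u using gauge_X[of u] by auto
  have "inj_on L C"
    unfolding linear_inj_on_iff_eq_0[OF linL subC] using gnz by (simp add: L_def vec_eq_iff[where 'b='v])
  then have "dim (L ` C) = dim C" using dim_image_eq[OF linL] subC by (metis span_eq_iff)
  then have dL: "dim (L ` C) = card U" using dim_vec_supported[of U, where 'a=real] by (simp add: C_def)
  have subL: "subspace (L ` C)" by (rule linear_subspace_image[OF linL subC])
  have RX: "x $ u \<bullet> X u = 0" if "x \<in> ?R" for x u
  proof -
    have "subspace {x :: (real^3)^'v. x $ u \<bullet> X u = 0}" by (simp add: subspace_def inner_add_left)
    moreover have "orbit_row eps Y ` E0 \<subseteq> {x. x $ u \<bullet> X u = 0}" using orbit_row_Y(2) by blast
    ultimately show ?thesis using that span_minimal by blast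
  qed
  have "x = 0" if x: "x \<in> ?R \<inter> L ` C" for x
  proof -
    obtain c where c: "x = L c" using x by blast
    have "c $ u = 0" for u using RX[of x u] x gauge_X[of u] by (simp add: c L_def)
    then show ?thesis by (simp add: c L_def vec_eq_iff[where 'b='v])
  qed
  then have "?R \<inter> L ` C = {0}" using subspace_0[OF subspace_span] subspace_0[OF subL] by blast
  then have "dim {x + y |x y. x \<in> ?R \<and> y \<in> L ` C} = rk eps + card U"
    using dim_sums_Int[OF subspace_span subL, of "orbit_row eps Y ` E0"] dL by (simp add: rk_def)
  moreover define S where "S = {x + y |x y. x \<in> ?R \<and> y \<in> L ` C}"
  ultimately have dS: "dim S = rk eps + card U" by simp
  have subS: "subspace S" unfolding S_def by (rule subspace_sums[OF subspace_span subL])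
  have RW: "?R \<subseteq> W" using orbit_row_Y(1) by (intro span_minimal subW) (auto simp: W_def)
  have LW: "L ` C \<subseteq> W" by (auto simp: W_def C_def L_def)
  have SW: "S \<subseteq> W" unfolding S_def using RW LW subspace_add[OF subW] by blast
  have "{y \<in> W. \<forall>x\<in>S. orthogonal x y} = block eps"
  proof (intro set_eqI iffI)
    fix y assume y: "y \<in> {y \<in> W. \<forall>x\<in>S. orthogonal x y}"
    have "x \<in> S" if "x \<in> ?R" for x
      unfolding S_def using that subspace_0[OF subL] by (intro CollectI exI[of _ x] exI[of _ 0]) simp
    moreover have "x \<in> S" if "x \<in> L ` C" for x
      unfolding S_def using that span_0 by (intro CollectI exI[of _ 0] exI[of _ x]) simp
    ultimately have o: "x \<bullet> y = 0" if "x \<in> ?R \<or> x \<in> L ` C" for x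
      using that y by (auto simp: orthogonal_def)
    have "gauge u \<bullet> y $ u = 0" if "u \<in> U" for u
    proof -
      have "L (axis u 1) = axis u (gauge u)" by (auto simp: L_def vec_eq_iff[where 'b='v] axis_def)
      moreover have "axis u 1 \<in> C" using that by (auto simp: C_def axis_def)
      ultimately show ?thesis using o[of "axis u (gauge u)"] by (metis image_eqI inner_axis_left)
    qed
    moreover have "orbit_row eps Y e \<bullet> y = 0" if "e \<in> E0" for e
      using o that by (simp add: span_base)
    ultimately show "y \<in> block eps" using y by (auto simp: block_def W_def)
  next
    fix y assume y: "y \<in> block eps"
    have "?R \<subseteq> {x. x \<bullet> y = 0}"
      using y by (intro span_minimal) (auto simp: block_def subspace_def inner_add_left)
    moreover have "L c \<bullet> y = 0" if "c \<in> C" for c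
      unfolding L_def using y that
      by (subst inner_vec_def, intro sum.neutral) (auto simp: block_def C_def)
    ultimately show "y \<in> {y \<in> W. \<forall>x\<in>S. orthogonal x y}"
      using y by (auto simp: block_def W_def S_def orthogonal_def inner_add_left)
  qed
  moreover have "dim W = card U * 3" unfolding W_def using dim_vec_supported[of U, where 'a="real^3"] by simp
  ultimately show ?thesis
    using dim_subspace_orthogonal_to_vectors[OF subS subW SW] dS by simp
qed

text \<open>Reflecting the second edge of an orbit back onto the first moves \<open>flip 1\<close>
  to the velocities, so both equations involve the same cross product. The signs of line normals
  only rescale an equation.\<close>

lemma hat_motions_iff:
  "x \<in> hat_motions \<longleftrightarrow> (\<forall>i. gauge i \<bullet> x $ i = 0) \<and> (\<forall>u w \<alpha>. (u, w, \<alpha>) \<in> E0 \<longrightarrow>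
     cross3 (X u) (flip \<alpha> (X w)) \<bullet> (x $ u - x $ act \<alpha> w) = 0 \<and>
     cross3 (X u) (flip \<alpha> (X w)) \<bullet> flip 1 (x $ g u - x $ act (\<alpha> + 1) w) = 0)"
proof -
  have 1: "edge_form x u (act \<alpha> w) = 0 \<longleftrightarrow> cross3 (X u) (flip \<alpha> (X w)) \<bullet> (x $ u - x $ act \<alpha> w) = 0" for u w \<alpha>
    using X_act[of \<alpha> w] by (auto simp: edge_form_def cross_mult_right)
  have 2: "edge_form x (g u) (act (\<alpha> + 1) w) = 0 \<longleftrightarrow>
      cross3 (X u) (flip \<alpha> (X w)) \<bullet> flip 1 (x $ g u - x $ act (\<alpha> + 1) w) = 0" for u w \<alpha>
  proof -
    obtain \<sigma> \<sigma>' where s: "\<sigma> \<in> {1, -1}" "\<sigma>' \<in> {1, -1}" "X (g u) = \<sigma> *\<^sub>R flip 1 (X u)"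
      "X (act (\<alpha> + 1) w) = \<sigma>' *\<^sub>R flip (\<alpha> + 1) (X w)"
      using X_g[of u] X_act[of "\<alpha> + 1" w] by blast
    have "cross3 (flip 1 (X u)) (flip (\<alpha> + 1) (X w)) = - flip 1 (cross3 (X u) (flip \<alpha> (X w)))"
      by (cases \<alpha>) (auto simp: vec_eq_iff forall_3 cross_components)
    then have "edge_form x (g u) (act (\<alpha> + 1) w) =
        - (\<sigma> * \<sigma>') * (cross3 (X u) (flip \<alpha> (X w)) \<bullet> flip 1 (x $ g u - x $ act (\<alpha> + 1) w))"
      unfolding edge_form_def s(3,4) by (simp add: cross_mult_left cross_mult_right inner_flip)
    then show ?thesis using s(1,2) by auto
  qed
  show ?thesis
    unfolding hat_motions_def mem_Collect_eq
      all_edges_iff[where Q="\<lambda>i j. edge_form x i j = 0", OF arg_cong[OF edge_form_commute]]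
    unfolding 2 unfolding 1 ..
qed

text \<open>Projection to the part multiplied by \<open>eps\<close> under the symmetry, recorded on
  representatives only; together the two projections lose nothing and are inverted by
  \<open>glue\<close>.\<close>

definition half :: "real \<Rightarrow> (real^3)^'v \<Rightarrow> (real^3)^'v" where
  "half eps x = (\<chi> u. if u \<in> U then (1/2) *\<^sub>R (x $ u + twist eps 1 (x $ g u)) else 0)"

definition glue :: "(real^3)^'v \<Rightarrow> (real^3)^'v \<Rightarrow> (real^3)^'v" where
  "glue x y = (\<chi> i. if i \<in> U then x $ i + y $ i else twist 1 1 (x $ g i) + twist (-1) 1 (y $ g i))"

lemma linear_half: "linear (half eps)"
  by (rule linearI; rule vec_eq_iff[THEN iffD2])
     (auto simp: half_def twist_linear algebra_simps)

text \<open>The gauge vectors of mirror images correspond up to a scalar, so the normalisation of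
  velocities is compatible with splitting into blocks.\<close>

lemma gauge_twist: "\<exists>k. \<forall>z. gauge i \<bullet> twist eps 1 z = k * (gauge (g i) \<bullet> z)"
proof (cases "i \<in> VP")
  case True
  then show ?thesis by (intro exI[of _ "- eps"]) (simp add: gauge_def inner_axis_left twist_def)
next
  case False
  obtain \<sigma> where s: "\<sigma> \<in> {1, -1}" "X (g i) = \<sigma> *\<^sub>R flip 1 (X i)" using X_g by blast
  have "\<sigma> * (X (g i) \<bullet> z) = flip 1 (X i) \<bullet> z" for z using s by auto
  then show ?thesis using False
    by (intro exI[of _ "- eps * \<sigma>"]) (simp add: gauge_def twist_def inner_flip)
qed

lemma gauge_twist_0: "gauge (g i) \<bullet> z = 0 \<Longrightarrow> gauge i \<bullet> twist eps 1 z = 0"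
  using gauge_twist[of i eps] by (metis mult_zero_right)

lemma half_block:
  assumes "x \<in> hat_motions" "eps * eps = 1"
  shows "half eps x \<in> block eps"
proof -
  have x: "\<And>i. gauge i \<bullet> x $ i = 0"
    "\<And>u w \<alpha>. (u, w, \<alpha>) \<in> E0 \<Longrightarrow> cross3 (X u) (flip \<alpha> (X w)) \<bullet> (x $ u - x $ act \<alpha> w) = 0"
    "\<And>u w \<alpha>. (u, w, \<alpha>) \<in> E0 \<Longrightarrow> cross3 (X u) (flip \<alpha> (X w)) \<bullet> flip 1 (x $ g u - x $ act (\<alpha> + 1) w) = 0"
    using assms(1) unfolding hat_motions_iff by blast+
  have "orbit_row eps Y (u, w, \<alpha>) \<bullet> half eps x = 0" if e: "(u, w, \<alpha>) \<in> E0" for u w \<alpha>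
  proof -
    let ?A = "cross3 (X u) (flip \<alpha> (X w))"
    have uw: "u \<in> U" "w \<in> U" using E0_U[OF e] by auto
    have tw: "twist eps \<alpha> (half eps x $ w) = (1/2) *\<^sub>R (x $ act \<alpha> w + twist eps 1 (x $ act (\<alpha> + 1) w))"
      using uw by (cases \<alpha>)
        (simp_all add: half_def act_def twist_linear
          twist_twist[OF assms(2)] add.commute)
    have "orbit_row eps Y (u, w, \<alpha>) \<bullet> half eps x =
        ?A \<bullet> ((1/2) *\<^sub>R ((x $ u - x $ act \<alpha> w) + twist eps 1 (x $ g u - x $ act (\<alpha> + 1) w)))"
      unfolding orbit_row_inner tw using uw
      by (simp add: half_def linear_diff[OF linear_twist] algebra_simps)
    also have "\<dots> = (1/2) * (?A \<bullet> (x $ u - x $ act \<alpha> w) -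
        eps * (?A \<bullet> flip 1 (x $ g u - x $ act (\<alpha> + 1) w)))"
      unfolding inner_scaleR_right inner_add_right by (simp add: twist_def)
    also have "\<dots> = 0" unfolding x(2)[OF e] x(3)[OF e] by simp
    finally show ?thesis .
  qed
  moreover have "gauge u \<bullet> half eps x $ u = 0" if "u \<in> U" for u
    using that x(1)[of u] gauge_twist_0[OF x(1)[of "g u"]] by (simp add: half_def inner_add_right)
  ultimately show ?thesis by (auto simp: block_def half_def)
qed

lemma glue_motion:
  assumes x: "x \<in> block 1" and y: "y \<in> block (-1)"
  shows "glue x y \<in> hat_motions"
  unfolding hat_motions_iff
proof (intro conjI allI impI)
  fix i
  show "gauge i \<bullet> glue x y $ i = 0"
  proof (cases "i \<in> U")
    case True
    then show ?thesis using x y by (simp add: glue_def block_def inner_add_right)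
  next
    case False
    then have "gauge (g i) \<bullet> x $ g i = 0" "gauge (g i) \<bullet> y $ g i = 0" using x y by (simp_all add: block_def)
    then show ?thesis using False by (simp add: glue_def inner_add_right gauge_twist_0)
  qed
next
  fix u w \<alpha> assume e: "(u, w, \<alpha>) \<in> E0"
  let ?A = "cross3 (X u) (flip \<alpha> (X w))"
  have uw: "u \<in> U" "w \<in> U" using E0_U[OF e] by auto
  have rx: "?A \<bullet> (x $ u - twist 1 \<alpha> (x $ w)) = 0" and ry: "?A \<bullet> (y $ u - twist (-1) \<alpha> (y $ w)) = 0"
    using x y e orbit_row_inner[of 1 Y u w \<alpha> x] orbit_row_inner[of "-1" Y u w \<alpha> y]
    by (auto simp: block_def)
  have ga: "glue x y $ act \<beta> w = twist 1 \<beta> (x $ w) + twist (-1) \<beta> (y $ w)" for \<beta>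
    using uw by (cases \<beta>) (simp_all add: glue_def act_def)
  have gu: "glue x y $ u = x $ u + y $ u" "glue x y $ g u = twist 1 1 (x $ u) + twist (-1) 1 (y $ u)"
    using uw by (simp_all add: glue_def)
  have "?A \<bullet> (glue x y $ u - glue x y $ act \<alpha> w) =
      ?A \<bullet> (x $ u - twist 1 \<alpha> (x $ w)) + ?A \<bullet> (y $ u - twist (-1) \<alpha> (y $ w))"
    unfolding ga gu by (simp add: inner_add_right inner_diff_right)
  then show "?A \<bullet> (glue x y $ u - glue x y $ act \<alpha> w) = 0" using rx ry by simp
  have "flip 1 (glue x y $ g u - glue x y $ act (\<alpha> + 1) w) =
      - (x $ u - twist 1 \<alpha> (x $ w)) + (y $ u - twist (-1) \<alpha> (y $ w))"
    unfolding ga gu by (cases \<alpha>) (simp_all add: twist_def vec_eq_iff forall_3)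
  then show "?A \<bullet> flip 1 (glue x y $ g u - glue x y $ act (\<alpha> + 1) w) = 0"
    using rx ry by (simp add: inner_add_right inner_diff_right)
qed

lemma half_glue:
  assumes x: "x \<in> block 1" and y: "y \<in> block (-1)"
  shows "half 1 (glue x y) = x" "half (-1) (glue x y) = y"
proof -
  have "half 1 (glue x y) $ u = x $ u" "half (-1) (glue x y) $ u = y $ u" for u
    using x y by (auto simp: half_def glue_def twist_def block_def vec_eq_iff[where 'b=3] forall_3)
  then show "half 1 (glue x y) = x" "half (-1) (glue x y) = y" by (simp_all add: vec_eq_iff[where 'b='v])
qed

lemma half_eq_0:
  assumes "half 1 x = 0" "half (-1) x = 0"
  shows "x = 0"
proof -
  have U: "x $ u = 0 \<and> x $ g u = 0" if "u \<in> U" for u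
  proof -
    have "half 1 x $ u = 0" "half (-1) x $ u = 0" using assms by simp_all
    then show ?thesis using that by (simp add: half_def twist_def vec_eq_iff[where 'b=3] forall_3)
  qed
  have "x $ i = 0" for i using U[of i] U[of "g i"] by (cases "i \<in> U") auto
  then show ?thesis by (simp add: vec_eq_iff[where 'b='v])
qed

lemma subspace_hat_motions: "subspace hat_motions"
proof -
  have "edge_form (x + y) i j = edge_form x i j + edge_form y i j"
    "edge_form (c *\<^sub>R x) i j = c * edge_form x i j" "edge_form 0 i j = 0" for x y i j c
    by (simp_all add: edge_form_def inner_diff_right inner_add_right algebra_simps)
  then show ?thesis unfolding hat_motions_def by (simp add: subspace_def inner_add_right)
qed

lemma dim_motions: "dim (inf_motions VP VH E p a) + rk 1 + rk (-1) = 4 * card U"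
proof -
  define D where "D x = (half 1 x, half (-1) x)" for x
  have linD: "linear D"
    by (rule linearI) (simp_all add: D_def linear_add[OF linear_half] linear_cmul[OF linear_half])
  have "D ` hat_motions = block 1 \<times> block (-1)"
  proof (intro set_eqI iffI)
    fix z assume "z \<in> D ` hat_motions"
    then show "z \<in> block 1 \<times> block (-1)" using half_block by (auto simp: D_def)
  next
    fix z assume "z \<in> block 1 \<times> block (-1)"
    then obtain x y where z: "z = (x, y)" "x \<in> block 1" "y \<in> block (-1)" by blast
    then have "z = D (glue x y)" using half_glue by (simp add: D_def)
    then show "z \<in> D ` hat_motions" using glue_motion z by blast
  qed
  moreover have "inj_on D hat_motions"
    unfolding linear_inj_on_iff_eq_0[OF linD subspace_hat_motions] using half_eq_0
    by (auto simp: D_def zero_prod_def)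
  ultimately have "dim (block 1 \<times> block (-1)) = dim hat_motions"
    using dim_image_eq[OF linD] subspace_hat_motions by (metis span_eq_iff)
  then have "dim hat_motions = dim (block 1) + dim (block (-1))"
    using dim_Times[OF subspace_block subspace_block] by metis
  then show ?thesis using dim_inf_motions dim_block[of 1] dim_block[of "-1"] by simp
qed

text \<open>The right-hand side does not depend on the positions; hence maximal rank means a motion
  space of minimal dimension.\<close>

lemma dim_motions_rank:
  "dim (inf_motions VP VH E p a) + rigidity_rank VP VH E p a =
   dim {w :: 'v velocity. (\<forall>i. i \<notin> VP \<longrightarrow> fst w $ i = 0) \<and>
     (\<forall>j. j \<notin> VH \<longrightarrow> fst (snd w) $ j = 0 \<and> snd (snd w) $ j = 0)}" (is "_ = dim ?S")
proof -
  let ?R = "rigidity_rows VP VH E p a"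
  have sub: "subspace ?S" by (simp add: subspace_def)
  have "?R \<subseteq> ?S" unfolding rigidity_rows_def by (auto simp: axis_def)
  then have RS: "span ?R \<subseteq> ?S" by (rule span_minimal) (rule sub)
  have "inf_motions VP VH E p a = {y \<in> ?S. \<forall>x\<in>span ?R. orthogonal x y}"
  proof (intro set_eqI iffI)
    fix y assume y: "y \<in> inf_motions VP VH E p a"
    have "span ?R \<subseteq> {x. x \<bullet> y = 0}"
      using y unfolding inf_motions_orthogonal by (intro span_minimal) (auto simp: subspace_def inner_add_left)
    then show "y \<in> {y \<in> ?S. \<forall>x\<in>span ?R. orthogonal x y}"
      using y unfolding inf_motions_orthogonal orthogonal_def by blast
  next
    fix y assume "y \<in> {y \<in> ?S. \<forall>x\<in>span ?R. orthogonal x y}"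
    then show "y \<in> inf_motions VP VH E p a"
      unfolding inf_motions_orthogonal orthogonal_def using span_base by blast
  qed
  then show ?thesis
    using dim_subspace_orthogonal_to_vectors[OF subspace_span sub RS] by (simp add: rigidity_rank_def)
qed

end

section \<open>Forced symmetric rigidity\<close>

lemma bit_all: "(\<forall>\<delta>::bit. P \<delta>) \<longleftrightarrow> P 0 \<and> P 1"
  by (metis bit.exhaust)

lemma skew_2:
  fixes S :: "real^2^2"
  assumes "transpose S = - S"
  shows "(S *v x) $ 1 = - (S $ 2 $ 1) * x $ 2" "(S *v x) $ 2 = S $ 2 $ 1 * x $ 1"
proof -
  have t: "S $ j $ i = - S $ i $ j" for i j
    using arg_cong[OF assms, of "\<lambda>M. M $ i $ j"] by (simp add: transpose_def)
  have "S $ 1 $ 1 = 0" "S $ 2 $ 2 = 0" "S $ 1 $ 2 = - S $ 2 $ 1"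
    using t[of 1 1] t[of 2 2] t[of 2 1] by linarith+
  then show "(S *v x) $ 1 = - (S $ 2 $ 1) * x $ 2" "(S *v x) $ 2 = S $ 2 $ 1 * x $ 1"
    by (simp_all add: matrix_vector_mult_def sum_2)
qed

context mirror
begin

lemma c_skew:
  fixes S :: "real^2^2"
  assumes "transpose S = - S"
  shows "c1 (S *v x) = - (S $ 2 $ 1) * c2 x" "c2 (S *v x) = S $ 2 $ 1 * c1 x"
  using skew_2[OF assms]
  by (simp_all add: c1_def c2_def axial_def inner_vec_def sum_2 algebra_simps)

end

context reflection_framework
begin

lemma half_minus_eq_0:
  "half (-1) x = 0 \<longleftrightarrow> (\<forall>i. x $ g i = - flip 1 (x $ i))"
proof
  assume 0: "half (-1) x = 0"
  have *: "x $ i = - flip 1 (x $ g i)" if "i \<in> U" for i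
  proof -
    have "half (-1) x $ i = 0" using 0 by simp
    then show ?thesis using that by (simp add: half_def twist_def add_eq_0_iff2)
  qed
  show "\<forall>i. x $ g i = - flip 1 (x $ i)"
  proof
    fix i
    show "x $ g i = - flip 1 (x $ i)"
      using *[of i] *[of "g i"] by (cases "i \<in> U") (auto simp: flip_minus)
  qed
next
  assume "\<forall>i. x $ g i = - flip 1 (x $ i)"
  then show "half (-1) x = 0"
    by (simp add: half_def twist_def flip_minus vec_eq_iff[where 'b='v])
qed

lemma half_plus:
  assumes "half (-1) x = 0"
  shows "half 1 x = (\<chi> u. if u \<in> U then x $ u else 0)"
  using assms[unfolded half_minus_eq_0]
  by (simp add: half_def twist_def flip_minus vec_eq_iff[where 'b='v] flip: scaleR_2)

lemma a_g_coords:
  assumes "\<sigma> \<in> {1, -1}" "reflection n (a j) = \<sigma> *\<^sub>R a (g j)"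
  shows "c1 (a (g j)) = - \<sigma> * c1 (a j)" "c2 (a (g j)) = \<sigma> * c2 (a j)"
  using assms c_reflection[of "a j"] by auto

lemma symmetric_point_iff:
  assumes "i \<in> VP"
  shows "hat (p', a', r') $ g i = - flip 1 (hat (p', a', r') $ i) \<longleftrightarrow> reflection n (p' $ i) = p' $ g i"
  using assms by (auto simp: vec_eq_iff[where 'b=3] forall_3 hat_nth vec2_eq_iff)

lemma symmetric_line_iff:
  assumes j: "j \<notin> VP" and \<sigma>: "\<sigma> \<in> {1, -1}" "reflection n (a j) = \<sigma> *\<^sub>R a (g j)"
    and 0: "a j \<bullet> a' $ j = 0" "a (g j) \<bullet> a' $ g j = 0"
  shows "hat (p', a', r') $ g j = - flip 1 (hat (p', a', r') $ j) \<longleftrightarrow>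
    reflection n (a' $ j) = \<sigma> *\<^sub>R a' $ g j \<and> r' $ j = \<sigma> * r' $ g j"
proof -
  define l m where "l = c2 (a j) * c1 (a' $ j) - c1 (a j) * c2 (a' $ j)"
    and "m = c2 (a (g j)) * c1 (a' $ g j) - c1 (a (g j)) * c2 (a' $ g j)"
  have gj: "g j \<notin> VP" using j by simp
  note nl = normal_velocity[OF j 0(1), folded l_def] and nm = normal_velocity[OF gj 0(2), folded m_def]
  note ag = a_g_coords[OF \<sigma>]
  have ss: "\<sigma> * \<sigma> = 1" using \<sigma>(1) by auto
  have nz: "c1 (a j) \<noteq> 0 \<or> c2 (a j) \<noteq> 0" using a_sq[OF j] by auto
  have h: "hat (p', a', r') $ j $ 3 = l" "hat (p', a', r') $ g j $ 3 = m"
    using j by (simp_all add: hat_nth l_def m_def)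
  have "hat (p', a', r') $ g j = - flip 1 (hat (p', a', r') $ j) \<longleftrightarrow>
      r' $ g j * \<sigma> * c2 (a j) = r' $ j * c2 (a j) \<and> r' $ g j * \<sigma> * c1 (a j) = r' $ j * c1 (a j) \<and> m = - l"
    using j by (auto simp: vec_eq_iff[where 'b=3] forall_3 h hat_nth(4,5) ag)
  also have "\<dots> \<longleftrightarrow> r' $ j = \<sigma> * r' $ g j \<and> m = - l"
    using nz by (auto simp: mult.commute)
  also have "m = - l \<longleftrightarrow> reflection n (a' $ j) = \<sigma> *\<^sub>R a' $ g j"
  proof -
    have "reflection n (a' $ j) = \<sigma> *\<^sub>R a' $ g j \<longleftrightarrow>
        (- l) * c2 (a j) = m * c2 (a j) \<and> (- l) * c1 (a j) = m * c1 (a j)"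
      unfolding vec2_eq_iff c_reflection c_linear nl nm ag using \<sigma>(1) by auto
    then show ?thesis unfolding mult_cancel_right using nz by auto
  qed
  finally show ?thesis by blast
qed

lemma symmetric_velocity_iff:
  assumes \<theta>: "\<theta> 0 = id" "\<theta> 1 = g" and \<tau>: "\<tau> 0 = id" "\<tau> 1 = reflection n"
    and w: "w \<in> inf_motions VP VH E p a"
  shows "symmetric_velocity VP VH \<theta> \<tau> a w \<longleftrightarrow> half (-1) (hat w) = 0"
proof -
  obtain p' a' r' where pa: "w = (p', a', r')" by (cases w)
  have perp: "a j \<bullet> a' $ j = 0" if "j \<notin> VP" for j
    using w that unfolding pa inf_motions_iff by (auto simp: VP_VH)
  have line: "hat w $ g j = - flip 1 (hat w $ j) \<longleftrightarrow>
      (\<exists>\<sigma>\<in>{1, -1}. reflection n (a j) = \<sigma> *\<^sub>R a (g j) \<and>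
        reflection n (a' $ j) = \<sigma> *\<^sub>R a' $ g j \<and> r' $ j = \<sigma> * r' $ g j)" if j: "j \<notin> VP" for j
  proof -
    obtain \<sigma> where \<sigma>: "\<sigma> \<in> {1, -1}" "reflection n (a j) = \<sigma> *\<^sub>R a (g j)" using a_g j VP_VH by blast
    have "a j \<bullet> a' $ j = 0" "a (g j) \<bullet> a' $ g j = 0" using perp j by auto
    note iff = symmetric_line_iff[OF j _ _ this, of _ p' r', folded pa]
    show ?thesis using \<sigma> iff by blast
  qed
  have id: "\<exists>\<sigma>\<in>{1, -1}. id (a j) = \<sigma> *\<^sub>R a (id j) \<and> id (a' $ j) = \<sigma> *\<^sub>R a' $ (id j) \<and> r' $ j = \<sigma> * r' $ (id j)" for j
    by (rule bexI[of _ 1]) auto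
  have "symmetric_velocity VP VH \<theta> \<tau> a w \<longleftrightarrow> (\<forall>i\<in>VP. reflection n (p' $ i) = p' $ g i) \<and>
      (\<forall>j\<in>VH. \<exists>\<sigma>\<in>{1, -1}. reflection n (a j) = \<sigma> *\<^sub>R a (g j) \<and>
        reflection n (a' $ j) = \<sigma> *\<^sub>R a' $ g j \<and> r' $ j = \<sigma> * r' $ g j)"
    unfolding pa symmetric_velocity_def prod.case bit_all \<theta> \<tau> using id by simp
  also have "\<dots> \<longleftrightarrow> (\<forall>i. hat w $ g i = - flip 1 (hat w $ i))"
    using symmetric_point_iff[of _ p' a' r', folded pa] line VP_VH by blast
  finally show ?thesis unfolding half_minus_eq_0 .
qed

text \<open>Translation along the mirror, up to scaling the only infinitesimal isometry commuting
  with the reflection.\<close>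

definition slide :: "'v velocity" where
  "slide = ((\<chi> i. if i \<in> VP then axial else 0), 0, (\<chi> j. if j \<in> VH then - c2 (a j) else 0))"

lemma hat_slide:
  "i \<in> VP \<Longrightarrow> hat slide $ i = vector [1, 0, 0]"
  "i \<notin> VP \<Longrightarrow> hat slide $ i = vector [c2 (a i) * c2 (a i), - (c2 (a i) * c1 (a i)), 0]"
  unfolding slide_def by (auto simp: vec_eq_iff[where 'b=3] forall_3 hat_nth VP_VH)

lemma slide_motion: "slide \<in> inf_motions VP VH E p a"
  unfolding inf_motions_def slide_def
  by (auto simp: VP_VH inner_c1_c2)

lemma half_slide: "half (-1) (hat slide) = 0"
  unfolding half_minus_eq_0
proof
  fix i
  show "hat slide $ g i = - flip 1 (hat slide $ i)"
  proof (cases "i \<in> VP")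
    case True
    then show ?thesis by (simp add: hat_slide vec_eq_iff[where 'b=3] forall_3)
  next
    case False
    then obtain \<sigma> where \<sigma>: "\<sigma> \<in> {1, -1}" "reflection n (a i) = \<sigma> *\<^sub>R a (g i)" using a_g VP_VH by blast
    have "\<sigma> * \<sigma> = 1" using \<sigma>(1) by auto
    then have "\<sigma> * x * (\<sigma> * y) = x * y" for x y by (metis mult.assoc mult.left_commute mult_1)
    then show ?thesis using False a_g_coords[OF \<sigma>] \<open>\<sigma> * \<sigma> = 1\<close>
      by (simp add: hat_slide vec_eq_iff[where 'b=3] forall_3)
  qed
qed

lemma trivial_slide: "trivial_velocity VP VH p a (k *\<^sub>R slide)"
proof -
  have eq: "k *\<^sub>R slide = (k *\<^sub>R (\<chi> i. if i \<in> VP then axial else 0), 0,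
      k *\<^sub>R (\<chi> j. if j \<in> VH then - c2 (a j) else 0))"
    by (simp add: slide_def)
  have "transpose (0 :: real^2^2) = - 0" by (simp add: transpose_def vec_eq_iff)
  then show ?thesis
    unfolding trivial_velocity_def eq prod.case
    by (intro exI[of _ 0] exI[of _ "k *\<^sub>R axial"]) (auto simp: c2_def inner_commute)
qed

text \<open>Symmetrising an infinitesimal isometry cancels its rotation and its translation across
  the mirror; the factor that survives is \<open>c2 t\<close>.\<close>

lemma half_trivial:
  assumes "trivial_velocity VP VH p a w"
  shows "\<exists>k. half 1 (hat w) = k *\<^sub>R half 1 (hat slide)"
proof -
  obtain p' a' r' where pa: "w = (p', a', r')" by (cases w)
  obtain S :: "real^2^2" and t where S: "transpose S = - S"
    and pt: "\<And>i. i \<in> VP \<Longrightarrow> p' $ i = S *v p i + t"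
    and at: "\<And>j. j \<notin> VP \<Longrightarrow> a' $ j = S *v a j" "\<And>j. j \<notin> VP \<Longrightarrow> r' $ j = - (a j \<bullet> t)"
    using assms unfolding pa trivial_velocity_def by (auto simp: VP_VH)
  have "half 1 (hat w) $ u = (c2 t) *\<^sub>R hat slide $ u" if "u \<in> U" for u
  proof (cases "u \<in> VP")
    case True
    then show ?thesis using that pt[of u] pt[of "g u"] p_g[of u]
      by (simp add: half_def pa twist_def hat_slide vec_eq_iff[where 'b=3] forall_3 hat_nth c_skew[OF S] algebra_simps)
  next
    case False
    then obtain \<sigma> where \<sigma>: "\<sigma> \<in> {1, -1}" "reflection n (a u) = \<sigma> *\<^sub>R a (g u)" using a_g VP_VH by blast
    have u: "c1 (a (g u)) = - \<sigma> * c1 (a u)" "c2 (a (g u)) = \<sigma> * c2 (a u)" by (rule a_g_coords[OF \<sigma>])+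
    have r: "r' $ u = - (c1 (a u) * c1 t + c2 (a u) * c2 t)"
      "r' $ g u = - (- \<sigma> * c1 (a u) * c1 t + \<sigma> * c2 (a u) * c2 t)"
      using False at(2)[of u] at(2)[of "g u"] inner_c1_c2[of _ t] u by simp_all
    have b: "c1 (a' $ u) = - (S $ 2 $ 1) * c2 (a u)" "c2 (a' $ u) = S $ 2 $ 1 * c1 (a u)"
      "c1 (a' $ g u) = - (S $ 2 $ 1) * (\<sigma> * c2 (a u))" "c2 (a' $ g u) = S $ 2 $ 1 * (- \<sigma> * c1 (a u))"
      using False at(1)[of u] at(1)[of "g u"] c_skew[OF S] u by simp_all
    show ?thesis using that False \<sigma>(1)
      by (auto simp: half_def pa twist_def hat_slide vec_eq_iff[where 'b=3] forall_3 hat_nth r b u algebra_simps)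
  qed
  moreover have "half 1 (hat slide) $ u = (if u \<in> U then hat slide $ u else 0)" for u
    using half_plus[OF half_slide] by simp
  ultimately have "half 1 (hat w) = c2 t *\<^sub>R half 1 (hat slide)"
    by (simp add: vec_eq_iff[where 'b='v]) (simp add: half_def)
  then show ?thesis by blast
qed

text \<open>Translation along the mirror moves every point, but it fixes lines parallel to the
  mirror. If there are no points, the dimension bound forces a nonzero row, necessarily of the edge
  between the two lines, and this row would vanish for lines parallel to the mirror.\<close>

lemma dim_block_le_imp_slide:
  assumes "dim (block 1) \<le> 1" "card VH = 2"
  shows "half 1 (hat slide) \<noteq> 0"
proof -
  have hs: "half 1 (hat slide) $ u = (if u \<in> U then hat slide $ u else 0)" for u
    using half_plus[OF half_slide] by simp
  have v1: "(vector [1, 0, 0] :: real^3) \<noteq> 0" by (metis vector_3(1) zero_index zero_neq_one)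
  show ?thesis
  proof (cases "VP \<inter> U = {}")
    case False
    then obtain u where "u \<in> VP" "u \<in> U" by blast
    then show ?thesis using hs[of u] hat_slide(1)[of u] v1 by force
  next
    case True
    have nVP: "i \<notin> VP" for i
    proof
      assume "i \<in> VP"
      then have "i \<in> VP \<inter> U \<or> g i \<in> VP \<inter> U" by auto
      then show False using True by blast
    qed
    have "card U > 0"
    proof -
      obtain j where "j \<in> VH" using assms(2) by (metis card.empty ex_in_conv zero_neq_numeral)
      then have "U \<noteq> {}" using g_U[of j] by blast
      then show ?thesis by (simp add: card_gt_0_iff)
    qed
    then have "rk 1 > 0" using dim_block[of 1] assms(1) by linarith
    then have "\<not> orbit_row 1 Y ` E0 \<subseteq> {0}" unfolding rk_def by (metis dim_eq_0 less_irrefl)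
    then obtain u w \<alpha> where e: "(u, w, \<alpha>) \<in> E0" "orbit_row 1 Y (u, w, \<alpha>) \<noteq> 0" by force
    have uw: "u \<in> U" "w \<in> U" using E0_U[OF e(1)] by auto
    have "u = w"
    proof (rule ccontr)
      assume "u \<noteq> w"
      then have d: "u \<noteq> w" "u \<noteq> g u" "u \<noteq> g w" "w \<noteq> g u" "w \<noteq> g w" "g u \<noteq> g w"
        using uw by (metis g_U g_g)+
      then have "card {u, w, g u, g w} = 4"
        using d by simp
      moreover have "card {u, w, g u, g w} \<le> card VH" by (rule card_mono) (auto simp: VP_VH nVP)
      ultimately show False using assms(2) by simp
    qed
    have "c2 (a u) \<noteq> 0"
    proof
      assume "c2 (a u) = 0"
      then have "cross3 (X u) (flip \<alpha> (X u)) = 0"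
        by (auto simp: vec_eq_iff[where 'b=3] forall_3 cross_components X_nth nVP)
      then have "orbit_row 1 Y (u, w, \<alpha>) = 0"
        using \<open>u = w\<close> by (intro vec_eq_iff[THEN iffD2]) (simp add: orbit_row_nth)
      then show False using e(2) by simp
    qed
    then have "hat slide $ u $ 1 \<noteq> 0" by (simp add: hat_slide nVP)
    then show ?thesis using hs[of u] uw by force
  qed
qed

lemma forced_symmetric_rigid_iff:
  assumes \<theta>: "\<theta> 0 = id" "\<theta> 1 = g" and \<tau>: "\<tau> 0 = id" "\<tau> 1 = reflection n" and VH: "card VH = 2"
  shows "forced_symmetric_rigid VP VH E \<theta> \<tau> p a \<longleftrightarrow> dim (block 1) \<le> 1"
proof
  assume forced: "forced_symmetric_rigid VP VH E \<theta> \<tau> p a"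
  have "x \<in> span {half 1 (hat slide)}" if x: "x \<in> block 1" for x
  proof -
    have 0: "0 \<in> block (-1)" by (rule subspace_0[OF subspace_block])
    define w where "w = unhat (glue x 0)"
    have w: "w \<in> inf_motions VP VH E p a" "hat w = glue x 0"
      unfolding w_def by (rule unhat_motion[OF glue_motion[OF x 0]])+
    have "half (-1) (hat w) = 0" "half 1 (hat w) = x" unfolding w(2) using half_glue[OF x 0] by simp_all
    then have "trivial_velocity VP VH p a w"
      using forced symmetric_velocity_iff[OF \<theta> \<tau> w(1)] w(1) unfolding forced_symmetric_rigid_def by blast
    from half_trivial[OF this] show ?thesis
      unfolding \<open>half 1 (hat w) = x\<close> by (auto simp: span_singleton)
  qed
  then have "dim (block 1) \<le> card {half 1 (hat slide)}" by (intro dim_le_card) auto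
  then show "dim (block 1) \<le> 1" by simp
next
  assume dim: "dim (block 1) \<le> 1"
  let ?z = "half 1 (hat slide)"
  have z: "?z \<noteq> 0" by (rule dim_block_le_imp_slide[OF dim VH])
  have zb: "?z \<in> block 1" by (rule half_block[OF hat_motion[OF slide_motion]]) simp
  have "block 1 \<subseteq> span {?z}"
  proof (rule card_ge_dim_independent)
    show "independent {?z}" using z by simp
  qed (use dim zb in auto)
  show "forced_symmetric_rigid VP VH E \<theta> \<tau> p a"
    unfolding forced_symmetric_rigid_def
  proof (intro ballI impI)
    fix w assume w: "w \<in> inf_motions VP VH E p a" "symmetric_velocity VP VH \<theta> \<tau> a w"
    have m: "half (-1) (hat w) = 0" using symmetric_velocity_iff[OF \<theta> \<tau> w(1)] w(2) by blast
    have "half 1 (hat w) \<in> block 1" by (rule half_block[OF hat_motion[OF w(1)]]) simp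
    then obtain k where k: "half 1 (hat w) = k *\<^sub>R ?z"
      using \<open>block 1 \<subseteq> span {?z}\<close> by (auto simp: span_singleton)
    \<comment> \<open>After subtracting this translation both halves vanish, so the motion is
      zero.\<close>
    let ?d = "w - k *\<^sub>R slide"
    have hd: "hat ?d = hat w - k *\<^sub>R hat slide"
      by (simp add: linear_diff[OF linear_hat] linear_cmul[OF linear_hat])
    have "half 1 (hat ?d) = 0" "half (-1) (hat ?d) = 0"
      unfolding hd using k m half_slide
      by (simp_all add: linear_diff[OF linear_half] linear_cmul[OF linear_half])
    then have "hat ?d = 0" by (rule half_eq_0)
    moreover have "?d \<in> inf_motions VP VH E p a"
      using subspace_diff[OF subspace_inf_motions w(1) subspace_scale[OF subspace_inf_motions slide_motion]] .
    ultimately have "?d = 0" using hat_eq_0 by blast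
    then show "trivial_velocity VP VH p a w" using trivial_slide[of k] by simp
  qed
qed

end

section \<open>Realising sparse edge sets by point-line frameworks\<close>

text \<open>
  \<open>tilt s t\<close> commutes with the reflection and maps vectors proportional to \<open>(_, s, t)\<close> to the plane
  at infinity; \<open>cotilt s t\<close> is its cofactor map.
\<close>

definition tilt :: "real \<Rightarrow> real \<Rightarrow> real^3 \<Rightarrow> real^3" where
  "tilt s t x = vector [x $ 1, s * x $ 2 + t * x $ 3, s * x $ 3 - t * x $ 2]"

definition cotilt :: "real \<Rightarrow> real \<Rightarrow> real^3 \<Rightarrow> real^3" where
  "cotilt s t x = vector [(s * s + t * t) * x $ 1, s * x $ 2 + t * x $ 3, s * x $ 3 - t * x $ 2]"

lemma tilt_nth [simp]:
  "tilt s t x $ 1 = x $ 1" "tilt s t x $ 2 = s * x $ 2 + t * x $ 3" "tilt s t x $ 3 = s * x $ 3 - t * x $ 2"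
  by (simp_all add: tilt_def)

lemma cotilt_nth [simp]:
  "cotilt s t x $ 1 = (s * s + t * t) * x $ 1" "cotilt s t x $ 2 = s * x $ 2 + t * x $ 3"
  "cotilt s t x $ 3 = s * x $ 3 - t * x $ 2"
  by (simp_all add: cotilt_def)

lemma cross3_tilt: "cross3 (tilt s t x) (tilt s t y) = cotilt s t (cross3 x y)"
  by (simp add: vec_eq_iff forall_3 cross_components algebra_simps)

lemma tilt_flip: "tilt s t (flip \<alpha> x) = flip \<alpha> (tilt s t x)"
  by (simp add: vec_eq_iff forall_3)

lemma linear_cotilt: "linear (cotilt s t)"
  by (rule linearI) (simp_all add: vec_eq_iff forall_3 algebra_simps)

lemma cotilt_eq_0:
  assumes "s * s + t * t \<noteq> 0" "cotilt s t x = 0"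
  shows "x = 0"
proof -
  have 1: "(s * s + t * t) * x $ 1 = 0" and 2: "s * x $ 2 + t * x $ 3 = 0" and 3: "s * x $ 3 - t * x $ 2 = 0"
    using assms(2) cotilt_nth[of s t x] by simp_all
  have "(s * s + t * t) * x $ 2 = s * (s * x $ 2 + t * x $ 3) - t * (s * x $ 3 - t * x $ 2)"
    "(s * s + t * t) * x $ 3 = t * (s * x $ 2 + t * x $ 3) + s * (s * x $ 3 - t * x $ 2)"
    by (simp_all add: algebra_simps)
  with 1 2 3 assms(1) show ?thesis by (auto simp: vec_eq_iff forall_3)
qed

text \<open>Rows consist of cross products, on which \<open>tilt\<close> acts through the injective
  map \<open>cotilt\<close>; the factors at the two ends rescale the row of an edge as a
  whole.\<close>

lemma indep_family_tilt:
  fixes F :: "'v::finite sedge set"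
  assumes F: "indep_family F (orbit_row eps Y)" and st: "s * s + t * t \<noteq> 0"
    and Z: "\<And>u. u \<in> sverts F \<Longrightarrow> Z $ u = k u *\<^sub>R tilt s t (Y $ u)" "\<And>u. u \<in> sverts F \<Longrightarrow> k u \<noteq> 0"
  shows "indep_family F (orbit_row eps Z)"
proof -
  define L :: "(real^3)^'v \<Rightarrow> (real^3)^'v" where "L x = (\<chi> u. cotilt s t (x $ u))" for x
  have linL: "linear L"
    by (rule linearI) (simp_all add: L_def vec_eq_iff[where 'b='v] linear_add[OF linear_cotilt] linear_cmul[OF linear_cotilt])
  have L0: "x = 0" if "L x = 0" for x
  proof -
    have "cotilt s t (x $ u) = 0" for u using arg_cong[OF that, of "\<lambda>x. x $ u"] by (simp add: L_def)
    then show ?thesis using cotilt_eq_0[OF st] by (simp add: vec_eq_iff[where 'b='v])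
  qed
  define \<kappa> where "\<kappa> e = k (fst e) * k (fst (snd e))" for e :: "'v sedge"
  have row: "orbit_row eps Z e = \<kappa> e *\<^sub>R L (orbit_row eps Y e)" if "e \<in> F" for e
  proof -
    obtain u w \<alpha> where e: "e = (u, w, \<alpha>)" by (cases e)
    have uw: "u \<in> sverts F" "w \<in> sverts F" using in_sverts[of u w \<alpha> F] that e by auto
    have c: "cross3 (Z $ u') (flip \<alpha> (Z $ w')) = (k u' * k w') *\<^sub>R cotilt s t (cross3 (Y $ u') (flip \<alpha> (Y $ w')))"
      if "u' \<in> sverts F" "w' \<in> sverts F" for u' w'
      unfolding Z(1)[OF that(1)] Z(1)[OF that(2)]
      by (simp add: flip_scaleR cross_mult_left cross_mult_right cross3_tilt flip: tilt_flip)
    show ?thesis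
    proof (rule vec_eq_iff[THEN iffD2], rule allI)
      fix z
      show "orbit_row eps Z e $ z = (\<kappa> e *\<^sub>R L (orbit_row eps Y e)) $ z"
        unfolding e using c[OF uw] c[OF uw(2,1)]
        by (auto simp: orbit_row_nth L_def \<kappa>_def linear_add[OF linear_cotilt] linear_cmul[OF linear_cotilt]
            linear_0[OF linear_cotilt] scaleR_add_right mult.commute mult.left_commute)
    qed
  qed
  have "indep_family F (\<lambda>e. L (orbit_row eps Y e))"
    unfolding indep_family_def
  proof (intro allI impI)
    fix c assume "(\<Sum>e\<in>F. c e *\<^sub>R L (orbit_row eps Y e)) = 0"
    then have "L (\<Sum>e\<in>F. c e *\<^sub>R orbit_row eps Y e) = 0"
      by (simp add: linear_sum[OF linL] linear_cmul[OF linL])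
    then have "(\<Sum>e\<in>F. c e *\<^sub>R orbit_row eps Y e) = 0" by (rule L0)
    then show "\<forall>e\<in>F. c e = 0" using F unfolding indep_family_def by blast
  qed
  moreover have "\<kappa> e \<noteq> 0" if "e \<in> F" for e
    using Z(2) in_sverts[of "fst e" "fst (snd e)" "snd (snd e)" F] that by (simp add: \<kappa>_def)
  ultimately have "indep_family F (\<lambda>e. \<kappa> e *\<^sub>R L (orbit_row eps Y e))" by (rule indep_family_scale)
  then show ?thesis
    using indep_family_cong[of F "orbit_row eps Z" "\<lambda>e. \<kappa> e *\<^sub>R L (orbit_row eps Y e)", OF row] by simp
qed

context reflection_framework
begin

lemma rk_sparse:
  assumes "m = 1 \<and> eps = 1 \<or> m = 2 \<and> eps = -1"
  shows "\<exists>F\<subseteq>E0. signed_sparse m F \<and> card F = rk eps"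
proof -
  obtain B where B: "B \<subseteq> orbit_row eps Y ` E0" "independent B" "card B = rk eps"
    using basis_exists[of "orbit_row eps Y ` E0"] unfolding rk_def by metis
  obtain F where F: "F \<subseteq> E0" "inj_on (orbit_row eps Y) F" "B = orbit_row eps Y ` F"
    using B(1) by (metis subset_image_inj)
  have "indep_family F (orbit_row eps Y)"
    using F B(2) by (simp add: indep_family_iff_independent)
  then have "signed_sparse m F" by (rule indep_imp_sparse[OF assms])
  then show ?thesis using F B(3) card_image by metis
qed

lemma rk_ge:
  assumes "F \<subseteq> E0" "indep_family F (orbit_row eps Y)"
  shows "card F \<le> rk eps"
proof -
  have "card F = card (orbit_row eps Y ` F)" "independent (orbit_row eps Y ` F)"
    using assms(2) by (auto simp: indep_family_iff_independent card_image)
  then show ?thesis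
    unfolding rk_def using independent_card_le_dim[of "orbit_row eps Y ` F"] assms(1) by (metis image_mono)
qed

end

lemma (in mirror) reflection_reflection [simp]: "reflection n (reflection n x) = x"
  by (simp add: vec2_eq_iff)

locale symmetric_graph = orbit_graph VP VH E g U E0 act + mirror n
  for VP VH :: "'v::finite set" and E g U E0 act n +
  assumes card_VH: "card VH = 2"
begin

lemma VH_orbit: "\<exists>j\<in>U. VH = {j, g j}"
proof -
  have gH: "g i \<in> VH \<longleftrightarrow> i \<in> VH" for i by (simp add: VP_VH)
  obtain i where i: "i \<in> VH" using card_VH by (metis card.empty ex_in_conv zero_neq_numeral)
  have ne: "g j \<noteq> j" for j by (metis g_U)
  have "\<exists>j\<in>U. j \<in> VH" using i gH[of i] g_U[of i] by blast
  then obtain j where j: "j \<in> U" "j \<in> VH" by blast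
  have "{j, g j} = VH"
    by (rule card_seteq) (use j gH ne[of j] card_VH in auto)
  then show ?thesis using j by blast
qed

text \<open>One generic placement makes both edge sets independent in their blocks. A tilt puts the
  line orbit at infinity, and rescaling gives points last coordinate 1 and lines unit normals. The
  rows do not involve the offsets, which are all set to 0.\<close>

lemma realization:
  assumes F: "F1 \<subseteq> E0" "signed_sparse 1 F1" "F2 \<subseteq> E0" "signed_sparse 2 F2"
    and \<theta>: "\<theta> 0 = id" "\<theta> 1 = g" and \<tau>: "\<tau> 0 = id" "\<tau> 1 = reflection n"
  shows "\<exists>q. symmetric_framework VP VH \<theta> \<tau> q q (\<lambda>_. 0) \<and> reflection_framework VP VH E g U E0 n q q \<and>
    dim (inf_motions VP VH E q q) + card F1 + card F2 \<le> 4 * card U"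
proof -
  obtain Y1 Y2 where "indep_family F1 (orbit_row 1 Y1)" "indep_family F2 (orbit_row (-1) Y2)"
    using sparse_imp_indep[OF _ F(2), of 1] sparse_imp_indep[OF _ F(4), of "-1"] by auto
  then have "generically (\<lambda>Y. indep_family F1 (orbit_row 1 Y))" "generically (\<lambda>Y. indep_family F2 (orbit_row (-1) Y))"
    by (auto intro: generically_indep_family polynomial_function_orbit_row)
  then obtain Y where Y: "indep_family F1 (orbit_row 1 Y)" "indep_family F2 (orbit_row (-1) Y)" "general_position Y"
    using generically_ex[OF generically_conj[OF _ generically_conj[OF _ generically_general_position]]] by blast
  obtain j where j: "j \<in> U" "VH = {j, g j}" using VH_orbit by blast
  have VHU: "u \<in> VP \<longleftrightarrow> u \<noteq> j" if "u \<in> U" for u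
    using that j VP_VH[of u] g_U[of j] by auto
  define s t where "s = Y $ j $ 2" and "t = Y $ j $ 3"
  have st: "s * s + t * t \<noteq> 0"
    using general_position_nth(2)[OF Y(3), of j] unfolding s_def t_def by (metis sum_squares_eq_zero_iff)
  \<comment> \<open>The tilt sends exactly the plane spanned by \<open>Y $ j\<close> and its mirror
    image to infinity; by general position no other vertex lies in it, so all others become finite
    points.\<close>
  have third: "s * Y $ u $ 3 - t * Y $ u $ 2 \<noteq> 0" if "u \<noteq> j" for u
  proof -
    have "place Y (u, 0) \<bullet> cross3 (place Y (j, 0)) (place Y (j, 1)) \<noteq> 0"
      using that by (intro general_position_pair(2)[OF Y(3)]) auto
    moreover have "place Y (u, 0) \<bullet> cross3 (place Y (j, 0)) (place Y (j, 1)) =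
        2 * Y $ j $ 1 * (s * Y $ u $ 3 - t * Y $ u $ 2)"
      by (simp add: place_def inner_vec_def sum_3 cross_components s_def t_def algebra_simps)
    ultimately show ?thesis by auto
  qed
  define T where "T u = tilt s t (Y $ u)" for u
  have Tj: "T j $ 1 \<noteq> 0" "T j $ 2 \<noteq> 0" "T j $ 3 = 0"
    using general_position_nth(1)[OF Y(3), of j] st by (simp_all add: T_def s_def t_def)
  define k where "k u = (if u = j then 1 / norm (T j) else 1 / T u $ 3)" for u
  have "T j \<noteq> 0" using Tj by auto
  then have k: "k u \<noteq> 0" for u using third[of u] by (auto simp: k_def T_def)
  define Z where "Z u = k u *\<^sub>R T u" for u
  have Z3: "Z u $ 3 = (if u = j then 0 else 1)" for u
    using third[of u] Tj by (auto simp: Z_def k_def T_def)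
  have Zj: "Z j $ 1 \<noteq> 0" "Z j $ 2 \<noteq> 0" using Tj k[of j] by (simp_all add: Z_def)
  have "norm (Z j) = 1" using \<open>T j \<noteq> 0\<close> by (simp add: Z_def k_def)
  then have Zsq: "Z j $ 1 * Z j $ 1 + Z j $ 2 * Z j $ 2 = 1"
    using Z3[of j] by (simp add: norm_eq_1 inner_vec_def sum_3)
  define q where "q i = (if i \<in> U then comb (Z i $ 1) (Z i $ 2) else reflection n (comb (Z (g i) $ 1) (Z (g i) $ 2)))" for i
  have qg: "q (g i) = reflection n (q i)" for i by (simp add: q_def)
  have qj: "c1 (q j) = Z j $ 1" "c2 (q j) = Z j $ 2" using j(1) by (simp_all add: q_def)
  have nq: "norm (q i) = 1" if "i \<in> VH" for i
    using that j(2) qj Zsq by (auto simp: norm_eq_1 inner_c1_c2 qg)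
  have fr: "reflection_framework VP VH E g U E0 n q q"
    by unfold_locales (use qg nq in \<open>auto intro!: bexI[of _ 1]\<close>)
  interpret R: reflection_framework VP VH E g U E0 act n q q by (rule fr) (rule act_def)
  have XZ: "R.Y $ u = k u *\<^sub>R tilt s t (Y $ u)" if "u \<in> U" for u
  proof -
    have "R.X u = Z u"
      using that VHU[OF that] Z3[of u] by (auto simp: R.X_def q_def vec_eq_iff forall_3)
    then show ?thesis by (simp add: Z_def T_def)
  qed
  have sv: "sverts F \<subseteq> U" if "F \<subseteq> E0" for F using that E0_U by (force simp: sverts_def)
  have "indep_family F1 (orbit_row 1 R.Y)"
    by (rule indep_family_tilt[OF Y(1) st, where k=k]) (use sv[OF F(1)] XZ k in auto)
  moreover have "indep_family F2 (orbit_row (-1) R.Y)"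
    by (rule indep_family_tilt[OF Y(2) st, where k=k]) (use sv[OF F(3)] XZ k in auto)
  ultimately have "card F1 \<le> R.rk 1" "card F2 \<le> R.rk (-1)" using R.rk_ge F(1,3) by auto
  then have dim: "dim (inf_motions VP VH E q q) + card F1 + card F2 \<le> 4 * card U"
    using R.dim_motions by linarith
  \<comment> \<open>The two lines suffice: both pass through the origin, and they differ because the
    normal has nonzero components along and across the mirror.\<close>
  have aff: "affine hull (q ` VP \<union> (\<Union>j\<in>VH. line_of (q j) 0)) = UNIV" (is "affine hull ?S = _")
  proof -
    have 0: "0 \<in> ?S" using j(2) by (auto simp: line_of_def)
    let ?x = "comb (- (Z j $ 2)) (Z j $ 1)" and ?y = "comb (Z j $ 2) (Z j $ 1)"
    have "?x \<in> line_of (q j) 0" by (simp add: line_of_def inner_c1_c2 qj)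
    moreover have "?y \<in> line_of (q (g j)) 0" by (simp add: line_of_def inner_c1_c2 qg qj)
    ultimately have xy: "?x \<in> span ?S" "?y \<in> span ?S" using j(2) by (auto intro: span_base)
    have "v \<in> span ?S" for v
    proof -
      define A B where "A = c1 v / (2 * Z j $ 2)" and "B = c2 v / (2 * Z j $ 1)"
      have "v = (B - A) *\<^sub>R ?x + (A + B) *\<^sub>R ?y"
        using Zj by (simp add: vec2_eq_iff A_def B_def field_simps)
      moreover have "(B - A) *\<^sub>R ?x + (A + B) *\<^sub>R ?y \<in> span ?S"
        by (intro span_add span_scale xy)
      ultimately show ?thesis by metis
    qed
    then have "span ?S = UNIV" by blast
    moreover have "affine hull ?S = span ?S" using 0 by (intro affine_hull_span_0 hull_inc)
    ultimately show ?thesis by simp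
  qed
  have "symmetric_framework VP VH \<theta> \<tau> q q (\<lambda>_. 0)"
    unfolding symmetric_framework_def point_line_framework_def bit_all \<theta> \<tau>
    using nq aff qg by auto
  then show ?thesis using fr dim by blast
qed

lemma sparse_bound:
  assumes "F \<subseteq> E0" "signed_sparse m F" "m \<le> 2"
  shows "card F + m \<le> 2 * card U"
proof (cases "F = {}")
  case True
  have "card U > 0" using VH_orbit by (auto simp: card_gt_0_iff)
  then show ?thesis using True assms(3) by simp
next
  case False
  then have "card F + m \<le> 2 * card (sverts F)" using assms(2) unfolding signed_sparse_def by blast
  moreover have "card (sverts F) \<le> card U"
    using assms(1) E0_U by (intro card_mono) (force simp: sverts_def)+
  ultimately show ?thesis by linarith
qed

end

section \<open>The characterisation\<close>

lemma iso_onto_Cs_reflection: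
  assumes "iso_onto_Cs \<tau>"
  obtains n where "norm n = 1" "\<tau> 0 = id" "\<tau> 1 = reflection n"
proof -
  obtain n where n: "norm n = 1" and bij: "bij_betw \<tau> UNIV {id, reflection n}"
    and hom: "\<And>\<delta> eps. \<tau> (\<delta> + eps) = \<tau> \<delta> \<circ> \<tau> eps"
    using assms by (auto simp: iso_onto_Cs_def)
  have ne: "\<tau> 0 \<noteq> \<tau> 1" using bij by (auto simp: bij_betw_def inj_on_def)
  have rng: "\<tau> \<delta> = id \<or> \<tau> \<delta> = reflection n" for \<delta> using bij by (auto simp: bij_betw_def)
  have "reflection n \<circ> reflection n = id"
  proof -
    interpret mirror n by unfold_locales (rule n)
    show ?thesis by (auto simp: fun_eq_iff)
  qed
  then have "\<tau> 0 = id" using hom[of 0 0] rng[of 0] by auto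
  then show thesis using that n rng[of 1] ne by auto
qed

theorem theorem5p4:
  fixes VP VH :: "'v::finite set"
    and E :: "'v set set"
    and \<theta> :: "bit \<Rightarrow> 'v \<Rightarrow> 'v"
    and \<tau> :: "bit \<Rightarrow> real^2 \<Rightarrow> real^2"
    and p a :: "'v \<Rightarrow> real^2"
    and r :: "'v \<Rightarrow> real"
    and G0 :: "('v set, 'v set set, bit) gain_graph"
  assumes "point_line_graph VP VH E"
    and "card VH = 2"
    and "Aut_PH_action VP VH E \<theta>"
    and "free_action \<theta>"
    and "iso_onto_Cs \<tau>"
    and "regular_framework VP VH E \<theta> \<tau> p a r"
    and "quotient_gain_graph E \<theta> G0"
  shows "(infinitesimally_rigid VP VH E p a \<longleftrightarrow>
           (\<forall>i\<in>{1, 2}. \<exists>H. spanning_gain_subgraph H G0 \<and> gain_tight 2 3 i H)) \<and>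
         (forced_symmetric_rigid VP VH E \<theta> \<tau> p a \<longleftrightarrow>
           (\<exists>H. spanning_gain_subgraph H G0 \<and> gain_tight 2 3 1 H))"
proof -
  obtain n where n: "norm n = 1" and \<tau>: "\<tau> 0 = id" "\<tau> 1 = reflection n"
    using iso_onto_Cs_reflection[OF assms(5)] by blast
  define g where "g = \<theta> 1"
  have aut: "bij (\<theta> \<delta>)" "{\<theta> \<delta> i, \<theta> \<delta> j} \<in> E \<longleftrightarrow> {i, j} \<in> E" "\<theta> \<delta> ` VP = VP" for \<delta> i j
    using assms(3) by (auto simp: Aut_PH_action_def Aut_PH_def)
  have hom: "\<theta> (\<delta> + eps) = \<theta> \<delta> \<circ> \<theta> eps" for \<delta> eps using assms(3) by (simp add: Aut_PH_action_def)
  have "\<theta> 0 (\<theta> 0 i) = \<theta> 0 i" for i using hom[of 0 0] by (metis add_0 comp_apply)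
  then have \<theta>0: "\<theta> 0 = id" using aut(1)[of 0] by (metis bij_def eq_id_iff injD)
  have \<theta>: "\<theta> 0 = id" "\<theta> 1 = g" using \<theta>0 by (simp_all add: g_def)
  have gg: "g (g i) = i" for i using hom[of 1 1] \<theta>0 by (metis bit_add_self comp_apply id_apply g_def)
  have free: "g i \<noteq> i" for i using assms(4) by (auto simp: free_action_def g_def)
  have VP: "i \<in> VH \<longleftrightarrow> i \<notin> VP" for i using assms(1) by (auto simp: point_line_graph_def)
  have gVP: "g i \<in> VP \<longleftrightarrow> i \<in> VP" for i using aut(3)[of 1] gg unfolding g_def[symmetric] by (metis image_eqI)
  have \<theta>act: "\<theta> \<delta> i = (if \<delta> = 0 then i else g i)" for \<delta> i by (cases \<delta>) (simp_all add: \<theta>)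
  have orb: "vertex_orbit \<theta> i = {i, g i}" for i
  proof -
    have "vertex_orbit \<theta> i = (\<lambda>\<delta>. \<theta> \<delta> i) ` {0, 1}"
      unfolding vertex_orbit_def by (auto simp: image_iff) (metis bit_not_zero_iff)+
    then show ?thesis by (simp add: \<theta>)
  qed
  note quot = assms(7)[unfolded quotient_gain_graph_def]
  have V: "gverts G0 = range (vertex_orbit \<theta>)" and EE: "gedges G0 = edge_orbit \<theta> ` E"
    using quot[THEN conjunct1] quot[THEN conjunct2, THEN conjunct1] .
  obtain rep where rep0: "(\<forall>X \<in> gverts G0. rep X \<in> X) \<and>
       (\<forall>e \<in> gedges G0. gtail G0 e \<in> gverts G0 \<and> ghead G0 e \<in> gverts G0 \<and>
          e = {{\<theta> \<delta> (rep (gtail G0 e)), \<theta> (\<delta> + ggain G0 e) (rep (ghead G0 e))} | \<delta>. True})"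
    using quot[THEN conjunct2, THEN conjunct2] by (rule exE)
  have rep: "rep A \<in> A" if "A \<in> gverts G0" for A using rep0[THEN conjunct1] that by (rule bspec)
  note edge0 = rep0[THEN conjunct2, THEN bspec]
  have ends: "gtail G0 e \<in> gverts G0 \<and> ghead G0 e \<in> gverts G0" if "e \<in> gedges G0" for e
    using edge0[OF that, THEN conjunct1] edge0[OF that, THEN conjunct2, THEN conjunct1] by (rule conjI)
  have edge: "e = {{\<theta> \<delta> (rep (gtail G0 e)), \<theta> (\<delta> + ggain G0 e) (rep (ghead G0 e))} | \<delta>. True}"
    if "e \<in> gedges G0" for e
    using edge0[OF that, THEN conjunct2, THEN conjunct2] .
  define U where "U = rep ` gverts G0"
  define E0 where "E0 = edge_triple rep G0 ` gedges G0"
  have orb_eq: "A = {x, g x}" if "A \<in> gverts G0" "x \<in> A" for A x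
    using that gg by (auto simp: V orb)
  have inj_rep: "inj_on rep (gverts G0)"
    using orb_eq rep by (intro inj_onI) metis
  have gU: "g u \<in> U \<longleftrightarrow> u \<notin> U" for u
  proof
    assume "g u \<in> U"
    show "u \<notin> U"
    proof
      assume "u \<in> U"
      then obtain A where A: "A \<in> gverts G0" "rep A = u" unfolding U_def by blast
      obtain B where B: "B \<in> gverts G0" "rep B = g u" using \<open>g u \<in> U\<close> unfolding U_def by (metis imageE)
      have "A = {u, g u}" using orb_eq[OF A(1) rep[OF A(1)]] by (simp add: A(2))
      moreover have "B = {g u, u}" using orb_eq[OF B(1) rep[OF B(1)]] by (simp add: B(2) gg)
      ultimately have "A = B" by (simp add: insert_commute)
      then show False using A(2) B(2) free[of u] by simp
    qed
  next
    assume "u \<notin> U"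
    have "{u, g u} \<in> gverts G0" using orb[of u] V by blast
    then have "rep {u, g u} \<in> {u, g u}" "rep {u, g u} \<in> U" using rep by (auto simp: U_def)
    then show "g u \<in> U" using \<open>u \<notin> U\<close> by auto
  qed
  have in_E: "f \<in> E" if ef: "e \<in> gedges G0" "f \<in> e" for e f
  proof -
    obtain f0 \<delta> where f0: "f0 \<in> E" "f = \<theta> \<delta> ` f0" using ef by (auto simp: EE edge_orbit_def)
    then have "card f0 = 2" using assms(1) by (simp add: point_line_graph_def)
    then obtain i j where "f0 = {i, j}" by (auto simp: card_2_iff)
    then show ?thesis using f0 aut(2) by simp
  qed
  have E_E0: "{i, j} \<in> E \<longleftrightarrow> (\<exists>u w \<alpha> \<delta>. (u, w, \<alpha>) \<in> E0 \<and>
      {i, j} = {if \<delta> = 0 then u else g u, if \<delta> + \<alpha> = 0 then w else g w})" (is "_ \<longleftrightarrow> ?R i j") for i j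
  proof
    assume ij: "{i, j} \<in> E"
    define e where "e = edge_orbit \<theta> {i, j}"
    have e: "e \<in> gedges G0" using ij by (simp add: EE e_def)
    have "\<theta> 0 ` {i, j} \<in> e" unfolding e_def edge_orbit_def by blast
    then have "{i, j} \<in> e" by (simp add: \<theta>0)
    then obtain \<delta> where "{i, j} = {\<theta> \<delta> (rep (gtail G0 e)), \<theta> (\<delta> + ggain G0 e) (rep (ghead G0 e))}"
      using edge[OF e] by blast
    moreover have "(rep (gtail G0 e), rep (ghead G0 e), ggain G0 e) \<in> E0"
      using e by (auto simp: E0_def edge_triple_def)
    ultimately show "?R i j"
      unfolding \<theta>act by blast
  next
    assume "?R i j"
    then obtain e \<delta> where e: "e \<in> gedges G0"
      and "{i, j} = {\<theta> \<delta> (rep (gtail G0 e)), \<theta> (\<delta> + ggain G0 e) (rep (ghead G0 e))}"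
      unfolding E0_def edge_triple_def \<theta>act by blast
    then have "{i, j} \<in> e" using edge[OF e] by blast
    then show "{i, j} \<in> E" by (rule in_E[OF e])
  qed
  have inj_tri: "inj_on (edge_triple rep G0) (gedges G0)"
  proof (rule inj_onI)
    fix e f assume ef: "e \<in> gedges G0" "f \<in> gedges G0" "edge_triple rep G0 e = edge_triple rep G0 f"
    then show "e = f" using edge[OF ef(1)] edge[OF ef(2)] by (simp add: edge_triple_def)
  qed
  have cardU: "card (gverts G0) = card U" unfolding U_def using card_image[OF inj_rep] by simp
  interpret symmetric_graph VP VH E g U E0 "\<lambda>\<delta> i. if \<delta> = 0 then i else g i" n
  proof unfold_locales
    show "u \<in> U \<and> w \<in> U" if "(u, w, \<alpha>) \<in> E0" for u w \<alpha>
      using that ends by (auto simp: E0_def edge_triple_def U_def)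
  qed (use VP gg gVP gU E_E0 n assms(2) in auto)
  have sym: "symmetric_framework VP VH \<theta> \<tau> p a r"
    and reg: "\<And>q b s. symmetric_framework VP VH \<theta> \<tau> q b s \<Longrightarrow>
      rigidity_rank VP VH E q b \<le> rigidity_rank VP VH E p a"
    using assms(6) by (auto simp: regular_framework_def)
  interpret R: reflection_framework VP VH E g U E0 "\<lambda>\<delta> i. if \<delta> = 0 then i else g i" n p a
  proof unfold_locales
    show "p (g i) = reflection n (p i)" if "i \<in> VP" for i
      using sym that unfolding symmetric_framework_def by (metis \<theta>(2) \<tau>(2))
    show "\<exists>\<sigma>\<in>{1, -1}. reflection n (a j) = \<sigma> *\<^sub>R a (g j)" if "j \<in> VH" for j
      using sym that unfolding symmetric_framework_def by (metis \<theta>(2) \<tau>(2))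
    show "norm (a j) = 1" if "j \<in> VH" for j
      using sym that by (simp add: symmetric_framework_def point_line_framework_def)
  qed
  \<comment> \<open>Here regularity enters: the realisation of \<open>F1\<close> and
    \<open>F2\<close> competes with the given framework, whose motion space is of least
    dimension.\<close>
  have max: "card F1 + card F2 \<le> R.rk 1 + R.rk (-1)"
    if F: "F1 \<subseteq> E0" "signed_sparse 1 F1" "F2 \<subseteq> E0" "signed_sparse 2 F2" for F1 F2
  proof -
    obtain q where q: "symmetric_framework VP VH \<theta> \<tau> q q (\<lambda>_. 0)" "reflection_framework VP VH E g U E0 n q q"
      "dim (inf_motions VP VH E q q) + card F1 + card F2 \<le> 4 * card U"
      using realization[OF F \<theta> \<tau>] by blast
    have "dim (inf_motions VP VH E p a) \<le> dim (inf_motions VP VH E q q)"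
      using reg[OF q(1)] R.dim_motions_rank reflection_framework.dim_motions_rank[OF q(2)] by linarith
    then show ?thesis using q(3) R.dim_motions by linarith
  qed
  obtain B1 where B1: "B1 \<subseteq> E0" "signed_sparse 1 B1" "card B1 = R.rk 1"
    using R.rk_sparse[of 1 1] by auto
  obtain B2 where B2: "B2 \<subseteq> E0" "signed_sparse 2 B2" "card B2 = R.rk (-1)"
    using R.rk_sparse[of 2 "-1"] by auto
  note bounds = sparse_bound[OF B1(1,2)] sparse_bound[OF B2(1,2)]
  have tight: "(\<exists>H. spanning_gain_subgraph H G0 \<and> gain_tight 2 3 (int m) H) \<longleftrightarrow>
      (\<exists>F\<subseteq>E0. signed_sparse m F \<and> card F + m = 2 * card U)" for m
    unfolding E0_def cardU[symmetric] by (rule spanning_tight_iff[OF inj_rep inj_tri ends])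
  have t1: "(\<exists>H. spanning_gain_subgraph H G0 \<and> gain_tight 2 3 1 H) \<longleftrightarrow> R.rk 1 + 1 = 2 * card U"
  proof -
    \<comment> \<open>The bound \<open>max\<close> concerns the sum of the ranks; pairing
      \<open>F\<close> with \<open>B2\<close>, which attains the rank of the other block, isolates
      this one.\<close>
    have "card F \<le> R.rk 1" if "F \<subseteq> E0" "signed_sparse 1 F" for F using max[OF that B2(1,2)] B2(3) by simp
    then have "(\<exists>F\<subseteq>E0. signed_sparse 1 F \<and> card F + 1 = 2 * card U) \<longleftrightarrow> R.rk 1 + 1 = 2 * card U"
      using B1 bounds(1) by (metis add_le_mono1 le_antisym one_le_numeral)
    then show ?thesis using tight[of 1] by simp
  qed
  have t2: "(\<exists>H. spanning_gain_subgraph H G0 \<and> gain_tight 2 3 2 H) \<longleftrightarrow> R.rk (-1) + 2 = 2 * card U"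
  proof -
    have "card F \<le> R.rk (-1)" if "F \<subseteq> E0" "signed_sparse 2 F" for F using max[OF B1(1,2) that] B1(3) by simp
    then have "(\<exists>F\<subseteq>E0. signed_sparse 2 F \<and> card F + 2 = 2 * card U) \<longleftrightarrow> R.rk (-1) + 2 = 2 * card U"
      using B2 bounds(2) by (metis add_le_mono1 le_antisym order_refl)
    then show ?thesis using tight[of 2] by simp
  qed
  \<comment> \<open>The motion space has dimension 4|U| minus both ranks, and these are at most 2|U|
    - 1 and 2|U| - 2; dimension 3 means equality in both.\<close>
  have "infinitesimally_rigid VP VH E p a \<longleftrightarrow> R.rk 1 + 1 = 2 * card U \<and> R.rk (-1) + 2 = 2 * card U"
    unfolding infinitesimally_rigid_def using R.dim_motions bounds B1(3) B2(3) by auto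
  moreover have "forced_symmetric_rigid VP VH E \<theta> \<tau> p a \<longleftrightarrow> R.rk 1 + 1 = 2 * card U"
    unfolding R.forced_symmetric_rigid_iff[OF \<theta> \<tau> assms(2)]
    using R.dim_block[of 1] bounds(1) B1(3) by auto
  ultimately show ?thesis using t1 t2 by simp
qed

end
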